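(* Let $1<p<\infty$. Every function in $H^p(\Omega_+)$ is the Cauchy integral of its non-tangential boundary limit: if $F\in H^p(\Omega_+)$ and $F(\zeta)$ denotes its non-tangential boundary limit (which exists for almost every $\zeta\in\Gamma$), then \[F(w)=\frac1{2\pi\mathrm{i}}\int_\Gamma\frac{F(\zeta)}{\zeta-w}\,\mathrm{d}\zeta\qquad\text{for all }w\in\Omega_+.\]
   Context: Let $a\colon\mathbb{R}\to\mathbb{R}$ satisfy $|a(u_1)-a(u_2)|\le M|u_1-u_2|$ for all $u_1,u_2\in\mathbb{R}$, with a fixed $M>0$. Let $\Gamma=\{\zeta(u)=u+\mathrm{i}a(u)\colon u\in\mathbb{R}\}$, oriented by increasing $u$, with arc length measure $|\mathrm{d}\zeta|$, and $\Omega_+=\{u+\mathrm{i}v\colon v>a(u)\}$. $H^p(\Omega_+)$ is the space of holomorphic $F$ on $\Omega_+$ with $\sup_{\tau>0}\int_{\Gamma}|F(\zeta+\mathrm{i}\tau)|^p\,|\mathrm{d}\zeta|<\infty$. Non-tangential limits: let $\zeta_0=\zeta(u_0)$ be such that $\zeta'(u_0)=|\zeta'(u_0)|\mathrm{e}^{\mathrm{i}\phi_0}$ exists, with $\phi_0\in(-\frac\pi2,\frac\pi2)$. For $\phi\in(0,\frac\pi2)$ let $\Omega_\phi(\zeta_0)=\{\zeta_0+r\mathrm{e}^{\mathrm{i}\theta}\colon r>0,\ \theta-\phi_0\in(\phi,\pi-\phi)\}$. A function $F$ on $\Omega_+$ has non-tangential boundary limit $l$ at $\zeta_0$ if for every $\phi\in(0,\frac\pi2)$,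 $F(w)\to l$ as $w\to\zeta_0$ with $w\in\Omega_\phi(\zeta_0)\cap\Omega_+$. *)

theory Defs
  imports "HOL-Complex_Analysis.Complex_Analysis"
begin

definition graph_point :: "(real \<Rightarrow> real) \<Rightarrow> real \<Rightarrow> complex" where
  "graph_point a u = Complex u (a u)"

definition graph_curve :: "(real \<Rightarrow> real) \<Rightarrow> complex set" where
  "graph_curve a = range (graph_point a)"

definition upper_domain :: "(real \<Rightarrow> real) \<Rightarrow> complex set" where
  "upper_domain a = {w. Im w > a (Re w)}"

text \<open>For Lipschitz \<open>a\<close> the derivative of \<open>graph_point a\<close> exists almost everywhere;
  elsewhere \<^const>\<open>vector_derivative\<close> is an arbitrary fixed value, which affects neither
  the measure nor the integrals below.\<close>

definition arc_length :: "(real \<Rightarrow> real) \<Rightarrow> complex measure" where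
  "arc_length a =
     distr (density lebesgue (\<lambda>u. ennreal (norm (vector_derivative (graph_point a) (at u)))))
       (restrict_space borel (graph_curve a)) (graph_point a)"

text \<open>Line integrals over the graph, oriented by increasing \<open>u\<close>. The measure is
  \<^const>\<open>lebesgue\<close> rather than \<^const>\<open>lborel\<close> because integrands will be prescribed only
  almost everywhere, so they need not be Borel measurable.\<close>

definition line_integrable :: "(real \<Rightarrow> real) \<Rightarrow> (complex \<Rightarrow> complex) \<Rightarrow> bool" where
  "line_integrable a g \<longleftrightarrow>
     integrable lebesgue (\<lambda>u. g (graph_point a u) * vector_derivative (graph_point a) (at u))"

definition line_integral :: "(real \<Rightarrow> real) \<Rightarrow> (complex \<Rightarrow> complex) \<Rightarrow> complex" where
  "line_integral a g =
     (LINT u|lebesgue. g (graph_point a u) * vector_derivative (graph_point a) (at u))"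

definition hardy_space :: "(real \<Rightarrow> real) \<Rightarrow> real \<Rightarrow> (complex \<Rightarrow> complex) set" where
  "hardy_space a p =
     {F. F holomorphic_on upper_domain a \<and>
         (SUP \<tau>\<in>{0<..}. \<integral>\<^sup>+\<zeta>. ennreal (norm (F (\<zeta> + \<i> * complex_of_real \<tau>)) powr p) \<partial>arc_length a) < \<infinity>}"

definition sector :: "complex \<Rightarrow> real \<Rightarrow> real \<Rightarrow> complex set" where
  "sector \<zeta>\<^sub>0 \<phi>\<^sub>0 \<phi> =
     {\<zeta>\<^sub>0 + complex_of_real r * exp (\<i> * complex_of_real \<theta>) | r \<theta>.
        r > 0 \<and> \<theta> - \<phi>\<^sub>0 \<in> {\<phi><..<pi - \<phi>}}"

text \<open>At points of the graph without a tangent no number is a non-tangential limit. The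
  parameter \<open>u\<^sub>0\<close> and the angle \<open>\<phi>\<^sub>0\<close> are uniquely determined by \<open>\<zeta>\<^sub>0\<close>, since
  the derivative \<open>d\<close> has real part 1.\<close>

definition has_nontangential_limit ::
    "(real \<Rightarrow> real) \<Rightarrow> (complex \<Rightarrow> complex) \<Rightarrow> complex \<Rightarrow> complex \<Rightarrow> bool" where
  "has_nontangential_limit a F \<zeta>\<^sub>0 l \<longleftrightarrow>
     (\<exists>u\<^sub>0 d \<phi>\<^sub>0. \<zeta>\<^sub>0 = graph_point a u\<^sub>0 \<and>
        (graph_point a has_vector_derivative d) (at u\<^sub>0) \<and>
        \<phi>\<^sub>0 \<in> {-(pi/2)<..<pi/2} \<and>
        d = complex_of_real (norm d) * exp (\<i> * complex_of_real \<phi>\<^sub>0) \<and>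
        (\<forall>\<phi>\<in>{0<..<pi/2}. (F \<longlongrightarrow> l) (at \<zeta>\<^sub>0 within sector \<zeta>\<^sub>0 \<phi>\<^sub>0 \<phi> \<inter> upper_domain a)))"

end

theory Submission
  imports Defs
begin

text \<open>The proof avoids harmonic measure, maximal functions, and singular integrals; everything is deduced
  from a primitive \<open>G\<close> of \<open>F\<close>, which exists because the domain \<open>\<Omega>\<close> above the graph is simply connected.

  The bound on the \<open>p\<close>-th power integrals over the shifted graphs makes the increments of \<open>G\<close> along
  them uniformly small on short arcs. Applied once more to a primitive of \<open>G\<close>, this shows
  that \<open>G\<close> is uniformly continuous on \<open>\<Omega>\<close> (\<open>primitive_uniformly_continuous\<close>), so \<open>G\<close> extends continuously
  to the graph, and \<open>F\<close> is bounded at positive distance from the graph.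

  Along the graph the increments of \<open>G\<close> are dominated by those of a monotone function, namely a lower
  limit of the distribution functions of the \<open>p\<close>-th power of \<open>F\<close> on the shifted graphs. Hence
  Lebesgue's theorem on monotone functions, proved here from Vitali's covering theorem, makes \<open>G\<close>
  differentiable along the graph almost everywhere (\<open>boundary_primitive_differentiable_AE\<close>). At a point
  where in addition the tangent exists, a Phragmen-Lindelof argument (\<open>local_phragmen_lindelof\<close>) carries
  the first-order expansion of \<open>G\<close> from the graph into \<open>\<Omega>\<close>, and Cauchy's estimate turns it into
  the nontangential limit of \<open>F = G'\<close> (\<open>nontangential_limit_of_derivative\<close>).

  The Cauchy formula holds for the shifted graphs, by closing the contour far away
  (\<open>cauchy_formula_slice\<close>). As the shift tends to zero, the values of \<open>F\<close> converge almost everywhere to the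
  nontangential limits with bounded \<open>p\<close>-norms, and \<open>1 < p\<close> makes the integrals against the Cauchy
  kernel converge (\<open>weak_convergence_of_AE_bounded\<close>).\<close>

section \<open>Differentiation of monotone functions\<close>

text \<open>A one-dimensional form of Vitali's covering theorem in which the intervals need not be centred at
  the points of \<open>S\<close>. Both \<open>S\<close> and the predicate are arbitrary, so no measurability of the sets of
  points with a given rate of growth has to be established anywhere below.\<close>

lemma vitali_intervals:
  fixes S U :: "real set" and P :: "real \<Rightarrow> real \<Rightarrow> bool"
  assumes "open U" "S \<subseteq> U"
    and S: "\<And>x d. x \<in> S \<Longrightarrow> 0 < d \<Longrightarrow> \<exists>s t. s < x \<and> x < t \<and> t - s < d \<and> P s t"
  obtains I :: "(real \<times> real) set" where "countable I"
    "\<And>i. i \<in> I \<Longrightarrow> fst i < snd i \<and> P (fst i) (snd i) \<and> {fst i<..<snd i} \<subseteq> U"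
    "disjoint_family_on (\<lambda>i. {fst i<..<snd i}) I"
    "negligible (S - (\<Union>i\<in>I. {fst i<..<snd i}))"
proof -
  let ?K = "{i::real\<times>real. fst i < snd i \<and> P (fst i) (snd i) \<and> {fst i<..<snd i} \<subseteq> U}"
  let ?a = "\<lambda>i::real\<times>real. (fst i + snd i) / 2"
  let ?r = "\<lambda>i::real\<times>real. (snd i - fst i) / 2"
  have ball: "ball (?a i) (?r i) = {fst i<..<snd i}" for i
  proof -
    have "?a i - ?r i = fst i" "?a i + ?r i = snd i" by argo+
    then show ?thesis by (simp only: ball_eq_greaterThanLessThan)
  qed
  have *: "\<exists>i. i \<in> ?K \<and> x \<in> ball (?a i) (?r i) \<and> ?r i < d" if "x \<in> S" "0 < d" for x d
  proof -
    obtain e where e: "e > 0" "ball x e \<subseteq> U"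
      using openE[OF \<open>open U\<close>, of x] \<open>S \<subseteq> U\<close> \<open>x \<in> S\<close> by blast
    obtain s t where st: "s < x" "x < t" "t - s < min d e" "P s t"
      using S[OF \<open>x \<in> S\<close>, of "min d e"] e \<open>0 < d\<close> by auto
    have "{s<..<t} \<subseteq> ball x e"
      using st by (auto simp: dist_real_def)
    with e st have "(s,t) \<in> ?K" by auto
    moreover have "x \<in> ball (?a (s,t)) (?r (s,t))" unfolding ball using st by auto
    moreover have "?r (s,t) < d" using st by auto
    ultimately show ?thesis by blast
  qed
  obtain C where C: "countable C" "C \<subseteq> ?K"
     "pairwise (\<lambda>i j. disjnt (ball (?a i) (?r i)) (ball (?a j) (?r j))) C"
     "negligible(S - (\<Union>i \<in> C. ball (?a i) (?r i)))"
    using Vitali_covering_theorem_balls[of S ?K ?a ?r, OF *] by blast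
  show ?thesis
  proof (rule that[OF C(1)])
    show "disjoint_family_on (\<lambda>i. {fst i<..<snd i}) C"
      using C(3) unfolding ball by (auto simp: disjoint_family_on_def pairwise_def disjnt_def)
    show "negligible (S - (\<Union>i\<in>C. {fst i<..<snd i}))" using C(4) unfolding ball .
  qed (use C(2) in auto)
qed

lemma emeasure_intervals:
  fixes N :: "real measure"
  assumes "sets N = sets borel" "countable I" "disjoint_family_on (\<lambda>i. {fst i<..<snd i}) (I :: (real\<times>real) set)"
  shows "emeasure N (\<Union>i\<in>I. {fst i<..<snd i}) = (\<integral>\<^sup>+i. emeasure N {fst i<..<snd i} \<partial>count_space I)"
  using assms by (intro emeasure_UN_countable) auto

lemma vitali_expanding:
  fixes N :: "real measure"
  assumes N: "sets N = sets borel" and "open U" "S \<subseteq> U" and "C \<ge> 0"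
    and S: "\<And>x d. x \<in> S \<Longrightarrow> 0 < d \<Longrightarrow> \<exists>s t. s < x \<and> x < t \<and> t - s < d \<and> ennreal (C * (t - s)) \<le> emeasure N {s<..<t}"
  shows "ennreal C * outer_measure_of lebesgue S \<le> emeasure N U"
proof -
  obtain I :: "(real \<times> real) set" where I: "countable I"
    "\<And>i. i \<in> I \<Longrightarrow> fst i < snd i \<and> ennreal (C * (snd i - fst i)) \<le> emeasure N {fst i<..<snd i} \<and> {fst i<..<snd i} \<subseteq> U"
    "disjoint_family_on (\<lambda>i. {fst i<..<snd i}) I"
    "negligible (S - (\<Union>i\<in>I. {fst i<..<snd i}))"
    using vitali_intervals[where P="\<lambda>s t. ennreal (C * (t - s)) \<le> emeasure N {s<..<t}", OF \<open>open U\<close> \<open>S \<subseteq> U\<close> S] 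
    by blast
  let ?W = "\<Union>i\<in>I. {fst i<..<snd i}"
  have W: "?W \<in> sets borel" using I(1) by (intro borel_open) auto
  have nW: "S - ?W \<in> null_sets lebesgue" using I(4) negligible_iff_null_sets by blast
  have "outer_measure_of lebesgue S \<le> outer_measure_of lebesgue (?W \<union> (S - ?W))"
    by (intro outer_measure_of_mono) auto
  also have "\<dots> = emeasure lebesgue (?W \<union> (S - ?W))"
    using W nW by (intro outer_measure_of_eq sets.Un) (auto simp: null_sets_def)
  also have "\<dots> = emeasure lborel ?W"
    using W nW by (subst emeasure_Un_null_set) auto
  finally have "ennreal C * outer_measure_of lebesgue S \<le> ennreal C * emeasure lborel ?W"
    by (rule mult_left_mono) simp
  also have "\<dots> = ennreal C * (\<integral>\<^sup>+i. emeasure lborel {fst i<..<snd i} \<partial>count_space I)"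
    by (subst emeasure_intervals) (use I in auto)
  also have "\<dots> = (\<integral>\<^sup>+i. ennreal C * emeasure lborel {fst i<..<snd i} \<partial>count_space I)"
    by (rule nn_integral_cmult[symmetric]) simp
  also have "\<dots> \<le> (\<integral>\<^sup>+i. emeasure N {fst i<..<snd i} \<partial>count_space I)"
  proof (rule nn_integral_mono)
    fix i assume "i \<in> space (count_space I)"
    then have "fst i < snd i" "ennreal (C * (snd i - fst i)) \<le> emeasure N {fst i<..<snd i}" using I(2)[of i] by auto
    then show "ennreal C * emeasure lborel {fst i<..<snd i} \<le> emeasure N {fst i<..<snd i}"
      using \<open>C \<ge> 0\<close> by (simp add: ennreal_mult)
  qed
  also have "\<dots> = emeasure N ?W" by (subst emeasure_intervals) (use I N in auto)
  also have "\<dots> \<le> emeasure N U" using I(2) \<open>open U\<close> N by (intro emeasure_mono) auto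
  finally show ?thesis .
qed

lemma vitali_contracting:
  fixes N :: "real measure"
  assumes N: "sets N = sets borel" and "open U" "S \<subseteq> U" and "c \<ge> 0"
    and S: "\<And>x d. x \<in> S \<Longrightarrow> 0 < d \<Longrightarrow> \<exists>s t. s < x \<and> x < t \<and> t - s < d \<and> emeasure N {s<..<t} \<le> ennreal (c * (t - s))"
  obtains W where "open W" "negligible (S - W)" "emeasure N W \<le> ennreal c * emeasure lborel U"
proof -
  obtain I :: "(real \<times> real) set" where I: "countable I"
    "\<And>i. i \<in> I \<Longrightarrow> fst i < snd i \<and> emeasure N {fst i<..<snd i} \<le> ennreal (c * (snd i - fst i)) \<and> {fst i<..<snd i} \<subseteq> U"
    "disjoint_family_on (\<lambda>i. {fst i<..<snd i}) I"
    "negligible (S - (\<Union>i\<in>I. {fst i<..<snd i}))"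
    using vitali_intervals[where P="\<lambda>s t. emeasure N {s<..<t} \<le> ennreal (c * (t - s))", OF \<open>open U\<close> \<open>S \<subseteq> U\<close> S] 
    by blast
  let ?W = "\<Union>i\<in>I. {fst i<..<snd i}"
  have "emeasure N ?W = (\<integral>\<^sup>+i. emeasure N {fst i<..<snd i} \<partial>count_space I)"
    by (subst emeasure_intervals) (use I N in auto)
  also have "\<dots> \<le> (\<integral>\<^sup>+i. ennreal c * emeasure lborel {fst i<..<snd i} \<partial>count_space I)"
  proof (rule nn_integral_mono)
    fix i assume "i \<in> space (count_space I)"
    then have "fst i < snd i" "emeasure N {fst i<..<snd i} \<le> ennreal (c * (snd i - fst i))" using I(2)[of i] by auto
    then show "emeasure N {fst i<..<snd i} \<le> ennreal c * emeasure lborel {fst i<..<snd i}"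
      using \<open>c \<ge> 0\<close> by (simp add: ennreal_mult)
  qed
  also have "\<dots> = ennreal c * (\<integral>\<^sup>+i. emeasure lborel {fst i<..<snd i} \<partial>count_space I)"
    by (rule nn_integral_cmult) simp
  also have "\<dots> = ennreal c * emeasure lborel ?W"
    by (subst emeasure_intervals) (use I in auto)
  also have "\<dots> \<le> ennreal c * emeasure lborel U"
    using I(2) \<open>open U\<close> by (intro mult_left_mono emeasure_mono) auto
  finally have le: "emeasure N ?W \<le> ennreal c * emeasure lborel U" .
  have "open ?W" by (intro open_UN ballI open_greaterThanLessThan)
  then show ?thesis by (rule that[OF _ I(4) le])
qed

lemma outer_measure_finite_open:
  fixes S :: "real set"
  assumes "bounded S" "e > 0"
  obtains m T where "outer_measure_of lebesgue S = ennreal m" "m \<ge> 0" "open T" "S \<subseteq> T" "emeasure lborel T \<le> ennreal (m + e)"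
proof -
  obtain E where E: "E \<in> sets lebesgue" "S \<subseteq> E" "outer_measure_of lebesgue S = emeasure lebesgue E"
    using outer_measure_of_attain[of S lebesgue] by auto
  obtain B where "\<forall>x\<in>S. norm x \<le> B" using \<open>bounded S\<close> unfolding bounded_iff by blast
  then have B: "S \<subseteq> cball 0 B" by auto
  have "outer_measure_of lebesgue S \<le> outer_measure_of lebesgue (cball 0 B :: real set)"
    by (rule outer_measure_of_mono[OF B])
  also have "\<dots> < \<infinity>" using emeasure_bounded_finite[OF bounded_cball, of "0::real" B] by simp
  finally have fin: "emeasure lebesgue E < \<infinity>" using E by simp
  define m where "m = measure lebesgue E"
  have m: "emeasure lebesgue E = ennreal m"
    unfolding m_def using fin by (intro emeasure_eq_ennreal_measure) auto
  obtain T where T: "open T" "E \<subseteq> T" "T - E \<in> lmeasurable" "emeasure lebesgue (T - E) < ennreal e"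
    using sets_lebesgue_outer_open[OF E(1) \<open>e > 0\<close>] by blast
  have "emeasure lborel T = emeasure lebesgue T" using T by auto
  also have "\<dots> = emeasure lebesgue (E \<union> (T - E))" using T by (simp add: Un_absorb1)
  also have "\<dots> \<le> emeasure lebesgue E + emeasure lebesgue (T - E)"
    using E T by (intro emeasure_subadditive) auto
  also have "\<dots> \<le> ennreal m + ennreal e" using T m by (auto intro: add_mono)
  also have "\<dots> = ennreal (m + e)" using \<open>e > 0\<close> by (simp add: m_def)
  finally show ?thesis using that[of m T] E m T by (auto simp: m_def)
qed

text \<open>The classical argument: choose an open set \<open>T\<close> around \<open>S\<close> with almost the outer measure
  \<open>m\<close> of \<open>S\<close>. The intervals of rate \<open>c\<close> give an open \<open>W\<close>, covering almost all of \<open>S\<close>, with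
  \<open>N W \<le> c * (m + e')\<close>. Covering \<open>S \<inter> W\<close> from inside \<open>W\<close> by the intervals of rate \<open>C\<close> gives
  \<open>C * m \<le> N W\<close>. Since \<open>c < C\<close>, this forces \<open>m = 0\<close>.\<close>

lemma negligible_two_rates:
  fixes N :: "real measure"
  assumes N: "sets N = sets borel" and "bounded S" and "0 \<le> c" "c < C"
    and S1: "\<And>x d. x \<in> S \<Longrightarrow> 0 < d \<Longrightarrow> \<exists>s t. s < x \<and> x < t \<and> t - s < d \<and> ennreal (C * (t - s)) \<le> emeasure N {s<..<t}"
    and S2: "\<And>x d. x \<in> S \<Longrightarrow> 0 < d \<Longrightarrow> \<exists>s t. s < x \<and> x < t \<and> t - s < d \<and> emeasure N {s<..<t} \<le> ennreal (c * (t - s))"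
  shows "negligible S"
proof -
  have *: "outer_measure_of lebesgue S \<le> ennreal e" if "e > 0" for e
  proof -
    define e' where "e' = e * (C - c) / (c + 1)"
    have e': "e' > 0" using assms that by (auto simp: e'_def)
    obtain m T where T: "outer_measure_of lebesgue S = ennreal m" "m \<ge> 0" "open T" "S \<subseteq> T" "emeasure lborel T \<le> ennreal (m + e')"
      using outer_measure_finite_open[OF \<open>bounded S\<close> e'] by blast
    obtain W where W: "open W" "negligible (S - W)" "emeasure N W \<le> ennreal c * emeasure lborel T"
      using vitali_contracting[OF N \<open>open T\<close> \<open>S \<subseteq> T\<close> \<open>0 \<le> c\<close> S2] by blast
    have "ennreal C * outer_measure_of lebesgue (S \<inter> W) \<le> emeasure N W"
      using assms W by (intro vitali_expanding[OF N]) auto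
    also have "\<dots> \<le> ennreal c * ennreal (m + e')" using W T by (meson mult_left_mono order_trans zero_le)
    finally have 1: "ennreal C * outer_measure_of lebesgue (S \<inter> W) \<le> ennreal (c * (m + e'))"
      using T e' assms by (simp add: ennreal_mult)
    obtain E where E: "E \<in> sets lebesgue" "S \<inter> W \<subseteq> E" "outer_measure_of lebesgue (S \<inter> W) = emeasure lebesgue E"
      using outer_measure_of_attain[of "S \<inter> W" lebesgue] by auto
    have nW: "S - W \<in> null_sets lebesgue" using W negligible_iff_null_sets by blast
    have "outer_measure_of lebesgue S \<le> outer_measure_of lebesgue (E \<union> (S - W))"
      using E by (intro outer_measure_of_mono) auto
    also have "\<dots> = emeasure lebesgue (E \<union> (S - W))"
      using E nW by (intro outer_measure_of_eq sets.Un) (auto simp: null_sets_def)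
    also have "\<dots> = emeasure lebesgue E" using E nW by (subst emeasure_Un_null_set) auto
    finally have "ennreal C * ennreal m \<le> ennreal (c * (m + e'))"
      using 1 E T by (metis mult_left_mono order_trans zero_le)
    then have "C * m \<le> c * (m + e')" using assms T e' by (simp add: ennreal_mult[symmetric])
    then have "(C - c) * m \<le> c * e'" by (simp add: algebra_simps)
    also have "\<dots> \<le> (c + 1) * e'" using e' by simp
    also have "\<dots> = (C - c) * e" using assms by (simp add: e'_def)
    finally have "m \<le> e" using assms by simp
    then show ?thesis using T by simp
  qed
  have "outer_measure_of lebesgue S \<le> 0"
    by (rule ennreal_le_epsilon) (use * in simp)
  then obtain E where E: "E \<in> sets lebesgue" "S \<subseteq> E" "emeasure lebesgue E = 0"
    using outer_measure_of_attain[of S lebesgue] by auto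
  then have "negligible E" unfolding negligible_iff_null_sets by (intro null_setsI)
  then show ?thesis by (rule negligible_subset) fact
qed

lemma negligible_infinite_rate:
  fixes N :: "real measure"
  assumes N: "sets N = sets borel" and "bounded S"
    and fin: "\<And>a b. emeasure N {a<..<b} < \<infinity>"
    and S1: "\<And>x d C. x \<in> S \<Longrightarrow> 0 < d \<Longrightarrow> 0 \<le> C \<Longrightarrow> \<exists>s t. s < x \<and> x < t \<and> t - s < d \<and> ennreal (C * (t - s)) \<le> emeasure N {s<..<t}"
  shows "negligible S"
proof -
  obtain B' where B': "\<forall>x\<in>S. norm x \<le> B'" using \<open>bounded S\<close> unfolding bounded_iff by blast
  define B where "B = B' + 1"
  have B: "norm x < B" if "x \<in> S" for x
    using B' that by (force simp: B_def)
  let ?U = "{-B<..<B}"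
  have SU: "S \<subseteq> ?U" proof
    fix x assume "x \<in> S"
    from B[OF this] show "x \<in> ?U" by (auto simp: abs_less_iff)
  qed
  define b where "b = measure N ?U"
  have b: "emeasure N ?U = ennreal b" unfolding b_def using fin by (intro emeasure_eq_ennreal_measure) (simp add: less_top)
  have "b \<ge> 0" by (simp add: b_def)
  obtain m T where T: "outer_measure_of lebesgue S = ennreal m" "m \<ge> 0" 
    using outer_measure_finite_open[OF \<open>bounded S\<close>, of 1] by auto
  have *: "C * m \<le> b" if "C \<ge> 0" for C
  proof -
    have "ennreal C * ennreal m \<le> ennreal b"
      using vitali_expanding[OF N _ SU that S1] that T b by auto
    then show ?thesis using \<open>b \<ge> 0\<close> that T by (simp add: ennreal_mult[symmetric])
  qed
  have "m = 0"
  proof (rule ccontr)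
    assume "m \<noteq> 0"
    with T have "m > 0" by simp
    then have "b + 1 \<le> b" using *[of "(b + 1) / m"] \<open>b \<ge> 0\<close> by simp
    then show False by simp
  qed
  then obtain E where E: "E \<in> sets lebesgue" "S \<subseteq> E" "emeasure lebesgue E = 0"
    using outer_measure_of_attain[of S lebesgue] T(1) by auto
  then have "negligible E" unfolding negligible_iff_null_sets by (intro null_setsI)
  then show ?thesis by (rule negligible_subset) fact
qed


text \<open>Almost every point lies outside the countable union, over rationals \<open>c < C\<close>, of the null sets
  where both rates occur at arbitrarily small scales, and has finite upper rate; there the supremum
  of the rates that occur at arbitrarily small scales is the limit.\<close>

lemma measure_derivative_AE:
  fixes N :: "real measure"
  assumes N: "sets N = sets borel" and fin: "\<And>a b. emeasure N {a<..<b} < \<infinity>"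
  shows "AE x in lebesgue. \<exists>L. \<forall>e>0. \<exists>d>0. \<forall>s t. s < x \<longrightarrow> x < t \<longrightarrow> t - s < d \<longrightarrow>
           \<bar>measure N {s<..<t} - L * (t - s)\<bar> \<le> e * (t - s)"
proof -
  define Up where "Up C = {x. \<forall>d>0. \<exists>s t. s < x \<and> x < t \<and> t - s < d \<and> ennreal (C * (t - s)) \<le> emeasure N {s<..<t}}" for C
  define Lo where "Lo c = {x. \<forall>d>0. \<exists>s t. s < x \<and> x < t \<and> t - s < d \<and> emeasure N {s<..<t} \<le> ennreal (c * (t - s))}" for c
  have em: "emeasure N {s<..<t} = ennreal (measure N {s<..<t})" for s t
    using fin by (intro emeasure_eq_ennreal_measure) (simp add: less_top)
  have Up_mono: "Up C \<subseteq> Up C'" if "C' \<le> C" for C C'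
  proof
    fix x assume x: "x \<in> Up C"
    show "x \<in> Up C'" unfolding Up_def
    proof (safe)
      fix d :: real assume "d > 0"
      then obtain s t where st: "s < x" "x < t" "t - s < d" "ennreal (C * (t - s)) \<le> emeasure N {s<..<t}"
        using x unfolding Up_def by blast
      have "C' * (t - s) \<le> C * (t - s)" using st that by (intro mult_right_mono) auto
      then have "ennreal (C' * (t - s)) \<le> emeasure N {s<..<t}" using st(4) ennreal_leI order_trans by blast
      then show "\<exists>s t. s < x \<and> x < t \<and> t - s < d \<and> ennreal (C' * (t - s)) \<le> emeasure N {s<..<t}" using st by blast
    qed
  qed
  have neg1: "negligible (Up C \<inter> Lo c)" if "0 \<le> c" "c < C" for c C
  proof -
    have "negligible (\<Union>n::nat. Up C \<inter> Lo c \<inter> {-real n..real n})"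
    proof (rule negligible_countable_Union, simp, clarsimp)
      fix n
      have sub: "Up C \<inter> Lo c \<inter> {-real n..real n} \<subseteq> Up C" "Up C \<inter> Lo c \<inter> {-real n..real n} \<subseteq> Lo c" by auto
      show "negligible (Up C \<inter> Lo c \<inter> {-real n..real n})"
      proof (rule negligible_two_rates[OF N _ that])
        show "bounded (Up C \<inter> Lo c \<inter> {-real n..real n})" by (rule bounded_subset[of "{-real n..real n}"]) auto
      qed (use sub in \<open>auto simp: Up_def Lo_def\<close>)
    qed
    moreover have "(\<Union>n::nat. Up C \<inter> Lo c \<inter> {-real n..real n}) = Up C \<inter> Lo c"
    proof (intro equalityI subsetI)
      fix x assume x: "x \<in> Up C \<inter> Lo c"
      obtain n :: nat where "\<bar>x\<bar> \<le> real n" using real_arch_simple by blast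
      then have "x \<in> {-real n..real n}" by auto
      then show "x \<in> (\<Union>n::nat. Up C \<inter> Lo c \<inter> {-real n..real n})" using x by blast
    qed auto
    ultimately show ?thesis by simp
  qed
  have neg2: "negligible (\<Inter>C\<in>{0..}. Up C)"
  proof -
    have "negligible (\<Union>n::nat. (\<Inter>C\<in>{0..}. Up C) \<inter> {-real n..real n})"
    proof (rule negligible_countable_Union, simp, clarsimp)
      fix n
      show "negligible ((\<Inter>C\<in>{0..}. Up C) \<inter> {-real n..real n})"
      proof (rule negligible_infinite_rate[OF N _ fin])
        show "bounded ((\<Inter>C\<in>{0..}. Up C) \<inter> {-real n..real n})" by (rule bounded_subset[of "{-real n..real n}"]) auto
      qed (auto simp: Up_def)
    qed
    moreover have "(\<Union>n::nat. (\<Inter>C\<in>{0..}. Up C) \<inter> {-real n..real n}) = (\<Inter>C\<in>{0..}. Up C)"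
    proof (intro equalityI subsetI)
      fix x assume x: "x \<in> (\<Inter>C\<in>{0..}. Up C)"
      obtain n :: nat where "\<bar>x\<bar> \<le> real n" using real_arch_simple by blast
      then have "x \<in> {-real n..real n}" by auto
      then show "x \<in> (\<Union>n::nat. (\<Inter>C\<in>{0..}. Up C) \<inter> {-real n..real n})" using x by blast
    qed auto
    ultimately show ?thesis by simp
  qed
  define Q where "Q = {cC \<in> \<rat> \<times> \<rat>. 0 \<le> fst cC \<and> fst cC < (snd cC :: real)}"
  define Bad where "Bad = (\<Inter>C\<in>{0..}. Up C) \<union> (\<Union>q\<in>Q. Up (snd q) \<inter> Lo (fst q))"
  have "countable Q"
    by (rule countable_subset[of _ "\<rat> \<times> \<rat>"]) (auto simp: Q_def countable_rat)
  then have "negligible (\<Union>q\<in>Q. Up (snd q) \<inter> Lo (fst q))"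
    by (intro negligible_countable_Union) (auto simp: Q_def intro!: neg1)
  then have "negligible Bad" unfolding Bad_def using neg2 by (rule negligible_Un[rotated])
  then have "Bad \<in> null_sets lebesgue" by (simp add: negligible_iff_null_sets)
  then have "AE x in lebesgue. x \<notin> Bad" by (rule AE_not_in)
  then show ?thesis
  proof (rule AE_mp, intro AE_I2 impI)
    fix x assume x: "x \<notin> Bad"
    obtain C0 where C0: "C0 \<ge> 0" "x \<notin> Up C0" using x unfolding Bad_def by auto
    define A where "A = {C. 0 \<le> C \<and> x \<in> Up C}"
    have A0: "0 \<in> A"
    proof -
      have "\<exists>s t. s < x \<and> x < t \<and> t - s < d" if "d > 0" for d
        by (rule exI[of _ "x - d/3"], rule exI[of _ "x + d/3"]) (use that in auto)
      then show ?thesis by (auto simp: A_def Up_def)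
    qed
    have bdd: "bdd_above A"
    proof (rule bdd_aboveI[of _ C0])
      fix C assume "C \<in> A"
      then have "x \<in> Up C" by (simp add: A_def)
      then show "C \<le> C0" using Up_mono[of C0 C] C0(2) by (cases "C0 \<le> C") auto
    qed
    define L where "L = Sup A"
    have L0: "L \<ge> 0" unfolding L_def using A0 bdd by (rule cSup_upper)
    show "\<exists>L. \<forall>e>0. \<exists>d>0. \<forall>s t. s < x \<longrightarrow> x < t \<longrightarrow> t - s < d \<longrightarrow> \<bar>measure N {s<..<t} - L * (t - s)\<bar> \<le> e * (t - s)"
    proof (rule exI[of _ L], intro allI impI)
      fix e :: real assume e: "e > 0"
      have "x \<notin> Up (L + e)"
      proof
        assume "x \<in> Up (L + e)"
        then have "L + e \<in> A" using L0 e by (auto simp: A_def)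
        then have "L + e \<le> L" unfolding L_def using bdd by (rule cSup_upper)
        then show False using e by simp
      qed
      then obtain d1 where d1: "d1 > 0" "\<And>s t. s < x \<Longrightarrow> x < t \<Longrightarrow> t - s < d1 \<Longrightarrow> \<not> ennreal ((L + e) * (t - s)) \<le> emeasure N {s<..<t}"
        unfolding Up_def by blast
      have up: "measure N {s<..<t} \<le> (L + e) * (t - s)" if "s < x" "x < t" "t - s < d1" for s t
      proof (rule ccontr)
        assume "\<not> ?thesis"
        then have "ennreal ((L + e) * (t - s)) \<le> emeasure N {s<..<t}" unfolding em by (intro ennreal_leI) simp
        then show False using d1(2)[OF that] by simp
      qed
      have "\<exists>d2>0. \<forall>s t. s < x \<longrightarrow> x < t \<longrightarrow> t - s < d2 \<longrightarrow> (L - e) * (t - s) \<le> measure N {s<..<t}"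
      proof (cases "L - e \<le> 0")
        case True
        have "(L - e) * (t - s) \<le> measure N {s<..<t}" if "s < x" "x < t" for s t
        proof -
          have "(L - e) * (t - s) \<le> 0" using True that by (intro mult_nonpos_nonneg) auto
          then show ?thesis using measure_nonneg[of N "{s<..<t}"] by linarith
        qed
        then show ?thesis by (intro exI[of _ 1]) auto
      next
        case False
        obtain c where c: "c \<in> \<rat>" "L - e < c" "c < L" using Rats_dense_in_real[of "L - e" L] e by auto
        obtain C where C: "C \<in> \<rat>" "c < C" "C < L" using Rats_dense_in_real[OF c(3)] by auto
        obtain C' where C': "C' \<in> A" "C < C'" using less_cSupE[of C A] C A0 unfolding L_def by auto
        have xU: "x \<in> Up C" using C' Up_mono[of C C'] unfolding A_def by auto
        have "(c, C) \<in> Q" using c C False by (auto simp: Q_def)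
        then have "x \<notin> Lo c" using xU x unfolding Bad_def by force
        then obtain d2 where d2: "d2 > 0" "\<And>s t. s < x \<Longrightarrow> x < t \<Longrightarrow> t - s < d2 \<Longrightarrow> \<not> emeasure N {s<..<t} \<le> ennreal (c * (t - s))"
          unfolding Lo_def by blast
        have "(L - e) * (t - s) \<le> measure N {s<..<t}" if st: "s < x" "x < t" "t - s < d2" for s t
        proof -
          have "\<not> measure N {s<..<t} \<le> c * (t - s)"
            using d2(2)[OF st] unfolding em using ennreal_leI by blast
          moreover have "(L - e) * (t - s) \<le> c * (t - s)" using c st by (intro mult_right_mono) auto
          ultimately show ?thesis by linarith
        qed
        then show ?thesis using d2(1) by blast
      qed
      then obtain d2 where d2: "d2 > 0" "\<And>s t. s < x \<Longrightarrow> x < t \<Longrightarrow> t - s < d2 \<Longrightarrow> (L - e) * (t - s) \<le> measure N {s<..<t}"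
        by blast
      have "\<bar>measure N {s<..<t} - L * (t - s)\<bar> \<le> e * (t - s)" if "s < x" "x < t" "t - s < min d1 d2" for s t
        using up[of s t] d2(2)[of s t] that by (auto simp: abs_le_iff algebra_simps)
      then show "\<exists>d>0. \<forall>s t. s < x \<longrightarrow> x < t \<longrightarrow> t - s < d \<longrightarrow> \<bar>measure N {s<..<t} - L * (t - s)\<bar> \<le> e * (t - s)"
        using d1(1) d2(1) by (intro exI[of _ "min d1 d2"]) auto
    qed
  qed
qed

text \<open>The measure of an open interval around \<open>x\<close> differs from an increment of \<open>f\<close> with end point \<open>x\<close>,
  but at a point of continuity the interval can be shrunk to the increment without changing the
  limit. All but countably many points are points of continuity.\<close>

lemma monotone_right_continuous_differentiable_AE:
  fixes f :: "real \<Rightarrow> real"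
  assumes mono: "mono f" and rc: "\<And>x. continuous (at_right x) f"
  shows "AE x in lebesgue. f differentiable (at x)"
proof -
  let ?N = "interval_measure f"
  have Ioc: "emeasure ?N {s<..t} = ennreal (f t - f s)" if "s \<le> t" for s t
    using that mono rc by (intro emeasure_interval_measure_Ioc) (auto simp: mono_def)
  have Ioc': "measure ?N {s<..t} = f t - f s" if "s \<le> t" for s t
    using Ioc[OF that] monoD[OF mono that] by (simp add: measure_def)
  have fin: "emeasure ?N {s<..<t} < \<infinity>" for s t
  proof (cases "s \<le> t")
    case True
    have "emeasure ?N {s<..<t} \<le> emeasure ?N {s<..t}" by (intro emeasure_mono) auto
    then show ?thesis using Ioc[OF True] by (auto intro: order_le_less_trans)
  qed auto
  have le1: "measure ?N {s<..<t} \<le> f t - f s" if "s \<le> t" for s t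
  proof -
    have "measure ?N {s<..<t} \<le> measure ?N {s<..t}"
      by (rule measure_mono_fmeasurable) (use Ioc[OF that] in \<open>auto simp: fmeasurable_def\<close>)
    then show ?thesis using Ioc'[OF that] by simp
  qed
  have le2: "f t - f s \<le> measure ?N {s'<..<t'}" if "s' \<le> s" "s \<le> t" "t < t'" for s t s' t'
  proof -
    have "measure ?N {s<..t} \<le> measure ?N {s'<..<t'}"
      by (rule measure_mono_fmeasurable) (use fin[of s' t'] that in \<open>auto simp: fmeasurable_def\<close>)
    then show ?thesis using Ioc'[OF that(2)] by simp
  qed
  have "countable {x. \<not> isCont f x}" by (rule mono_ctble_discont[OF mono])
  then have "{x. \<not> isCont f x} \<in> null_sets lebesgue"
    by (intro null_sets_completionI countable_imp_null_set_lborel)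
  then have 1: "AE x in lebesgue. x \<notin> {x. \<not> isCont f x}" by (rule AE_not_in)
  have 2: "AE x in lebesgue. \<exists>L. \<forall>e>0. \<exists>d>0. \<forall>s t. s < x \<longrightarrow> x < t \<longrightarrow> t - s < d \<longrightarrow>
           \<bar>measure ?N {s<..<t} - L * (t - s)\<bar> \<le> e * (t - s)"
    by (rule measure_derivative_AE[OF _ fin]) simp
  show ?thesis using 1 2
  proof eventually_elim
    case (elim x)
    then obtain L where L: "\<And>e. e > 0 \<Longrightarrow> \<exists>d>0. \<forall>s t. s < x \<longrightarrow> x < t \<longrightarrow> t - s < d \<longrightarrow>
           \<bar>measure ?N {s<..<t} - L * (t - s)\<bar> \<le> e * (t - s)" by auto
    have cont: "(f \<longlongrightarrow> f x) (at x)" using elim by (auto simp: isCont_def)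
    have cr: "((\<lambda>h. f (x + h)) \<longlongrightarrow> f x) (at_right 0)" "((\<lambda>h. f (x - h)) \<longlongrightarrow> f x) (at_right 0)"
    proof -
      have "((\<lambda>h. x + h) \<longlongrightarrow> x) (at_right 0)" "((\<lambda>h. x - h) \<longlongrightarrow> x) (at_right 0)"
        by (rule tendsto_eq_intros refl | simp)+
      then show "((\<lambda>h. f (x + h)) \<longlongrightarrow> f x) (at_right 0)" "((\<lambda>h. f (x - h)) \<longlongrightarrow> f x) (at_right 0)"
        using elim isCont_tendsto_compose[of x f] by auto
    qed
    have "(f has_derivative (\<lambda>h. L * h)) (at x)"
      unfolding has_derivative_within_alt
    proof (intro conjI allI impI)
      show "bounded_linear (\<lambda>h. L * h)" by (rule bounded_linear_mult_right)
      fix e :: real assume "e > 0"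
      then obtain d where d: "d > 0" "\<And>s t. s < x \<Longrightarrow> x < t \<Longrightarrow> t - s < d \<Longrightarrow>
           \<bar>measure ?N {s<..<t} - L * (t - s)\<bar> \<le> e * (t - s)" using L by blast
      have ev: "\<forall>\<^sub>F h in at_right 0. 0 < h \<and> h < (d - \<bar>y - x\<bar>) / 3" if "\<bar>y - x\<bar> < d" for y
        unfolding eventually_at_right_field using that by (intro exI[of _ "(d - \<bar>y - x\<bar>) / 3"]) auto
      have R: "\<bar>f y - f x - L * (y - x)\<bar> \<le> e * \<bar>y - x\<bar>" if y: "\<bar>y - x\<bar> < d" for y
      proof (cases y x rule: linorder_cases)
        case equal then show ?thesis by simp
      next
        case greater
        have "f y - f x \<le> (L + e) * (y - x)"
        proof (rule tendsto_le[where F="at_right 0"])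
          show "((\<lambda>h. (L + e) * (y - x + 2*h)) \<longlongrightarrow> (L + e) * (y - x)) (at_right 0)"
            by (rule tendsto_eq_intros refl | simp)+
          show "((\<lambda>h. f y - f x) \<longlongrightarrow> f y - f x) (at_right 0)" by simp
          show "\<forall>\<^sub>F h in at_right 0. f y - f x \<le> (L + e) * (y - x + 2*h)"
            using ev[OF y]
          proof eventually_elim
            case (elim h)
            have "f y - f x \<le> measure ?N {x - h<..<y + h}" using elim greater by (intro le2) auto
            also have "\<dots> \<le> L * (y + h - (x - h)) + e * (y + h - (x - h))"
              using d(2)[of "x - h" "y + h"] elim greater by (auto simp: abs_le_iff)
            finally show ?case by (simp add: algebra_simps)
          qed
        qed simp
        moreover have "(L - e) * (y - x) \<le> f y - f x"
        proof (rule tendsto_le[where F="at_right 0"])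
          show "((\<lambda>h. (L - e) * (y - x + h)) \<longlongrightarrow> (L - e) * (y - x)) (at_right 0)"
            by (rule tendsto_eq_intros refl | simp)+
          show "((\<lambda>h. f y - f (x - h)) \<longlongrightarrow> f y - f x) (at_right 0)" by (intro tendsto_intros cr)
          show "\<forall>\<^sub>F h in at_right 0. (L - e) * (y - x + h) \<le> f y - f (x - h)"
            using ev[OF y]
          proof eventually_elim
            case (elim h)
            have "L * (y - (x - h)) - e * (y - (x - h)) \<le> measure ?N {x - h<..<y}"
              using d(2)[of "x - h" "y"] elim greater by (auto simp: abs_le_iff)
            also have "\<dots> \<le> f y - f (x - h)" using elim greater by (intro le1) auto
            finally show ?case by (simp add: algebra_simps)
          qed
        qed simp
        ultimately show ?thesis using greater by (auto simp: abs_le_iff algebra_simps)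
      next
        case less
        have "f x - f y \<le> (L + e) * (x - y)"
        proof (rule tendsto_le[where F="at_right 0"])
          show "((\<lambda>h. (L + e) * (x - y + h)) \<longlongrightarrow> (L + e) * (x - y)) (at_right 0)"
            by (rule tendsto_eq_intros refl | simp)+
          show "((\<lambda>h. f x - f y) \<longlongrightarrow> f x - f y) (at_right 0)" by simp
          show "\<forall>\<^sub>F h in at_right 0. f x - f y \<le> (L + e) * (x - y + h)"
            using ev[OF y]
          proof eventually_elim
            case (elim h)
            have "f x - f y \<le> measure ?N {y<..<x + h}" using elim less by (intro le2) auto
            also have "\<dots> \<le> L * (x + h - y) + e * (x + h - y)"
              using d(2)[of "y" "x + h"] elim less by (auto simp: abs_le_iff)
            finally show ?case by (simp add: algebra_simps)
          qed
        qed simp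
        moreover have "(L - e) * (x - y) \<le> f x - f y"
        proof (rule tendsto_le[where F="at_right 0"])
          show "((\<lambda>h. (L - e) * (x - y + h)) \<longlongrightarrow> (L - e) * (x - y)) (at_right 0)"
            by (rule tendsto_eq_intros refl | simp)+
          show "((\<lambda>h. f (x + h) - f y) \<longlongrightarrow> f x - f y) (at_right 0)" by (intro tendsto_intros cr)
          show "\<forall>\<^sub>F h in at_right 0. (L - e) * (x - y + h) \<le> f (x + h) - f y"
            using ev[OF y]
          proof eventually_elim
            case (elim h)
            have "L * (x + h - y) - e * (x + h - y) \<le> measure ?N {y<..<x + h}"
              using d(2)[of "y" "x + h"] elim less by (auto simp: abs_le_iff)
            also have "\<dots> \<le> f (x + h) - f y" using elim less by (intro le1) auto
            finally show ?case by (simp add: algebra_simps)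
          qed
        qed simp
        ultimately show ?thesis using less by (auto simp: abs_le_iff algebra_simps)
      qed
      show "\<exists>d>0. \<forall>y\<in>UNIV. norm (y - x) < d \<longrightarrow> norm (f y - f x - L * (y - x)) \<le> e * norm (y - x)"
        using d(1) R by (intro exI[of _ d]) auto
    qed
    then show ?case by (auto simp: differentiable_def)
  qed
qed

text \<open>Passing to the right limits \<open>R\<close> of \<open>W\<close> keeps the domination, because \<open>f\<close> is continuous. Then \<open>R\<close>
  and \<open>R + f\<close> are both monotone and right-continuous. This form covers Lipschitz functions, with
  linear \<open>W\<close>, as well as the boundary values of a primitive of a Hardy function, where \<open>W\<close> may jump.\<close>

lemma dominated_differentiable_AE:
  fixes f W :: "real \<Rightarrow> real"
  assumes cont: "continuous_on UNIV f" and dom: "\<And>u v. u \<le> v \<Longrightarrow> \<bar>f v - f u\<bar> \<le> W v - W u"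
  shows "AE x in lebesgue. f differentiable (at x)"
proof -
  have W: "W u \<le> W v" if "u \<le> v" for u v using dom[OF that] by linarith
  define R where "R x = Inf (W ` {x<..})" for x
  have bdd: "bdd_below (W ` {x<..})" for x by (rule bdd_belowI[of _ "W x"]) (auto intro!: W)
  have R_le: "R x \<le> W y" if "x < y" for x y unfolding R_def by (rule cInf_lower[OF _ bdd]) (use that in auto)
  have R_ge: "c \<le> R x" if "\<And>y. x < y \<Longrightarrow> c \<le> W y" for x c
    unfolding R_def by (rule cInf_greatest) (use that in auto)
  have W_le_R: "W x \<le> R x" for x by (rule R_ge) (auto intro: W)
  have Rm: "R u \<le> R v" if "u \<le> v" for u v by (rule R_ge) (use that in \<open>auto intro: R_le\<close>)
  have R_rc: "continuous (at_right x) R" for x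
    unfolding continuous_within
  proof (rule tendstoI)
    fix e :: real assume "e > 0"
    then obtain y where y: "x < y" "W y < R x + e"
      using cInf_lessD[of "W ` {x<..}" "R x + e"] unfolding R_def by auto
    show "\<forall>\<^sub>F z in at_right x. dist (R z) (R x) < e"
      unfolding eventually_at_right_field
    proof (intro exI[of _ y] conjI y allI impI)
      fix z assume z: "x < z" "z < y"
      have "R z \<le> W y" "R x \<le> R z" using z by (auto intro: R_le Rm)
      then show "dist (R z) (R x) < e" using y by (auto simp: dist_real_def)
    qed
  qed
  have R_tend: "((\<lambda>h. W (x + h)) \<longlongrightarrow> R x) (at_right 0)" for x
  proof (rule tendstoI)
    fix e :: real assume "e > 0"
    then obtain y where y: "x < y" "W y < R x + e"
      using cInf_lessD[of "W ` {x<..}" "R x + e"] unfolding R_def by auto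
    show "\<forall>\<^sub>F h in at_right 0. dist (W (x + h)) (R x) < e"
      unfolding eventually_at_right_field
    proof (intro exI[of _ "y - x"] conjI allI impI)
      fix h assume z: "0 < h" "h < y - x"
      have "W (x + h) \<le> W y" "R x \<le> W (x + h)" using z by (auto intro: R_le W)
      then show "dist (W (x + h)) (R x) < e" using y by (auto simp: dist_real_def)
    qed (use y in auto)
  qed
  have f_tend: "((\<lambda>h. f (x + h)) \<longlongrightarrow> f x) (at_right 0)" for x
  proof -
    have "(f \<longlongrightarrow> f x) (at x)" using cont by (simp add: continuous_on_eq_continuous_at isCont_def)
    then have "((\<lambda>h. f (x + h)) \<longlongrightarrow> f x) (at 0)" using LIM_offset_zero by blast
    then show ?thesis by (rule tendsto_within_subset) auto
  qed
  have domR: "\<bar>f v - f u\<bar> \<le> R v - R u" if "u \<le> v" for u v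
  proof (rule tendsto_le[where F="at_right 0"])
    show "((\<lambda>h. W (v + h) - W (u + h)) \<longlongrightarrow> R v - R u) (at_right 0)" by (intro tendsto_intros R_tend)
    show "((\<lambda>h. \<bar>f (v + h) - f (u + h)\<bar>) \<longlongrightarrow> \<bar>f v - f u\<bar>) (at_right 0)" by (intro tendsto_intros f_tend)
  qed (use dom that in auto)
  have "AE x in lebesgue. R differentiable (at x)"
    by (rule monotone_right_continuous_differentiable_AE[OF _ R_rc]) (auto simp: mono_def intro: Rm)
  moreover have "AE x in lebesgue. (\<lambda>x. R x + f x) differentiable (at x)"
  proof (rule monotone_right_continuous_differentiable_AE)
    show "mono (\<lambda>x. R x + f x)"
    proof (rule monoI)
      fix x y :: real assume "x \<le> y"
      from domR[OF this] show "R x + f x \<le> R y + f y" by (auto simp: abs_le_iff)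
    qed
    fix x show "continuous (at_right x) (\<lambda>x. R x + f x)"
      using R_rc cont by (intro continuous_intros) (auto simp: continuous_on_eq_continuous_within intro: continuous_within_subset)
  qed
  ultimately show ?thesis
  proof eventually_elim
    case (elim x)
    then have "(\<lambda>x. (R x + f x) - R x) differentiable (at x)" by (intro differentiable_diff)
    then show ?case by simp
  qed
qed

lemma dominated_complex_differentiable_AE:
  fixes f :: "real \<Rightarrow> complex" and W :: "real \<Rightarrow> real"
  assumes cont: "continuous_on UNIV f" and dom: "\<And>u v. u \<le> v \<Longrightarrow> norm (f v - f u) \<le> W v - W u"
  shows "AE x in lebesgue. f differentiable (at x)"
proof -
  have "AE x in lebesgue. (\<lambda>x. Re (f x)) differentiable (at x)"
  proof (rule dominated_differentiable_AE[where W=W])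
    show "continuous_on UNIV (\<lambda>x. Re (f x))" using cont by (intro continuous_intros)
    show "\<bar>Re (f v) - Re (f u)\<bar> \<le> W v - W u" if "u \<le> v" for u v
      using abs_Re_le_cmod[of "f v - f u"] dom[OF that] by simp
  qed
  moreover have "AE x in lebesgue. (\<lambda>x. Im (f x)) differentiable (at x)"
  proof (rule dominated_differentiable_AE[where W=W])
    show "continuous_on UNIV (\<lambda>x. Im (f x))" using cont by (intro continuous_intros)
    show "\<bar>Im (f v) - Im (f u)\<bar> \<le> W v - W u" if "u \<le> v" for u v
      using abs_Im_le_cmod[of "f v - f u"] dom[OF that] by simp
  qed
  ultimately show ?thesis
  proof eventually_elim
    case (elim x)
    then have "(\<lambda>x. Re (f x) *\<^sub>R 1 + Im (f x) *\<^sub>R \<i>) differentiable (at x)"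
      by (intro differentiable_add differentiable_scaleR) auto
    moreover have "Re (f x) *\<^sub>R 1 + Im (f x) *\<^sub>R \<i> = f x" for x by (simp add: complex_eq_iff)
    ultimately show ?case by simp
  qed
qed

section \<open>Integration along a Lipschitz graph\<close>

lemma borel_measurable_completion_cong_AE:
  assumes f: "f \<in> borel_measurable (completion N)" and ae: "AE x in completion N. f x = g x"
  shows "g \<in> borel_measurable (completion N)"
proof (rule measurableI)
  fix A :: "'b set" assume A: "A \<in> sets borel"
  obtain Z where "{x \<in> space (completion N). f x \<noteq> g x} \<subseteq> Z" "emeasure (completion N) Z = 0" "Z \<in> sets (completion N)"
    by (rule AE_E[OF ae])
  then have Z: "{x \<in> space N. f x \<noteq> g x} \<subseteq> Z" "Z \<in> null_sets (completion N)"
    by (simp_all only: space_completion null_setsI)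
  have S: "f -` A \<inter> space (completion N) \<in> sets (completion N)" using f A by (rule measurable_sets)
  have n1: "(f -` A \<inter> space N) \<inter> Z \<in> null_sets (completion N)" "(g -` A \<inter> space N) \<inter> Z \<in> null_sets (completion N)"
    by (rule null_sets_completion_subset[OF _ Z(2)], blast)+
  have "g -` A \<inter> space (completion N) = (f -` A \<inter> space N - (f -` A \<inter> space N) \<inter> Z) \<union> ((g -` A \<inter> space N) \<inter> Z)"
    using Z(1) by auto
  also have "\<dots> \<in> sets (completion N)"
    using S n1 by (intro sets.Un sets.Diff) (auto simp: null_setsD2)
  finally show "g -` A \<inter> space (completion N) \<in> sets (completion N)" .
qed auto

lemma has_vector_derivative_imp_LIMSEQ:
  assumes "(g has_vector_derivative d) (at t)"
  shows "(\<lambda>n. real (Suc n) *\<^sub>R (g (t + 1 / real (Suc n)) - g t)) \<longlonglongrightarrow> d"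
proof -
  have "((\<lambda>h. norm (g (t + h) - g t - h *\<^sub>R d) / norm h) \<longlongrightarrow> 0) (at 0)"
    using assms unfolding has_vector_derivative_def has_derivative_at by auto
  moreover have "filterlim (\<lambda>n. 1 / real (Suc n)) (at 0) sequentially"
    unfolding filterlim_at using LIMSEQ_inverse_real_of_nat by (auto simp: inverse_eq_divide)
  ultimately have "(\<lambda>n. norm (g (t + 1 / real (Suc n)) - g t - (1 / real (Suc n)) *\<^sub>R d) / norm (1 / real (Suc n))) \<longlonglongrightarrow> 0"
    by (rule filterlim_compose)
  moreover have "norm (g (t + 1 / real (Suc n)) - g t - (1 / real (Suc n)) *\<^sub>R d) / norm (1 / real (Suc n))
      = norm (real (Suc n) *\<^sub>R (g (t + 1 / real (Suc n)) - g t) - d)" for n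
  proof -
    have "real (Suc n) *\<^sub>R (g (t + 1 / real (Suc n)) - g t) - d = real (Suc n) *\<^sub>R (g (t + 1 / real (Suc n)) - g t - (1 / real (Suc n)) *\<^sub>R d)"
      by (simp add: scaleR_diff_right)
    also have "norm \<dots> = real (Suc n) * norm (g (t + 1 / real (Suc n)) - g t - (1 / real (Suc n)) *\<^sub>R d)"
      by (simp del: of_nat_Suc)
    finally show ?thesis by (simp del: of_nat_Suc)
  qed
  ultimately show ?thesis by (simp add: tendsto_norm_zero_iff LIM_zero_iff del: of_nat_Suc)
qed

text \<open>The difference quotients of a Lipschitz function are bounded, so their integrals converge to that
  of the derivative; on the other hand these integrals telescope to averages of \<open>g\<close> near the two
  end points. The extension \<open>h\<close> of \<open>g\<close> by constants makes all the quotients meaningful.\<close>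

lemma lipschitz_integral_derivative:
  fixes g g' :: "real \<Rightarrow> 'a :: euclidean_space"
  assumes L: "L-lipschitz_on {\<alpha>..\<beta>} g" and "\<alpha> \<le> \<beta>"
    and der: "AE t in lebesgue. t \<in> {\<alpha><..<\<beta>} \<longrightarrow> (g has_vector_derivative g' t) (at t)"
  shows "set_integrable lebesgue {\<alpha>..\<beta>} g'" and "(LINT t:{\<alpha>..\<beta>}|lebesgue. g' t) = g \<beta> - g \<alpha>"
proof -
  define h where "h t = g (max \<alpha> (min \<beta> t))" for t
  have L0: "L \<ge> 0" using L lipschitz_on_nonneg by blast
  have h_lip: "norm (h s - h t) \<le> L * \<bar>s - t\<bar>" for s t
  proof -
    have "norm (h s - h t) \<le> L * \<bar>max \<alpha> (min \<beta> s) - max \<alpha> (min \<beta> t)\<bar>"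
      using lipschitz_onD[OF L, of "max \<alpha> (min \<beta> s)" "max \<alpha> (min \<beta> t)"] \<open>\<alpha> \<le> \<beta>\<close>
      by (simp add: h_def dist_norm)
    also have "\<dots> \<le> L * \<bar>s - t\<bar>" using L0 by (intro mult_left_mono) auto
    finally show ?thesis .
  qed
  have h_cont: "continuous_on S h" for S
  proof -
    have "L-lipschitz_on UNIV h" using h_lip L0 by (intro lipschitz_onI) (auto simp: dist_norm)
    then show ?thesis using lipschitz_on_continuous_on continuous_on_subset by blast
  qed
  define q where "q n t = real (Suc n) *\<^sub>R (h (t + 1 / real (Suc n)) - h t)" for n t
  have q_bound: "norm (q n t) \<le> L" for n t
  proof -
    have "norm (q n t) \<le> real (Suc n) * (L * (1 / real (Suc n)))"
      unfolding q_def norm_scaleR using h_lip[of "t + 1 / real (Suc n)" t] by (intro mult_mono) auto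
    then show ?thesis by (simp del: of_nat_Suc)
  qed
  have q_cont: "continuous_on S (q n)" for S n
    unfolding q_def by (intro continuous_intros continuous_on_compose2[OF h_cont[of UNIV]]) auto
  let ?F = "\<lambda>n t. indicator {\<alpha>..\<beta>} t *\<^sub>R q n t"
  let ?G = "\<lambda>t. indicator {\<alpha>..\<beta>} t *\<^sub>R g' t"
  have F_meas: "?F n \<in> borel_measurable lebesgue" for n
  proof -
    have "?F n \<in> borel_measurable lborel" using borel_measurable_continuous_onI[OF q_cont[of UNIV n]] by measurable
    then show ?thesis by (rule measurable_completion)
  qed
  have ae_ends: "AE t in lebesgue. t \<noteq> \<alpha> \<and> t \<noteq> \<beta>"
    using AE_lborel_singleton[of \<alpha>] AE_lborel_singleton[of \<beta>] by (intro AE_completion) auto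
  have lim: "AE t in lebesgue. (\<lambda>n. ?F n t) \<longlonglongrightarrow> ?G t"
    using der ae_ends
  proof eventually_elim
    case (elim t)
    show ?case
    proof (cases "t \<in> {\<alpha><..<\<beta>}")
      case True
      have "(h has_vector_derivative g' t) (at t)"
      proof (rule has_vector_derivative_transform_within_open[where f=g and S="{\<alpha><..<\<beta>}"])
        show "(g has_vector_derivative g' t) (at t)" using elim True by simp
      qed (use True in \<open>auto simp: h_def\<close>)
      then have "(\<lambda>n. q n t) \<longlonglongrightarrow> g' t" unfolding q_def by (rule has_vector_derivative_imp_LIMSEQ)
      then show ?thesis by (intro tendsto_intros)
    next
      case False
      then have "indicator {\<alpha>..\<beta>} t = (0::real)" using elim by auto
      then show ?thesis by simp
    qed
  qed
  have G_meas: "?G \<in> borel_measurable lebesgue"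
  proof (rule borel_measurable_completion_cong_AE)
    show "(\<lambda>t. lim (\<lambda>n. ?F n t)) \<in> borel_measurable lebesgue" using F_meas by (rule borel_measurable_lim_metric)
    show "AE t in lebesgue. lim (\<lambda>n. ?F n t) = ?G t" using lim by eventually_elim (rule limI)
  qed
  have int_dom: "integrable lebesgue (\<lambda>t. L * indicator {\<alpha>..\<beta>} t)"
    using \<open>\<alpha> \<le> \<beta>\<close> by (intro integrable_mult_right integrable_real_indicator) (auto simp: emeasure_lborel_Icc_eq)
  have bnd: "AE t in lebesgue. norm (?F n t) \<le> L * indicator {\<alpha>..\<beta>} t" for n
    using q_bound by (auto simp: indicator_def L0)
  note dc = integral_dominated_convergence[OF G_meas F_meas int_dom lim bnd]
  note dominated_convergence_integrable = integrable_dominated_convergence[OF G_meas F_meas int_dom lim bnd]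
  show "set_integrable lebesgue {\<alpha>..\<beta>} g'" unfolding set_integrable_def by (rule dominated_convergence_integrable)
  have eq: "integral\<^sup>L lebesgue (?F n) = real (Suc n) *\<^sub>R (integral {\<beta>..\<beta> + 1 / real (Suc n)} h - integral {\<alpha>..\<alpha> + 1 / real (Suc n)} h)" for n
  proof -
    let ?d = "1 / real (Suc n)"
    have hi: "h integrable_on {s..t}" for s t by (rule integrable_continuous_real[OF h_cont])
    have "set_integrable lebesgue {\<alpha>..\<beta>} (q n)"
      unfolding set_integrable_def using Bochner_Integration.integrable_bound[OF int_dom F_meas[of n]] bnd[of n] by (auto simp: abs_mult L0)
    then have "integral\<^sup>L lebesgue (?F n) = integral {\<alpha>..\<beta>} (q n)"
      using set_lebesgue_integral_eq_integral(2) unfolding set_lebesgue_integral_def by blast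
    also have "\<dots> = real (Suc n) *\<^sub>R (integral {\<alpha>..\<beta>} (h \<circ> (\<lambda>t. t + ?d)) - integral {\<alpha>..\<beta>} h)"
      unfolding q_def by (subst integral_diff[symmetric])
        (auto intro!: integrable_continuous_real h_cont continuous_intros continuous_on_compose2[OF h_cont[of UNIV]] simp del: of_nat_Suc)
    also have "integral {\<alpha>..\<beta>} (h \<circ> (\<lambda>t. t + ?d)) = integral {\<alpha> + ?d..\<beta> + ?d} h" by (rule integral_shift[OF h_cont])
    also have "integral {\<alpha> + ?d..\<beta> + ?d} h - integral {\<alpha>..\<beta>} h = integral {\<beta>..\<beta> + ?d} h - integral {\<alpha>..\<alpha> + ?d} h"
    proof -
      have "integral {\<alpha>..\<alpha> + ?d} h + integral {\<alpha> + ?d..\<beta> + ?d} h = integral {\<alpha>..\<beta> + ?d} h"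
        by (rule Henstock_Kurzweil_Integration.integral_combine[OF _ _ hi]) (use \<open>\<alpha> \<le> \<beta>\<close> in auto)
      moreover have "integral {\<alpha>..\<beta>} h + integral {\<beta>..\<beta> + ?d} h = integral {\<alpha>..\<beta> + ?d} h"
        by (rule Henstock_Kurzweil_Integration.integral_combine[OF _ _ hi]) (use \<open>\<alpha> \<le> \<beta>\<close> in auto)
      ultimately show ?thesis by (simp add: algebra_simps)
    qed
    finally show ?thesis .
  qed
  have avg: "(\<lambda>n. real (Suc n) *\<^sub>R integral {x..x + 1 / real (Suc n)} h) \<longlonglongrightarrow> h x" for x
  proof (rule LIM_zero_cancel, rule Lim_null_comparison)
    show "(\<lambda>n. L * (1 / real (Suc n))) \<longlonglongrightarrow> 0"
      using tendsto_mult[OF tendsto_const LIMSEQ_inverse_real_of_nat, of L] by (simp add: inverse_eq_divide)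
    show "\<forall>\<^sub>F n in sequentially. norm (real (Suc n) *\<^sub>R integral {x..x + 1 / real (Suc n)} h - h x) \<le> L * (1 / real (Suc n))"
    proof (intro always_eventually allI)
      fix n
      let ?d = "1 / real (Suc n)"
      have "integral {x..x + ?d} (\<lambda>t. h t - h x) = integral {x..x + ?d} h - ?d *\<^sub>R h x"
        by (subst integral_diff) (auto intro!: integrable_continuous_real h_cont)
      then have "real (Suc n) *\<^sub>R integral {x..x + ?d} h - h x = real (Suc n) *\<^sub>R integral {x..x + ?d} (\<lambda>t. h t - h x)"
        by (simp add: scaleR_diff_right del: of_nat_Suc)
      also have "norm \<dots> \<le> real (Suc n) * (L * ?d * (x + ?d - x))"
        unfolding norm_scaleR
      proof (intro mult_mono integral_bound)
        show "continuous_on {x..x + ?d} (\<lambda>t. h t - h x)" by (intro continuous_intros h_cont)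
        fix t assume "t \<in> {x..x + ?d}"
        then have "\<bar>t - x\<bar> \<le> ?d" by auto
        then have "L * \<bar>t - x\<bar> \<le> L * ?d" using L0 by (rule mult_left_mono)
        then show "norm (h t - h x) \<le> L * ?d" using h_lip[of t x] by linarith
      qed auto
      also have "\<dots> = L * ?d" by (simp del: of_nat_Suc)
      finally show "norm (real (Suc n) *\<^sub>R integral {x..x + ?d} h - h x) \<le> L * ?d" .
    qed
  qed
  have "(\<lambda>n. integral\<^sup>L lebesgue (?F n)) \<longlonglongrightarrow> h \<beta> - h \<alpha>"
    unfolding eq scaleR_diff_right by (intro tendsto_diff avg)
  then have "integral\<^sup>L lebesgue ?G = h \<beta> - h \<alpha>" using dc(1) LIMSEQ_unique by blast
  then show "(LINT t:{\<alpha>..\<beta>}|lebesgue. g' t) = g \<beta> - g \<alpha>"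
    unfolding set_lebesgue_integral_def using \<open>\<alpha> \<le> \<beta>\<close> by (simp add: h_def)
qed

text \<open>Near points are joined by a segment inside \<open>U\<close>; for far points boundedness of \<open>P\<close> suffices.\<close>

lemma field_derivative_lipschitz_on_compact:
  fixes P P' :: "complex \<Rightarrow> complex"
  assumes "open U" and der: "\<And>w. w \<in> U \<Longrightarrow> (P has_field_derivative P' w) (at w)"
    and K: "compact K" "K \<subseteq> U"
  obtains B where "B-lipschitz_on K P"
proof -
  have holP: "P holomorphic_on U" using der \<open>open U\<close> by (auto simp: holomorphic_on_open)
  have PP: "deriv P w = P' w" if "w \<in> U" for w using der[OF that] by (rule DERIV_imp_deriv)
  have "deriv P holomorphic_on U" using holP \<open>open U\<close> by (rule holomorphic_deriv)
  then have contP': "continuous_on U P'"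
    by (rule continuous_on_eq[OF holomorphic_on_imp_continuous_on]) (rule PP)
  have contP: "continuous_on U P" using holP holomorphic_on_imp_continuous_on by blast
  obtain e where e: "e > 0" "(\<Union>x\<in>K. cball x e) \<subseteq> U"
    using compact_subset_open_imp_cball_epsilon_subset[OF K(1) \<open>open U\<close> K(2)] by blast
  let ?T = "\<Union>x\<in>K. cball x e"
  have cT: "compact ?T" by (rule compact_minkowski_sum_cball[OF K(1)])
  obtain B where B: "\<forall>w\<in>?T. norm (P' w) \<le> B"
    using compact_imp_bounded[OF compact_continuous_image[OF continuous_on_subset[OF contP' e(2)] cT]]
    unfolding bounded_iff by auto
  obtain A where A: "\<forall>w\<in>K. norm (P w) \<le> A"
    using compact_imp_bounded[OF compact_continuous_image[OF continuous_on_subset[OF contP K(2)] K(1)]]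
    unfolding bounded_iff by auto
  define C where "C = max \<bar>B\<bar> (2 * \<bar>A\<bar> / e)"
  have C0: "C \<ge> 0" "\<bar>B\<bar> \<le> C" "2 * \<bar>A\<bar> / e \<le> C" by (auto simp: C_def)
  have "C-lipschitz_on K P"
  proof (rule lipschitz_onI[OF _ C0(1)])
    fix x y assume xy: "x \<in> K" "y \<in> K"
    show "dist (P x) (P y) \<le> C * dist x y"
    proof (cases "dist x y \<le> e")
      case True
      have sub: "cball x e \<subseteq> ?T" using xy by auto
      have "norm (P x - P y) \<le> \<bar>B\<bar> * norm (x - y)"
      proof (rule field_differentiable_bound[where S="cball x e"])
        show "(P has_field_derivative P' w) (at w within cball x e)" if "w \<in> cball x e" for w
          using der[of w] that sub e(2) has_field_derivative_at_within by blast
        show "norm (P' w) \<le> \<bar>B\<bar>" if "w \<in> cball x e" for w using B that sub by force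
      qed (use True e(1) in auto)
      also have "\<dots> \<le> C * norm (x - y)" using C0 by (intro mult_right_mono) auto
      finally show ?thesis by (simp add: dist_norm)
    next
      case False
      have "dist (P x) (P y) \<le> norm (P x) + norm (P y)" by (simp add: dist_norm norm_triangle_ineq4)
      also have "\<dots> \<le> 2 * \<bar>A\<bar>" using bspec[OF A xy(1)] bspec[OF A xy(2)] by linarith
      also have "\<dots> = 2 * \<bar>A\<bar> / e * e" using e by simp
      also have "\<dots> \<le> C * dist x y" using C0 False e by (intro mult_mono) auto
      finally show ?thesis .
    qed
  qed
  then show ?thesis by (rule that)
qed

locale lipschitz_graph =
  fixes a :: "real \<Rightarrow> real" and M :: real
  assumes M_pos: "M > 0" and lip: "\<bar>a u - a v\<bar> \<le> M * \<bar>u - v\<bar>"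
begin

abbreviation z :: "real \<Rightarrow> complex" where "z \<equiv> graph_point a"
abbreviation dz :: "real \<Rightarrow> complex" where "dz u \<equiv> vector_derivative (graph_point a) (at u)"
abbreviation \<Omega> :: "complex set" where "\<Omega> \<equiv> upper_domain a"

lemma Re_z [simp]: "Re (z u) = u" and Im_z [simp]: "Im (z u) = a u"
  by (simp_all add: graph_point_def)

lemma z_lower: "\<bar>u - v\<bar> \<le> norm (z u - z v)"
  using abs_Re_le_cmod[of "z u - z v"] by simp

lemma z_upper: "norm (z u - z v) \<le> (1 + M) * \<bar>u - v\<bar>"
  using cmod_le[of "z u - z v"] lip[of u v] by (simp add: algebra_simps)

lemma z_lipschitz: "(1 + M)-lipschitz_on S z"
  using z_upper M_pos by (intro lipschitz_onI) (auto simp: dist_norm)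

lemma continuous_on_z [continuous_intros]: "continuous_on S z"
  using z_lipschitz lipschitz_on_continuous_on by blast

lemma continuous_on_a: "continuous_on S a"
proof -
  have "M-lipschitz_on S a" using lip M_pos by (intro lipschitz_onI) (auto simp: dist_real_def)
  then show ?thesis by (rule lipschitz_on_continuous_on)
qed

lemma z_deriv_AE: "AE u in lebesgue. (z has_vector_derivative dz u) (at u)"
proof -
  have "AE u in lebesgue. z differentiable (at u)"
  proof (rule dominated_complex_differentiable_AE[where W="\<lambda>u. (1 + M) * u"])
    show "norm (z v - z u) \<le> (1 + M) * v - (1 + M) * u" if "u \<le> v" for u v
      using z_upper[of v u] that by (simp add: algebra_simps)
  qed (rule continuous_on_z)
  then show ?thesis by eventually_elim (simp add: vector_derivative_works)
qed

lemma Re_z_derivative: 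
  assumes "(z has_vector_derivative d) (at u)" shows "Re d = 1"
proof -
  have "((\<lambda>u. Re (z u)) has_vector_derivative Re d) (at u)"
    using assms by (rule bounded_linear.has_vector_derivative[OF bounded_linear_Re])
  then have "((\<lambda>u. u) has_vector_derivative Re d) (at u)" by simp
  moreover have "((\<lambda>u. u) has_vector_derivative 1) (at u)" by (rule has_vector_derivative_id)
  ultimately show ?thesis by (rule vector_derivative_unique_at)
qed

lemma norm_z_derivative_le:
  assumes "(z has_vector_derivative d) (at u)" shows "norm d \<le> 1 + M"
proof (rule LIMSEQ_le_const2)
  show "(\<lambda>n. norm (real (Suc n) *\<^sub>R (z (u + 1 / real (Suc n)) - z u))) \<longlonglongrightarrow> norm d"
    by (intro tendsto_norm has_vector_derivative_imp_LIMSEQ assms)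
  have "norm (real (Suc n) *\<^sub>R (z (u + 1 / real (Suc n)) - z u)) \<le> 1 + M" for n
  proof -
    have "norm (real (Suc n) *\<^sub>R (z (u + 1 / real (Suc n)) - z u)) \<le> real (Suc n) * ((1 + M) * (1 / real (Suc n)))"
      unfolding norm_scaleR using z_upper[of "u + 1 / real (Suc n)" u] M_pos by (intro mult_mono) auto
    then show ?thesis by (simp del: of_nat_Suc)
  qed
  then show "\<exists>N. \<forall>n\<ge>N. norm (real (Suc n) *\<^sub>R (z (u + 1 / real (Suc n)) - z u)) \<le> 1 + M" by blast
qed

lemma dz_bounds_AE: "AE u in lebesgue. 1 \<le> norm (dz u) \<and> norm (dz u) \<le> 1 + M"
  using z_deriv_AE
proof eventually_elim
  case (elim u)
  then show ?case using Re_z_derivative[OF elim] norm_z_derivative_le[OF elim] complex_Re_le_cmod[of "dz u"] by simp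
qed

lemma z_measurable [measurable]: "z \<in> borel_measurable lebesgue"
  using borel_measurable_continuous_onI[OF continuous_on_z] by (intro measurable_completion) simp

lemma dz_measurable [measurable]: "dz \<in> borel_measurable lebesgue"
proof (rule borel_measurable_completion_cong_AE)
  let ?q = "\<lambda>n u. real (Suc n) *\<^sub>R (z (u + 1 / real (Suc n)) - z u)"
  show "(\<lambda>u. lim (\<lambda>n. ?q n u)) \<in> borel_measurable lebesgue"
  proof (rule borel_measurable_lim_metric)
    fix n
    have "continuous_on UNIV (?q n)"
      by (intro continuous_intros continuous_on_compose2[OF continuous_on_z[of UNIV]]) auto
    then show "?q n \<in> borel_measurable lebesgue"
      by (intro measurable_completion) (simp add: borel_measurable_continuous_onI)
  qed
  show "AE u in lebesgue. lim (\<lambda>n. ?q n u) = dz u"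
    using z_deriv_AE by eventually_elim (intro limI has_vector_derivative_imp_LIMSEQ)
qed

lemma z_measurable_curve [measurable]: "z \<in> lebesgue \<rightarrow>\<^sub>M restrict_space borel (graph_curve a)"
  by (intro measurable_restrict_space2) (auto simp: graph_curve_def)

text \<open>The bad set of points on the graph need not be measurable, but it is the image of a subset of a
  Borel null set \<open>N\<close>, and the points of the graph with real part in \<open>N\<close> form a Borel set. The
  density \<open>norm (dz u)\<close> is at least \<open>1\<close>, so it has the same null sets as Lebesgue measure.\<close>

lemma AE_arc_length_iff: "(AE \<zeta> in arc_length a. P \<zeta>) \<longleftrightarrow> (AE u in lebesgue. P (z u))"
proof
  let ?D = "density lebesgue (\<lambda>u. ennreal (norm (dz u)))"
  have D: "(AE u in ?D. Q u) \<longleftrightarrow> (AE u in lebesgue. Q u)" for Q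
  proof -
    have "(AE u in ?D. Q u) \<longleftrightarrow> (AE u in lebesgue. 0 < ennreal (norm (dz u)) \<longrightarrow> Q u)"
      by (rule AE_density) measurable
    also have "\<dots> \<longleftrightarrow> (AE u in lebesgue. Q u)"
    proof (intro iffI)
      assume "AE u in lebesgue. 0 < ennreal (norm (dz u)) \<longrightarrow> Q u"
      with dz_bounds_AE show "AE u in lebesgue. Q u"
        by eventually_elim (auto simp: ennreal_zero_less_mult_iff)
    qed auto
    finally show ?thesis .
  qed
  have zm: "z \<in> ?D \<rightarrow>\<^sub>M restrict_space borel (graph_curve a)" using z_measurable_curve by simp
  show "AE u in lebesgue. P (z u)" if "AE \<zeta> in arc_length a. P \<zeta>"
    using AE_distrD[OF zm that[unfolded arc_length_def]] D by simp
  show "AE \<zeta> in arc_length a. P \<zeta>" if "AE u in lebesgue. P (z u)"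
  proof -
    have "AE u in lborel. P (z u)" using that by (simp add: AE_completion_iff)
    then obtain N where "{u \<in> space lborel. \<not> P (z u)} \<subseteq> N" "emeasure lborel N = 0" "N \<in> sets lborel"
      by (rule AE_E)
    then have N: "{u. \<not> P (z u)} \<subseteq> N" "N \<in> null_sets lborel" by (simp_all add: null_setsI)
    define B where "B = {w \<in> graph_curve a. Re w \<in> N}"
    have "B = (Re -` N \<inter> space borel) \<inter> graph_curve a" by (auto simp: B_def)
    moreover have "Re -` N \<inter> space borel \<in> sets borel"
      by (rule measurable_sets[of Re borel borel]) (use N in \<open>auto simp: null_sets_def intro!: borel_measurable_continuous_onI continuous_intros\<close>)
    ultimately have Bs: "B \<in> sets (restrict_space borel (graph_curve a))"
      by (auto simp: sets_restrict_space image_iff)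
    have vB: "z -` B = N" by (auto simp: B_def graph_curve_def)
    have "AE u in lebesgue. u \<notin> N" using N(2) by (intro AE_not_in null_sets_completionI)
    then have "AE u in ?D. u \<notin> N" by (simp add: D)
    then have "N \<in> null_sets ?D" using N(2) by (subst (asm) AE_iff_null_sets[symmetric]) (auto simp: null_sets_def)
    then have "emeasure (arc_length a) B = 0"
      unfolding arc_length_def by (subst emeasure_distr[OF zm Bs]) (simp add: vB null_sets_def)
    then have "B \<in> null_sets (arc_length a)" using Bs by (intro null_setsI) (auto simp: arc_length_def)
    then show ?thesis
    proof (rule AE_I'[of B])
      show "{w \<in> space (arc_length a). \<not> P w} \<subseteq> B"
        using N(1) by (auto simp: B_def arc_length_def space_restrict_space graph_curve_def)
    qed
  qed
qed

lemma nn_integral_arc_length: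
  assumes "continuous_on (graph_curve a) g"
  shows "(\<integral>\<^sup>+\<zeta>. ennreal (g \<zeta>) \<partial>arc_length a) = (\<integral>\<^sup>+u. ennreal (g (z u)) * ennreal (norm (dz u)) \<partial>lebesgue)"
proof -
  have g: "(\<lambda>\<zeta>. ennreal (g \<zeta>)) \<in> borel_measurable (restrict_space borel (graph_curve a))"
    using borel_measurable_continuous_on_restrict[OF assms] by measurable
  have gz: "(\<lambda>u. ennreal (g (z u))) \<in> borel_measurable lebesgue"
    using measurable_compose[OF z_measurable_curve g] .
  have "(\<integral>\<^sup>+\<zeta>. ennreal (g \<zeta>) \<partial>arc_length a) = (\<integral>\<^sup>+u. ennreal (g (z u)) \<partial>density lebesgue (\<lambda>u. ennreal (norm (dz u))))"
    unfolding arc_length_def using g z_measurable_curve by (intro nn_integral_distr) auto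
  also have "\<dots> = (\<integral>\<^sup>+u. ennreal (norm (dz u)) * ennreal (g (z u)) \<partial>lebesgue)"
    using gz by (intro nn_integral_density) auto
  finally show ?thesis by (simp add: mult.commute)
qed

text \<open>The graph is only Lipschitz, hence not piecewise continuously differentiable, and contour integrals
  in the usual sense are not defined along it. Primitives take the place of Cauchy's theorem: this is the only way in which
  integrals over the graph are evaluated.\<close>

lemma graph_integral_derivative:
  assumes "open U" and der: "\<And>w. w \<in> U \<Longrightarrow> (P has_field_derivative P' w) (at w)"
    and "\<alpha> \<le> \<beta>" and inU: "\<And>u. u \<in> {\<alpha>..\<beta>} \<Longrightarrow> z u + c \<in> U"
  shows "set_integrable lebesgue {\<alpha>..\<beta>} (\<lambda>u. P' (z u + c) * dz u)"
    and "(LINT u:{\<alpha>..\<beta>}|lebesgue. P' (z u + c) * dz u) = P (z \<beta> + c) - P (z \<alpha> + c)"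
proof -
  let ?K = "(\<lambda>u. z u + c) ` {\<alpha>..\<beta>}"
  have "compact ?K" by (intro compact_continuous_image continuous_intros) auto
  then obtain B where B: "B-lipschitz_on ?K P"
    using field_derivative_lipschitz_on_compact[OF \<open>open U\<close> der, of ?K] inU by blast
  have "(B * (1 + M))-lipschitz_on {\<alpha>..\<beta>} (\<lambda>u. P (z u + c))"
  proof (rule lipschitz_on_compose2[OF _ B])
    show "(1 + M)-lipschitz_on {\<alpha>..\<beta>} (\<lambda>u. z u + c)"
      using z_upper M_pos by (intro lipschitz_onI) (auto simp: dist_norm)
  qed
  moreover have "AE u in lebesgue. u \<in> {\<alpha><..<\<beta>} \<longrightarrow> ((\<lambda>u. P (z u + c)) has_vector_derivative P' (z u + c) * dz u) (at u)"
    using z_deriv_AE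
  proof eventually_elim
    case (elim u)
    show ?case
    proof
      assume "u \<in> {\<alpha><..<\<beta>}"
      then have "(P has_field_derivative P' (z u + c)) (at (z u + c))" by (intro der inU) auto
      moreover have "((\<lambda>u. z u + c) has_vector_derivative dz u) (at u)"
        using has_vector_derivative_add[OF elim has_vector_derivative_const[of c]] by simp
      ultimately have "((P \<circ> (\<lambda>u. z u + c)) has_vector_derivative dz u * P' (z u + c)) (at u)"
        by (intro field_vector_diff_chain_at)
      then show "((\<lambda>u. P (z u + c)) has_vector_derivative P' (z u + c) * dz u) (at u)" by (simp add: o_def mult.commute)
    qed
  qed
  ultimately show "set_integrable lebesgue {\<alpha>..\<beta>} (\<lambda>u. P' (z u + c) * dz u)"
    and "(LINT u:{\<alpha>..\<beta>}|lebesgue. P' (z u + c) * dz u) = P (z \<beta> + c) - P (z \<alpha> + c)"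
    by (rule lipschitz_integral_derivative[OF _ \<open>\<alpha> \<le> \<beta>\<close>])+
qed

end

section \<open>Uniform continuity of the primitive of a Hardy function\<close>

lemma vector_derivative_bound:
  fixes f :: "real \<Rightarrow> 'a :: real_normed_vector"
  assumes "convex S" and der: "\<And>s. s \<in> S \<Longrightarrow> (f has_vector_derivative f' s) (at s within S)"
    and bound: "\<And>s. s \<in> S \<Longrightarrow> norm (f' s) \<le> B" and "x \<in> S" "y \<in> S"
  shows "norm (f x - f y) \<le> B * norm (x - y)"
proof (rule differentiable_bound[OF \<open>convex S\<close> _ _ \<open>x \<in> S\<close> \<open>y \<in> S\<close>])
  fix s assume "s \<in> S"
  then show "(f has_derivative (\<lambda>h. h *\<^sub>R f' s)) (at s within S)"
    using der by (simp add: has_vector_derivative_def)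
  have "0 \<le> norm (f' s)" by simp
  then have "0 \<le> B" using bound[OF \<open>s \<in> S\<close>] by linarith
  then show "onorm (\<lambda>h. h *\<^sub>R f' s) \<le> B"
    using bound[OF \<open>s \<in> S\<close>] by (intro onorm_bound) (auto simp: mult.commute[of B] intro!: mult_left_mono)
qed

text \<open>Young's inequality with a weight. With \<open>y = 1\<close> it shows that a bound on \<open>p\<close>-th power integrals
  makes integrals over short intervals uniformly small, which replaces Hoelder's inequality
  and gives the uniform integrability used below.\<close>

lemma weighted_young:
  fixes x y :: real
  assumes "p > 1" "\<kappa> > 0" "x \<ge> 0" "y \<ge> 0"
  shows "x * y \<le> \<kappa> * x powr p + \<kappa> powr (- (1 / (p - 1))) * y powr (p / (p - 1))"
proof (cases "x = 0 \<or> y = 0")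
  case True
  then show ?thesis using assms by auto
next
  case False
  then have x: "x > 0" and y: "y > 0" using assms by auto
  show ?thesis
  proof (cases "y \<le> \<kappa> * x powr (p - 1)")
    case True
    then have "x * y \<le> x * (\<kappa> * x powr (p - 1))" using x by (intro mult_left_mono) auto
    also have "\<dots> = \<kappa> * (x powr 1 * x powr (p - 1))" using x by simp
    also have "\<dots> = \<kappa> * x powr p" by (simp only: powr_add[symmetric]) simp
    finally show ?thesis by (rule order_trans) (simp add: assms)
  next
    case False
    then have "x powr (p - 1) \<le> y / \<kappa>" using assms by (simp add: field_simps)
    then have "(x powr (p - 1)) powr (1 / (p - 1)) \<le> (y / \<kappa>) powr (1 / (p - 1))"
      using assms by (intro powr_mono2) auto
    then have "x \<le> (y / \<kappa>) powr (1 / (p - 1))" using x assms by (simp add: powr_powr)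
    then have "x * y \<le> (y / \<kappa>) powr (1 / (p - 1)) * y" using y by (intro mult_right_mono) auto
    also have "\<dots> = \<kappa> powr (- (1 / (p - 1))) * (y powr (1 / (p - 1)) * y powr 1)"
      using y assms by (simp add: powr_divide powr_minus_divide)
    also have "\<dots> = \<kappa> powr (- (1 / (p - 1))) * y powr (1 / (p - 1) + 1)" by (simp only: powr_add)
    also have "1 / (p - 1) + 1 = p / (p - 1)" using assms by (simp add: field_simps)
    finally show ?thesis using assms by (smt (verit) mult_nonneg_nonneg powr_ge_zero)
  qed
qed

context lipschitz_graph begin

definition height :: "complex \<Rightarrow> real" where "height w = Im w - a (Re w)"

lemma in_\<Omega>_iff: "w \<in> \<Omega> \<longleftrightarrow> height w > 0"
  by (simp add: upper_domain_def height_def)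

lemma height_z [simp]: "height (z u + \<i> * complex_of_real \<tau>) = \<tau>" "height (z u) = 0"
  by (simp_all add: height_def)

lemma z_height: "z (Re w) + \<i> * complex_of_real (height w) = w"
  by (simp add: complex_eq_iff height_def)

lemma height_shift [simp]: "height (w + \<i> * complex_of_real \<tau>) = height w + \<tau>"
  by (simp add: height_def)

lemma height_lip: "\<bar>height v - height w\<bar> \<le> (1 + M) * norm (v - w)"
proof -
  have "\<bar>Im (v - w)\<bar> \<le> norm (v - w)" by (rule abs_Im_le_cmod)
  moreover have "\<bar>a (Re v) - a (Re w)\<bar> \<le> M * norm (v - w)"
  proof -
    have "\<bar>Re v - Re w\<bar> \<le> norm (v - w)" using abs_Re_le_cmod[of "v - w"] by simp
    then have "M * \<bar>Re v - Re w\<bar> \<le> M * norm (v - w)" using M_pos by (intro mult_left_mono) auto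
    then show ?thesis using lip[of "Re v" "Re w"] by linarith
  qed
  ultimately show ?thesis by (simp add: height_def algebra_simps)
qed

lemma continuous_on_height: "continuous_on S height"
proof -
  have "(1 + M)-lipschitz_on S height"
    using height_lip M_pos by (intro lipschitz_onI) (auto simp: dist_norm)
  then show ?thesis by (rule lipschitz_on_continuous_on)
qed

lemma open_\<Omega>: "open \<Omega>"
proof -
  have "\<Omega> = {w. 0 < height w}" by (auto simp: in_\<Omega>_iff)
  then show ?thesis by (simp add: open_Collect_less continuous_on_height)
qed

lemma z_in_\<Omega>: "\<tau> > 0 \<Longrightarrow> z u + \<i> * complex_of_real \<tau> \<in> \<Omega>"
  by (simp add: in_\<Omega>_iff)

lemma simply_connected_\<Omega>: "simply_connected \<Omega>"
proof -
  let ?H = "{w. 0 < Im w}"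
  let ?f = "\<lambda>w. Complex (Re w) (Im w - a (Re w))" and ?g = "\<lambda>w. Complex (Re w) (Im w + a (Re w))"
  have ca: "continuous_on S (\<lambda>w. a (Re w))" for S
    by (intro continuous_on_compose2[OF continuous_on_a[of UNIV]] continuous_intros) auto
  have "continuous_on \<Omega> ?f" "continuous_on ?H ?g"
    by (subst Complex_eq, intro continuous_intros ca)+
  then have "homeomorphism \<Omega> ?H ?f ?g"
    by (intro homeomorphismI) (auto simp: upper_domain_def complex_eq_iff)
  then have "\<Omega> homeomorphic ?H" unfolding homeomorphic_def by blast
  moreover have "simply_connected ?H" by (intro convex_imp_simply_connected convex_halfspace_Im_gt)
  ultimately show ?thesis using homeomorphic_simply_connected_eq by blast
qed

lemma primitive_on_\<Omega>:
  assumes "f holomorphic_on \<Omega>"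
  obtains P where "\<And>w. w \<in> \<Omega> \<Longrightarrow> (P has_field_derivative f w) (at w)"
  using simply_connected_\<Omega> assms unfolding simply_connected_eq_global_primitive[OF open_\<Omega>] by blast

end

text \<open>The \<open>H\<^sup>p\<close> condition with respect to \<open>du\<close> instead of arc length. As \<open>norm (dz u)\<close> lies between
  \<open>1\<close> and \<open>1 + M\<close>, this is equivalent to the original condition.\<close>

locale hardy_function = lipschitz_graph +
  fixes p A :: real and F :: "complex \<Rightarrow> complex"
  assumes p: "1 < p"
    and F_hol: "F holomorphic_on \<Omega>"
    and A_nonneg: "0 \<le> A"
    and slice_integrable: "\<tau> > 0 \<Longrightarrow> integrable lebesgue (\<lambda>u. norm (F (z u + \<i> * complex_of_real \<tau>)) powr p)"
    and slice_bound: "\<tau> > 0 \<Longrightarrow> (LINT u|lebesgue. norm (F (z u + \<i> * complex_of_real \<tau>)) powr p) \<le> A"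
begin

lemma continuous_on_slice:
  assumes "\<tau> > 0" shows "continuous_on S (\<lambda>u. F (z u + \<i> * complex_of_real \<tau>))"
  by (rule continuous_on_compose2[OF holomorphic_on_imp_continuous_on[OF F_hol]])
     (auto intro!: continuous_intros z_in_\<Omega> assms)

lemma slice_measurable:
  assumes "\<tau> > 0" shows "(\<lambda>u. F (z u + \<i> * complex_of_real \<tau>)) \<in> borel_measurable lebesgue"
  using borel_measurable_continuous_onI[OF continuous_on_slice[OF assms]] by (intro measurable_completion) simp

lemma slice_increment:
  assumes G: "\<And>w. w \<in> \<Omega> \<Longrightarrow> (G has_field_derivative F w) (at w)"
    and "\<tau> > 0" "u \<le> v" "\<kappa> > 0"
  shows "norm (G (z v + \<i> * complex_of_real \<tau>) - G (z u + \<i> * complex_of_real \<tau>))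
     \<le> (1 + M) * (\<kappa> * (LINT t:{u..v}|lebesgue. norm (F (z t + \<i> * complex_of_real \<tau>)) powr p) + \<kappa> powr (- (1 / (p - 1))) * (v - u))"
proof -
  let ?c = "\<i> * complex_of_real \<tau>" and ?C = "\<kappa> powr (- (1 / (p - 1)))"
  have int: "set_integrable lebesgue {u..v} (\<lambda>t. F (z t + ?c) * dz t)"
    "(LINT t:{u..v}|lebesgue. F (z t + ?c) * dz t) = G (z v + ?c) - G (z u + ?c)"
    by (rule graph_integral_derivative[OF open_\<Omega> G \<open>u \<le> v\<close>]; simp add: z_in_\<Omega> \<open>\<tau> > 0\<close>)+
  have ip: "set_integrable lebesgue {u..v} (\<lambda>t. norm (F (z t + ?c)) powr p)"
    using integrable_mult_indicator[OF _ slice_integrable[OF \<open>\<tau> > 0\<close>], of "{u..v}"] unfolding set_integrable_def by simp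
  have ic: "set_integrable lebesgue {u..v} (\<lambda>t. ?C)"
    unfolding set_integrable_def using \<open>u \<le> v\<close> by (intro integrable_real_indicator integrable_scaleR_left) (auto simp: emeasure_lborel_Icc_eq)
  have "norm (G (z v + ?c) - G (z u + ?c)) \<le> (LINT t:{u..v}|lebesgue. norm (F (z t + ?c) * dz t))"
    unfolding int(2)[symmetric] by (rule set_integral_norm_bound[OF int(1)])
  also have "\<dots> \<le> (LINT t:{u..v}|lebesgue. (1 + M) * (\<kappa> * norm (F (z t + ?c)) powr p + ?C))"
  proof (rule set_integral_mono_AE)
    show "AE t\<in>{u..v} in lebesgue. norm (F (z t + ?c) * dz t) \<le> (1 + M) * (\<kappa> * norm (F (z t + ?c)) powr p + ?C)"
      using dz_bounds_AE
    proof eventually_elim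
      case (elim t)
      have "norm (F (z t + ?c) * dz t) \<le> norm (F (z t + ?c)) * (1 + M)"
        unfolding norm_mult using elim by (intro mult_left_mono) auto
      also have "\<dots> \<le> (\<kappa> * norm (F (z t + ?c)) powr p + ?C) * (1 + M)"
        using weighted_young[OF p \<open>\<kappa> > 0\<close>, of "norm (F (z t + ?c))" 1] M_pos by (intro mult_right_mono) auto
      finally show ?case by (simp add: mult.commute)
    qed
    show "set_integrable lebesgue {u..v} (\<lambda>t. (1 + M) * (\<kappa> * norm (F (z t + ?c)) powr p + ?C))"
      using ip ic by (intro set_integrable_mult_right set_integral_add(1)) auto
  qed (rule set_integrable_norm[OF int(1)])
  also have "\<dots> = (1 + M) * (\<kappa> * (LINT t:{u..v}|lebesgue. norm (F (z t + ?c)) powr p) + (LINT t:{u..v}|lebesgue. ?C))"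
    using ip ic by (simp add: set_integral_add(2))
  also have "(LINT t:{u..v}|lebesgue. ?C) = ?C * (v - u)"
    using \<open>u \<le> v\<close> by (simp add: set_lebesgue_integral_def mult.commute)
  finally show ?thesis .
qed

lemma slice_part_le:
  assumes "\<tau> > 0" "S \<in> sets lebesgue"
  shows "(LINT t:S|lebesgue. norm (F (z t + \<i> * complex_of_real \<tau>)) powr p) \<le> A"
proof -
  have "(LINT t:S|lebesgue. norm (F (z t + \<i> * complex_of_real \<tau>)) powr p) \<le> (LINT u|lebesgue. norm (F (z u + \<i> * complex_of_real \<tau>)) powr p)"
    unfolding set_lebesgue_integral_def
  proof (rule integral_mono)
    show "integrable lebesgue (\<lambda>t. indicat_real S t *\<^sub>R norm (F (z t + \<i> * complex_of_real \<tau>)) powr p)"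
      by (rule integrable_mult_indicator[OF assms(2) slice_integrable[OF assms(1)]])
  qed (auto simp: indicator_def intro: slice_integrable[OF assms(1)])
  then show ?thesis using slice_bound[OF assms(1)] by linarith
qed

lemma slices_equicontinuous:
  assumes G: "\<And>w. w \<in> \<Omega> \<Longrightarrow> (G has_field_derivative F w) (at w)" and "e > 0"
  obtains d where "d > 0" "\<And>\<tau> u v. \<tau> > 0 \<Longrightarrow> \<bar>u - v\<bar> \<le> d \<Longrightarrow>
    norm (G (z v + \<i> * complex_of_real \<tau>) - G (z u + \<i> * complex_of_real \<tau>)) \<le> e"
proof -
  define \<kappa> where "\<kappa> = e / (2 * (1 + M) * (A + 1))"
  define C where "C = \<kappa> powr (- (1 / (p - 1)))"
  define d where "d = e / (2 * (1 + M) * (C + 1))"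
  have pos: "\<kappa> > 0" "C \<ge> 0" "d > 0"
    using \<open>e > 0\<close> M_pos A_nonneg by (auto simp: \<kappa>_def C_def d_def add_nonneg_pos)
  have le: "norm (G (z v + \<i> * complex_of_real \<tau>) - G (z u + \<i> * complex_of_real \<tau>)) \<le> e"
    if "\<tau> > 0" "u \<le> v" "v - u \<le> d" for \<tau> u v
  proof -
    have "norm (G (z v + \<i> * complex_of_real \<tau>) - G (z u + \<i> * complex_of_real \<tau>))
     \<le> (1 + M) * (\<kappa> * (LINT t:{u..v}|lebesgue. norm (F (z t + \<i> * complex_of_real \<tau>)) powr p) + C * (v - u))"
      unfolding C_def by (rule slice_increment[OF G that(1,2) pos(1)])
    also have "\<dots> \<le> (1 + M) * (\<kappa> * (A + 1) + (C + 1) * d)"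
    proof (intro mult_left_mono add_mono)
      show "(LINT t:{u..v}|lebesgue. norm (F (z t + \<i> * complex_of_real \<tau>)) powr p) \<le> A + 1"
        using slice_part_le[OF that(1), of "{u..v}"] by simp
      show "C * (v - u) \<le> (C + 1) * d" using that pos by (intro mult_mono) auto
    qed (use pos M_pos in auto)
    also have "(1 + M) * (\<kappa> * (A + 1) + (C + 1) * d) = e"
    proof -
      have "\<kappa> * (A + 1) = e / (2 * (1 + M))" "(C + 1) * d = e / (2 * (1 + M))"
        using A_nonneg pos M_pos by (simp_all add: \<kappa>_def d_def)
      then show ?thesis using M_pos by (simp add: field_simps)
    qed
    finally show ?thesis .
  qed
  show ?thesis
  proof (rule that[OF pos(3)])
    fix \<tau> u v :: real assume "\<tau> > 0" "\<bar>u - v\<bar> \<le> d"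
    then show "norm (G (z v + \<i> * complex_of_real \<tau>) - G (z u + \<i> * complex_of_real \<tau>)) \<le> e"
      using le[of \<tau> u v] le[of \<tau> v u] by (cases "u \<le> v") (auto simp: norm_minus_commute)
  qed
qed

text \<open>The horizontal modulus of continuity of a primitive \<open>G\<close> of \<open>F\<close> is controlled by
  \<open>slices_equicontinuous\<close>. For the vertical direction let \<open>G2\<close> be a primitive of \<open>G\<close>. The increment
  \<open>D \<tau>\<close> of \<open>G2\<close> over the arc of the slice at height \<open>\<tau>\<close> between \<open>u\<close> and \<open>u + d\<close> is close to
  \<open>G (z u + \<i> \<tau>) * (z (u + d) - z u)\<close>, and its derivative in \<open>\<tau>\<close> is a horizontal increment of \<open>G\<close>,
  hence small. So \<open>G (z u + \<i> \<tau>)\<close> varies slowly in \<open>\<tau>\<close>.\<close>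

lemma primitive_uniformly_continuous:
  assumes G: "\<And>w. w \<in> \<Omega> \<Longrightarrow> (G has_field_derivative F w) (at w)"
  shows "uniformly_continuous_on \<Omega> G"
  unfolding uniformly_continuous_on_def
proof (intro allI impI)
  fix e :: real assume "e > 0"
  define e' where "e' = e / (5 + 2 * M)"
  have e': "e' > 0" "e' * (5 + 2 * M) = e" using \<open>e > 0\<close> M_pos by (auto simp: e'_def)
  obtain d where d: "d > 0" "\<And>\<tau> u v. \<tau> > 0 \<Longrightarrow> \<bar>u - v\<bar> \<le> d \<Longrightarrow>
    norm (G (z v + \<i> * complex_of_real \<tau>) - G (z u + \<i> * complex_of_real \<tau>)) \<le> e'"
    using slices_equicontinuous[OF G e'(1)] by blast
  have "G holomorphic_on \<Omega>" using G open_\<Omega> by (auto simp: holomorphic_on_open)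
  then obtain G2 where G2: "\<And>w. w \<in> \<Omega> \<Longrightarrow> (G2 has_field_derivative G w) (at w)"
    using primitive_on_\<Omega> by blast
  have vert: "norm (G (z u + \<i> * complex_of_real \<tau>) - G (z u + \<i> * complex_of_real \<sigma>)) \<le> e' * (3 + 2 * M)"
    if ts: "\<tau> > 0" "\<sigma> > 0" "\<bar>\<tau> - \<sigma>\<bar> \<le> d" for u \<tau> \<sigma>
  proof -
    define v where "v = u + d"
    define D where "D s = G2 (z v + \<i> * complex_of_real s) - G2 (z u + \<i> * complex_of_real s)" for s
    have approx: "norm (G (z u + \<i> * complex_of_real s) * (z v - z u) - D s) \<le> e' * (1 + M) * d" if "s > 0" for s
    proof -
      let ?c = "\<i> * complex_of_real s" and ?g = "G (z u + \<i> * complex_of_real s)"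
      have der: "((\<lambda>w. G2 w - ?g * w) has_field_derivative (G w - ?g)) (at w)" if "w \<in> \<Omega>" for w
        by (rule derivative_eq_intros G2[OF that] refl | simp)+
      have uv: "u \<le> v" using d by (simp add: v_def)
      have int: "set_integrable lebesgue {u..v} (\<lambda>t. (G (z t + ?c) - ?g) * dz t)"
        "(LINT t:{u..v}|lebesgue. (G (z t + ?c) - ?g) * dz t) = (G2 (z v + ?c) - ?g * (z v + ?c)) - (G2 (z u + ?c) - ?g * (z u + ?c))"
        by (rule graph_integral_derivative[OF open_\<Omega> der uv]; simp add: z_in_\<Omega> \<open>s > 0\<close>)+
      have "norm (LINT t:{u..v}|lebesgue. (G (z t + ?c) - ?g) * dz t) \<le> (LINT t:{u..v}|lebesgue. norm ((G (z t + ?c) - ?g) * dz t))"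
        by (rule set_integral_norm_bound[OF int(1)])
      also have "\<dots> \<le> (LINT t:{u..v}|lebesgue. e' * (1 + M))"
      proof (rule set_integral_mono_AE)
        show "set_integrable lebesgue {u..v} (\<lambda>t. e' * (1 + M))"
          unfolding set_integrable_def using uv by (intro integrable_real_indicator integrable_scaleR_left) (auto simp: emeasure_lborel_Icc_eq)
        show "AE t\<in>{u..v} in lebesgue. norm ((G (z t + ?c) - ?g) * dz t) \<le> e' * (1 + M)"
          using dz_bounds_AE
        proof eventually_elim
          case (elim t)
          show ?case
          proof
            assume "t \<in> {u..v}"
            then show "norm ((G (z t + ?c) - ?g) * dz t) \<le> e' * (1 + M)"
              unfolding norm_mult using elim d(2)[OF \<open>s > 0\<close>, of u t] e' by (intro mult_mono) (auto simp: v_def)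
          qed
        qed
      qed (rule set_integrable_norm[OF int(1)])
      also have "\<dots> = e' * (1 + M) * d"
        using d by (simp add: set_lebesgue_integral_def v_def mult.commute)
      finally have "norm (D s - ?g * (z v - z u)) \<le> e' * (1 + M) * d"
        unfolding int(2) D_def by (simp add: algebra_simps)
      then show ?thesis by (simp add: norm_minus_commute)
    qed
    have DL: "norm (D \<tau> - D \<sigma>) \<le> e' * \<bar>\<tau> - \<sigma>\<bar>"
    proof -
      have "norm (D \<tau> - D \<sigma>) \<le> e' * norm (\<tau> - \<sigma>)"
      proof (rule vector_derivative_bound[where S="{0<..}" and f'="\<lambda>s. \<i> * (G (z v + \<i> * complex_of_real s) - G (z u + \<i> * complex_of_real s))"])
        fix s :: real assume s: "s \<in> {0<..}"
        have 1: "((\<lambda>s. G2 (z x + \<i> * complex_of_real s)) has_vector_derivative (\<i> * G (z x + \<i> * complex_of_real s))) (at s)" for x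
        proof -
          have "((\<lambda>s. z x + \<i> * complex_of_real s) has_vector_derivative \<i>) (at s)"
            by (auto intro!: derivative_eq_intros)
          from field_vector_diff_chain_at[OF this G2[OF z_in_\<Omega>]] s show ?thesis by (simp add: o_def)
        qed
        show "(D has_vector_derivative (\<i> * (G (z v + \<i> * complex_of_real s) - G (z u + \<i> * complex_of_real s)))) (at s within {0<..})"
          unfolding D_def right_diff_distrib by (rule has_vector_derivative_at_within[OF has_vector_derivative_diff[OF 1 1]])
        show "norm (\<i> * (G (z v + \<i> * complex_of_real s) - G (z u + \<i> * complex_of_real s))) \<le> e'"
          unfolding norm_mult using d(2)[of s u v] s d(1) by (simp add: v_def)
      qed (use that in auto)
      then show ?thesis by simp
    qed
    let ?x = "G (z u + \<i> * complex_of_real \<tau>)" and ?y = "G (z u + \<i> * complex_of_real \<sigma>)"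
    have "d \<le> norm (z v - z u)" using z_lower[of v u] d by (simp add: v_def)
    then have "norm (?x - ?y) * d \<le> norm (?x - ?y) * norm (z v - z u)" by (intro mult_left_mono) auto
    also have "\<dots> = norm ((?x * (z v - z u) - D \<tau>) - (?y * (z v - z u) - D \<sigma>) + (D \<tau> - D \<sigma>))"
      unfolding norm_mult[symmetric] by (simp add: algebra_simps)
    also have "\<dots> \<le> norm (?x * (z v - z u) - D \<tau>) + norm (?y * (z v - z u) - D \<sigma>) + norm (D \<tau> - D \<sigma>)"
      by (meson add_mono norm_triangle_ineq norm_triangle_ineq4 order.refl order_trans)
    also have "\<dots> \<le> e' * (1 + M) * d + e' * (1 + M) * d + e' * d"
    proof (intro add_mono approx ts)
      show "norm (D \<tau> - D \<sigma>) \<le> e' * d" by (rule order_trans[OF DL]) (use ts e' in \<open>intro mult_left_mono, auto\<close>)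
    qed
    also have "\<dots> = (e' * (3 + 2 * M)) * d" by (simp add: algebra_simps)
    finally show ?thesis using d(1) by simp
  qed
  show "\<exists>r>0. \<forall>w\<in>\<Omega>. \<forall>w'\<in>\<Omega>. dist w' w < r \<longrightarrow> dist (G w') (G w) < e"
  proof (intro exI[of _ "d / (1 + M)"] conjI ballI impI)
    show "0 < d / (1 + M)" using d M_pos by simp
    fix w w' assume w: "w \<in> \<Omega>" "w' \<in> \<Omega>" and "dist w' w < d / (1 + M)"
    then have n: "(1 + M) * norm (w' - w) < d" using M_pos by (simp add: dist_norm field_simps)
    have h: "\<bar>height w' - height w\<bar> \<le> d" using height_lip[of w' w] n by linarith
    have "norm (w' - w) \<le> (1 + M) * norm (w' - w)" using M_pos by (simp add: algebra_simps)
    then have r: "\<bar>Re w - Re w'\<bar> \<le> d" using abs_Re_le_cmod[of "w - w'"] n by (simp add: norm_minus_commute)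
    have hp: "height w > 0" "height w' > 0" using w by (auto simp: in_\<Omega>_iff)
    have "norm (G w' - G w) \<le> norm (G (z (Re w') + \<i> * complex_of_real (height w')) - G (z (Re w') + \<i> * complex_of_real (height w)))
       + norm (G (z (Re w') + \<i> * complex_of_real (height w)) - G (z (Re w) + \<i> * complex_of_real (height w)))"
      unfolding z_height by (rule norm_diff_triangle_le[OF order_refl order_refl])
    also have "\<dots> \<le> e' * (3 + 2 * M) + e'"
      using vert[OF hp(2,1) h] d(2)[OF hp(1) r] by (rule add_mono)
    also have "\<dots> < e" using e' by (simp add: algebra_simps)
    finally show "dist (G w') (G w) < e" by (simp add: dist_norm)
  qed
qed

text \<open>Cauchy's estimate for \<open>F = G'\<close> on discs of a fixed radius inside \<open>\<Omega>\<close>, on which uniform continuity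
  bounds the increments of \<open>G\<close>.\<close>

lemma F_bounded_above:
  assumes "\<tau> > 0"
  obtains B where "B > 0" "\<And>w. height w \<ge> \<tau> \<Longrightarrow> norm (F w) \<le> B"
proof -
  obtain G where G: "\<And>w. w \<in> \<Omega> \<Longrightarrow> (G has_field_derivative F w) (at w)"
    using primitive_on_\<Omega>[OF F_hol] by blast
  obtain d where d: "d > 0" "\<And>w w'. w \<in> \<Omega> \<Longrightarrow> w' \<in> \<Omega> \<Longrightarrow> dist w' w < d \<Longrightarrow> dist (G w') (G w) < 1"
    using primitive_uniformly_continuous[OF G] unfolding uniformly_continuous_on_def by (metis zero_less_one)
  define r where "r = min (d / 2) (\<tau> / (2 * (1 + M)))"
  have r: "r > 0" "r < d" "(1 + M) * r \<le> \<tau> / 2"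
  proof -
    show "r > 0" "r < d" using d assms M_pos by (auto simp: r_def min_less_iff_disj)
    have "(1 + M) * r \<le> (1 + M) * (\<tau> / (2 * (1 + M)))" using M_pos by (intro mult_left_mono) (auto simp: r_def)
    also have "\<dots> = \<tau> / 2" using M_pos by (simp add: divide_simps)
    finally show "(1 + M) * r \<le> \<tau> / 2" .
  qed
  have "norm (F w) \<le> 1 / r" if w: "height w \<ge> \<tau>" for w
  proof -
    have sub: "cball w r \<subseteq> \<Omega>"
    proof
      fix x assume x: "x \<in> cball w r"
      have "\<bar>height w - height x\<bar> \<le> (1 + M) * norm (w - x)" by (rule height_lip)
      also have "\<dots> \<le> (1 + M) * r" using x M_pos by (intro mult_left_mono) (auto simp: dist_norm)
      finally show "x \<in> \<Omega>" using r w assms by (simp add: in_\<Omega>_iff)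
    qed
    have w\<Omega>: "w \<in> \<Omega>" using w assms by (simp add: in_\<Omega>_iff)
    have hol: "(\<lambda>x. G x - G w) holomorphic_on \<Omega>"
      using G open_\<Omega> by (intro holomorphic_intros) (auto simp: holomorphic_on_open)
    have "norm ((deriv ^^ 1) (\<lambda>x. G x - G w) w) \<le> fact 1 * 1 / r ^ 1"
    proof (rule Cauchy_inequality)
      show "(\<lambda>x. G x - G w) holomorphic_on ball w r" using hol sub ball_subset_cball by (meson holomorphic_on_subset order_trans)
      show "continuous_on (cball w r) (\<lambda>x. G x - G w)" using hol sub holomorphic_on_imp_continuous_on holomorphic_on_subset by blast
      fix x assume x: "norm (w - x) = r"
      then have "x \<in> \<Omega>" using sub by (auto simp: dist_norm)
      then show "norm (G x - G w) \<le> 1" using d(2)[OF w\<Omega>, of x] x r by (simp add: dist_norm norm_minus_commute)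
    qed (rule r)
    moreover have "deriv (\<lambda>x. G x - G w) w = F w"
      by (rule DERIV_imp_deriv) (rule derivative_eq_intros G[OF w\<Omega>] refl | simp)+
    ultimately show ?thesis by simp
  qed
  then show ?thesis using r by (intro that[of "1 / r"]) auto
qed

end

section \<open>Nontangential limits\<close>

lemma Re_csqrt_ge:
  assumes "Re y \<ge> - (norm y / 2)"
  shows "sqrt (norm y) / 2 \<le> Re (csqrt y)"
proof -
  have "sqrt (norm y) / 2 = sqrt (norm y / 4)" by (simp add: real_sqrt_divide)
  also have "\<dots> \<le> sqrt ((norm y + Re y) / 2)" using assms by (intro real_sqrt_le_mono) auto
  finally show ?thesis by simp
qed

text \<open>A Phragmen-Lindelof argument at a boundary point \<open>w0\<close> near which \<open>U\<close> is contained in the sector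
  of half-opening \<open>2\<pi>/3\<close> around the direction \<open>cnj c\<close>. Put \<open>s = csqrt ((w - w0) * c)\<close>; then the real
  parts of \<open>s\<close> and \<open>1 / s\<close> are comparable to \<open>norm s\<close> and \<open>1 / norm s\<close>. The quotient
  \<open>H w / (w - w0)\<close>, multiplied by \<open>exp (- L * s - \<kappa> / s)\<close>, is at most \<open>\<epsilon>\<close> on the frontier of
  \<open>U \<inter> {\<rho> < norm (w - w0) < \<delta>}\<close>: on the frontier of \<open>U\<close> by assumption, on the outer circle because
  \<open>L\<close> is large, on the inner circle because \<open>\<rho>\<close> is small compared with \<open>\<kappa>\<close>. The maximum principle
  carries the bound inside, and for \<open>w\<close> close to \<open>w0\<close> with \<open>\<kappa> = sqrt (norm (w - w0))\<close> the
  exponential factor is at least \<open>exp (- 2)\<close>, which exceeds \<open>1 / 9\<close>.\<close>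

lemma local_phragmen_lindelof:
  fixes U :: "complex set" and H :: "complex \<Rightarrow> complex"
  assumes "open U" "norm c = 1" "\<delta> > 0" "\<epsilon> > 0"
    and sect: "\<And>w. w \<in> closure U \<Longrightarrow> norm (w - w0) \<le> \<delta> \<Longrightarrow> Re ((w - w0) * c) \<ge> - (norm (w - w0) / 2)"
    and cont: "continuous_on (closure U) H" and hol: "H holomorphic_on U"
    and bdry: "\<And>w. w \<in> frontier U \<Longrightarrow> norm (w - w0) \<le> \<delta> \<Longrightarrow> norm (H w) \<le> \<epsilon> * norm (w - w0)"
  obtains d where "d > 0" "\<And>w. w \<in> U \<Longrightarrow> norm (w - w0) < d \<Longrightarrow> norm (H w) \<le> 9 * \<epsilon> * norm (w - w0)"
proof -
  define s where "s w = csqrt ((w - w0) * c)" for w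
  have ny: "norm ((w - w0) * c) = norm (w - w0)" for w using \<open>norm c = 1\<close> by (simp add: norm_mult)
  have ns: "norm (s w) = sqrt (norm (w - w0))" for w unfolding s_def by (simp add: norm_mult \<open>norm c = 1\<close>)
  have Re_s: "Re (s w) \<ge> sqrt (norm (w - w0)) / 2" if "w \<in> closure U" "norm (w - w0) \<le> \<delta>" for w
    using Re_csqrt_ge[of "(w - w0) * c"] sect[OF that] unfolding s_def ny by simp
  have Re_inv_s: "Re (1 / s w) \<ge> 1 / (2 * sqrt (norm (w - w0)))" if "w \<in> closure U" "norm (w - w0) \<le> \<delta>" "w \<noteq> w0" for w
  proof -
    have "Re (1 / s w) = Re (s w) / (norm (s w))\<^sup>2" by (simp add: Re_divide cmod_power2)
    also have "(norm (s w))\<^sup>2 = norm (w - w0)" by (simp add: ns)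
    also have "Re (s w) / norm (w - w0) \<ge> (sqrt (norm (w - w0)) / 2) / norm (w - w0)"
      using Re_s[OF that(1,2)] by (intro divide_right_mono) auto
    also have "(sqrt (norm (w - w0)) / 2) / norm (w - w0) = 1 / (2 * sqrt (norm (w - w0)))"
      using that real_sqrt_mult_self[of "norm (w - w0)"] by (simp add: field_simps)
    finally show ?thesis .
  qed
  have "compact (closure U \<inter> cball w0 \<delta>)" by (simp add: closed_Int_compact)
  then have "bounded (H ` (closure U \<inter> cball w0 \<delta>))"
    by (intro compact_imp_bounded compact_continuous_image continuous_on_subset[OF cont]) auto
  then obtain B0 where "\<forall>x\<in>closure U \<inter> cball w0 \<delta>. norm (H x) \<le> B0"
    unfolding bounded_iff by auto
  then have B0: "\<And>w. w \<in> closure U \<Longrightarrow> norm (w - w0) \<le> \<delta> \<Longrightarrow> norm (H w) \<le> B0"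
    by (simp add: dist_norm norm_minus_commute)
  define B where "B = \<bar>B0\<bar> + 1"
  have B: "B > 0" "\<And>w. w \<in> closure U \<Longrightarrow> norm (w - w0) \<le> \<delta> \<Longrightarrow> norm (H w) \<le> B"
    using B0 unfolding B_def by (auto, force)
  define L where "L = 2 / sqrt \<delta> * ln (max 1 (B / (\<delta> * \<epsilon>)))"
  have L0: "L \<ge> 0" unfolding L_def using \<open>\<delta> > 0\<close> by (intro mult_nonneg_nonneg ln_ge_zero) auto
  have L: "B / \<delta> * exp (- (L * (sqrt \<delta> / 2))) \<le> \<epsilon>"
  proof -
    have "L * (sqrt \<delta> / 2) = ln (max 1 (B / (\<delta> * \<epsilon>)))" using \<open>\<delta> > 0\<close> by (simp add: L_def)
    then have "exp (L * (sqrt \<delta> / 2)) = max 1 (B / (\<delta> * \<epsilon>))" by simp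
    then have "B / (\<delta> * \<epsilon>) \<le> exp (L * (sqrt \<delta> / 2))" by simp
    then show ?thesis using \<open>\<delta> > 0\<close> \<open>\<epsilon> > 0\<close> by (simp add: exp_minus field_simps)
  qed
  define d where "d = min \<delta> (1 / (L + 1)\<^sup>2)"
  have main: "norm (H w) \<le> 9 * \<epsilon> * norm (w - w0)" if w: "w \<in> U" "norm (w - w0) < d" for w
  proof (cases "w = w0")
    case True
    show ?thesis
    proof -
      \<comment> \<open>The centre is not in \<open>U\<close>: the sector condition would fail just below it.\<close>
      have "w0 \<in> U" using True w by simp
      then obtain e where e: "e > 0" "ball w0 e \<subseteq> U" using \<open>open U\<close> openE by blast
      define t where "t = min (e / 2) \<delta>"
      have t: "t > 0" "t < e" "t \<le> \<delta>" using e \<open>\<delta> > 0\<close> by (auto simp: t_def)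
      define v where "v = w0 - of_real t * cnj c"
      have vw: "v - w0 = - (of_real t * cnj c)" by (simp add: v_def)
      have nv: "norm (v - w0) = t" using t \<open>norm c = 1\<close> unfolding vw by (simp add: norm_mult)
      then have "v \<in> ball w0 e" using t by (simp add: dist_norm norm_minus_commute)
      then have "v \<in> closure U" using e(2) closure_subset by blast
      then have "Re ((v - w0) * c) \<ge> - (t / 2)" using sect[of v] nv t by simp
      moreover have "(v - w0) * c = - of_real t"
        using \<open>norm c = 1\<close> complex_norm_square[of c] unfolding vw by (simp add: mult.assoc mult.commute[of "cnj c"])
      ultimately have "- t \<ge> - (t / 2)" by simp
      then show ?thesis using t by simp
    qed
  next
    case False
    define r where "r = norm (w - w0)"
    have r: "r > 0" "r < \<delta>" "r < 1 / (L + 1)\<^sup>2" using False w by (auto simp: r_def d_def)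
    define \<kappa> where "\<kappa> = sqrt r"
    have \<kappa>: "\<kappa> > 0" using r by (simp add: \<kappa>_def)
    obtain \<rho> where \<rho>: "0 < \<rho>" "\<rho> < r" "B / \<rho> * exp (- (\<kappa> * (1 / (2 * sqrt \<rho>)))) \<le> \<epsilon>"
    proof -
      have "((\<lambda>x. (4 * B / \<kappa>\<^sup>2) * (x ^ 2 / exp x)) \<longlongrightarrow> (4 * B / \<kappa>\<^sup>2) * 0) at_top"
        by (intro tendsto_intros tendsto_power_div_exp_0)
      then have "\<forall>\<^sub>F x in at_top. (4 * B / \<kappa>\<^sup>2) * (x ^ 2 / exp x) < \<epsilon>"
        using \<open>\<epsilon> > 0\<close> by (intro order_tendstoD(2)) auto
      moreover have "\<forall>\<^sub>F x::real in at_top. x > 1" by (rule eventually_gt_at_top)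
      ultimately have "\<forall>\<^sub>F x in at_top. (4 * B / \<kappa>\<^sup>2) * (x ^ 2 / exp x) < \<epsilon> \<and> x > 1" by eventually_elim auto
      then obtain x where x: "(4 * B / \<kappa>\<^sup>2) * (x ^ 2 / exp x) < \<epsilon>" "x > 1"
        using eventually_happens by force
      define \<rho> where "\<rho> = (\<kappa> / (2 * x))\<^sup>2"
      have s\<rho>: "sqrt \<rho> = \<kappa> / (2 * x)" using \<kappa> x by (simp add: \<rho>_def)
      show ?thesis
      proof (rule that[of \<rho>])
        show "0 < \<rho>" using \<kappa> x by (simp add: \<rho>_def)
        have "\<kappa> / (2 * x) < \<kappa>" using \<kappa> x by (simp add: field_simps)
        then have "\<rho> < \<kappa>\<^sup>2" unfolding \<rho>_def using \<kappa> x by (intro power_strict_mono) auto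
        then show "\<rho> < r" using r by (simp add: \<kappa>_def)
        have e1: "\<kappa> * (1 / (2 * sqrt \<rho>)) = x" unfolding s\<rho> using \<kappa> x by simp
        have e2: "B / \<rho> = (4 * B / \<kappa>\<^sup>2) * x\<^sup>2" using \<kappa> x by (simp add: \<rho>_def power_divide power_mult_distrib)
        show "B / \<rho> * exp (- (\<kappa> * (1 / (2 * sqrt \<rho>)))) \<le> \<epsilon>"
          unfolding e1 e2 using x by (simp add: exp_minus field_simps)
      qed
    qed
    define S where "S = U \<inter> {v. \<rho> < norm (v - w0)} \<inter> {v. norm (v - w0) < \<delta>}"
    have openS: "open S" unfolding S_def using \<open>open U\<close>
      by (intro open_Int open_Collect_less continuous_intros)
    have clS: "closure S \<subseteq> closure U \<inter> {v. \<rho> \<le> norm (v - w0)} \<inter> {v. norm (v - w0) \<le> \<delta>}"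
    proof (rule closure_minimal)
      show "S \<subseteq> closure U \<inter> {v. \<rho> \<le> norm (v - w0)} \<inter> {v. norm (v - w0) \<le> \<delta>}"
        using closure_subset by (auto simp: S_def)
      show "closed (closure U \<inter> {v. \<rho> \<le> norm (v - w0)} \<inter> {v. norm (v - w0) \<le> \<delta>})"
        by (intro closed_Int closed_closure closed_Collect_le continuous_intros)
    qed
    define \<Phi> where "\<Phi> v = H v / (v - w0) * exp (- (of_real L * s v) - of_real \<kappa> * (1 / s v))" for v
    have nonneg: "(v - w0) * c \<notin> \<real>\<^sub>\<le>\<^sub>0" "v \<noteq> w0" "s v \<noteq> 0" if "v \<in> closure S" for v
    proof -
      have v: "v \<in> closure U" "\<rho> \<le> norm (v - w0)" "norm (v - w0) \<le> \<delta>" using clS that by auto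
      show "v \<noteq> w0" using v \<rho> by auto
      then show "s v \<noteq> 0" using \<open>norm c = 1\<close> by (auto simp: s_def)
      show "(v - w0) * c \<notin> \<real>\<^sub>\<le>\<^sub>0"
      proof
        assume "(v - w0) * c \<in> \<real>\<^sub>\<le>\<^sub>0"
        then obtain x where x: "(v - w0) * c = of_real x" "x \<le> 0" by (auto elim!: nonpos_Reals_cases)
        then have "norm (v - w0) = - x" using ny[of v] by simp
        then show False using sect[OF v(1,3)] x v(2) \<rho>(1) by simp
      qed
    qed
    have norm\<Phi>: "norm (\<Phi> v) = norm (H v) / norm (v - w0) * exp (- (L * Re (s v)) - \<kappa> * Re (1 / s v))" for v
      unfolding \<Phi>_def norm_mult norm_divide norm_exp_eq_Re
    by (simp only: minus_complex.simps uminus_complex.simps times_complex.simps Re_complex_of_real Im_complex_of_real mult_zero_left diff_zero)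
    have cs: "continuous_on (closure S) s"
      unfolding s_def using nonneg(1) 
      by (intro continuous_on_compose2[OF holomorphic_on_imp_continuous_on[OF holomorphic_on_csqrt]] continuous_intros) auto
    have hs: "s holomorphic_on S"
      unfolding s_def using nonneg(1) closure_subset[of S]
      by (intro holomorphic_on_compose_gen[OF _ holomorphic_on_csqrt, unfolded o_def] holomorphic_intros) auto
    have \<Phi>w: "norm (\<Phi> w) \<le> \<epsilon>"
    proof (rule maximum_modulus_frontier[where f=\<Phi> and S=S and \<xi>=w])
      show "\<Phi> holomorphic_on interior S"
      proof -
        have "H holomorphic_on S" using hol by (rule holomorphic_on_subset) (auto simp: S_def)
        then have "\<Phi> holomorphic_on S"
          unfolding \<Phi>_def using nonneg(2,3) closure_subset[of S] hs by (intro holomorphic_intros) auto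
        then show ?thesis using interior_open[OF openS] by simp
      qed
      show "continuous_on (closure S) \<Phi>"
      proof -
        have "continuous_on (closure S) H" using cont by (rule continuous_on_subset) (use clS in auto)
        then show ?thesis unfolding \<Phi>_def using nonneg(2,3) cs by (intro continuous_intros) auto
      qed
      show "bounded S" by (rule bounded_subset[of "cball w0 \<delta>"]) (auto simp: S_def dist_norm norm_minus_commute)
      show "w \<in> S" using w \<rho> r by (auto simp: S_def r_def)
      fix v assume "v \<in> frontier S"
      then have v': "v \<in> closure S" "v \<notin> S" using interior_open[OF openS] by (auto simp: frontier_def)
      then have v: "v \<in> closure U" "\<rho> \<le> norm (v - w0)" "norm (v - w0) \<le> \<delta>" using clS by auto
      have vw: "v \<noteq> w0" using nonneg v' by blast
      note b1 = Re_s[OF v(1,3)] and b2 = Re_inv_s[OF v(1,3) vw]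
      have p1: "0 \<le> Re (s v)" by (rule order_trans[OF _ b1]) simp
      have p2: "0 \<le> Re (1 / s v)" by (rule order_trans[OF _ b2]) simp
      have q1: "0 \<le> L * Re (s v)" using L0 p1 by (rule mult_nonneg_nonneg)
      have q2: "0 \<le> \<kappa> * Re (1 / s v)" using \<kappa> p2 by (intro mult_nonneg_nonneg) auto
      have np: "norm (v - w0) > 0" using vw by simp
      consider "v \<notin> U" | "norm (v - w0) = \<rho>" | "norm (v - w0) = \<delta>"
        using v v' by (auto simp: S_def)
      then show "norm (\<Phi> v) \<le> \<epsilon>"
      proof cases
        case 1
        then have "v \<in> frontier U" using v(1) interior_open[OF \<open>open U\<close>] by (simp add: frontier_def)
        then have "norm (H v) / norm (v - w0) \<le> \<epsilon>" using bdry v(3) np by (simp add: divide_le_eq)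
        moreover have "exp (- (L * Re (s v)) - \<kappa> * Re (1 / s v)) \<le> 1" using q1 q2 by simp
        ultimately show ?thesis unfolding norm\<Phi> using mult_mono[of "norm (H v) / norm (v - w0)" \<epsilon> _ 1] \<open>\<epsilon> > 0\<close> by auto
      next
        case 2
        have "\<kappa> * (1 / (2 * sqrt \<rho>)) \<le> \<kappa> * Re (1 / s v)" using b2 \<kappa> unfolding 2 by (intro mult_left_mono) auto
        then have "norm (\<Phi> v) \<le> B / \<rho> * exp (- (\<kappa> * (1 / (2 * sqrt \<rho>))))"
          unfolding norm\<Phi> 2 using q1 B v \<rho>(1) by (intro mult_mono divide_right_mono) auto
        then show ?thesis using \<rho>(3) by linarith
      next
        case 3
        have "L * (sqrt \<delta> / 2) \<le> L * Re (s v)" using b1 L0 unfolding 3 by (intro mult_left_mono) auto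
        then have "norm (\<Phi> v) \<le> B / \<delta> * exp (- (L * (sqrt \<delta> / 2)))"
          unfolding norm\<Phi> 3 using q2 B v \<open>\<delta> > 0\<close> by (intro mult_mono divide_right_mono) auto
        then show ?thesis using L by linarith
      qed
    qed
    have *: "norm (H w) / r \<le> \<epsilon> * exp (L * Re (s w) + \<kappa> * Re (1 / s w))"
    proof -
      have E: "h \<le> \<epsilon> * exp (x + y)" if "h * exp (- x - y) \<le> \<epsilon>" for h x y :: real
        using mult_right_mono[OF that, of "exp (x + y)"] by (simp add: mult.assoc mult_exp_exp)
      show ?thesis using \<Phi>w unfolding norm\<Phi> r_def[symmetric] by (rule E)
    qed
    have "L * Re (s w) \<le> L * sqrt r" using complex_Re_le_cmod[of "s w"] L0 unfolding ns r_def by (intro mult_left_mono) auto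
    also have "\<dots> \<le> (L + 1) * (1 / (L + 1))"
    proof (intro mult_mono)
      have "sqrt r \<le> sqrt (1 / (L + 1)\<^sup>2)" using r by (intro real_sqrt_le_mono) auto
      then show "sqrt r \<le> 1 / (L + 1)" using L0 by (simp add: real_sqrt_divide)
    qed (use L0 r in auto)
    also have "\<dots> = 1" using L0 by simp
    finally have e1: "L * Re (s w) \<le> 1" .
    have "\<kappa> * Re (1 / s w) \<le> \<kappa> * (1 / sqrt r)"
      using complex_Re_le_cmod[of "1 / s w"] \<kappa> unfolding norm_divide ns r_def by (intro mult_left_mono) auto
    then have e2: "\<kappa> * Re (1 / s w) \<le> 1" using r by (simp add: \<kappa>_def)
    have "exp (L * Re (s w) + \<kappa> * Re (1 / s w)) \<le> exp (1 + 1)" using e1 e2 by (subst exp_le_cancel_iff) linarith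
    also have "\<dots> = exp 1 * exp (1::real)" by (rule exp_add)
    also have "\<dots> \<le> 3 * 3" using exp_le by (intro mult_mono) auto
    finally have "\<epsilon> * exp (L * Re (s w) + \<kappa> * Re (1 / s w)) \<le> \<epsilon> * (3 * 3)"
      using \<open>\<epsilon> > 0\<close> by (intro mult_left_mono) auto
    with * have "norm (H w) / r \<le> \<epsilon> * 9" by simp
    then show ?thesis using r by (simp add: r_def[symmetric] field_simps)
  qed
  have "d > 0" using \<open>\<delta> > 0\<close> L0 by (simp add: d_def)
  then show ?thesis using main by (rule that)
qed


context lipschitz_graph begin

lemma closure_\<Omega>: "closure \<Omega> = {w. 0 \<le> height w}"
proof (intro equalityI subsetI)
  have "closure \<Omega> \<subseteq> {w. 0 \<le> height w}"
    by (rule closure_minimal) (auto simp: in_\<Omega>_iff intro!: closed_Collect_le continuous_on_height continuous_on_const)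
  then show "w \<in> {w. 0 \<le> height w}" if "w \<in> closure \<Omega>" for w using that by blast
  fix w assume w: "w \<in> {w. 0 \<le> height w}"
  have "(\<lambda>n. w + \<i> * complex_of_real (1 / real (Suc n))) \<longlonglongrightarrow> w + \<i> * complex_of_real 0"
    by (intro tendsto_intros LIMSEQ_inverse_real_of_nat[unfolded inverse_eq_divide])
  moreover have "w + \<i> * complex_of_real (1 / real (Suc n)) \<in> \<Omega>" for n
  proof -
    have "0 < 1 / real (Suc n)" by simp
    then show ?thesis using w unfolding in_\<Omega>_iff height_shift mem_Collect_eq by linarith
  qed
  ultimately show "w \<in> closure \<Omega>" unfolding closure_sequential by force
qed

lemma frontier_\<Omega>: "frontier \<Omega> = range z"
proof -
  have "frontier \<Omega> = {w. height w = 0}"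
    unfolding frontier_def closure_\<Omega> interior_open[OF open_\<Omega>] by (auto simp: in_\<Omega>_iff)
  also have "\<dots> = range z"
  proof (intro equalityI subsetI)
    fix w assume "w \<in> {w. height w = 0}"
    then have "w = z (Re w)" using z_height[of w] by simp
    then show "w \<in> range z" by (rule range_eqI)
  qed auto
  finally show ?thesis .
qed

text \<open>Multiplication by \<open>- \<i> * cnj (sgn d)\<close> rotates the upper normal of the graph to the positive real
  axis. The real part then measures, up to the factor \<open>norm d\<close>, how far \<open>w\<close> is above the tangent.\<close>

lemma normal_coordinate:
  assumes "Re d = 1"
  shows "Re ((w - z u) * (- \<i> * cnj (sgn d))) * norm d = Im w - a u - Im d * (Re w - u)"
proof -
  have "norm d > 0" using assms by auto
  have "Re ((w - z u) * (- \<i> * cnj (sgn d))) * norm d = Re ((w - z u) * (- \<i> * cnj (of_real (norm d) * sgn d)))"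
    by (simp add: algebra_simps)
  also have "of_real (norm d) * sgn d = d" using \<open>norm d > 0\<close> by (simp add: sgn_eq)
  finally show ?thesis using assms by (simp add: algebra_simps)
qed

lemma tangent_estimate:
  assumes "(z has_vector_derivative d) (at u)" and "\<eta> > 0"
  obtains \<delta> where "\<delta> > 0" "\<And>v. \<bar>v - u\<bar> < \<delta> \<Longrightarrow> \<bar>a v - a u - Im d * (v - u)\<bar> \<le> \<eta> * \<bar>v - u\<bar>"
proof -
  obtain \<delta> where \<delta>: "\<delta> > 0" "\<And>v. norm (v - u) < \<delta> \<Longrightarrow> norm (z v - z u - (v - u) *\<^sub>R d) \<le> \<eta> * norm (v - u)"
    using assms unfolding has_vector_derivative_def has_derivative_within_alt by blast
  show ?thesis
  proof (rule that[OF \<delta>(1)])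
    fix v assume "\<bar>v - u\<bar> < \<delta>"
    then have "norm (z v - z u - (v - u) *\<^sub>R d) \<le> \<eta> * \<bar>v - u\<bar>" using \<delta>(2)[of v] by simp
    then show "\<bar>a v - a u - Im d * (v - u)\<bar> \<le> \<eta> * \<bar>v - u\<bar>"
      using abs_Im_le_cmod[of "z v - z u - (v - u) *\<^sub>R d"] by (simp add: mult.commute)
  qed
qed

lemma small_at_boundary_imp_small:
  assumes dz: "(z has_vector_derivative d) (at u)"
    and cont: "continuous_on (closure \<Omega>) H" and hol: "H holomorphic_on \<Omega>"
    and Hz: "((\<lambda>v. H (z v)) has_vector_derivative 0) (at u)" "H (z u) = 0"
    and "\<epsilon> > 0"
  obtains \<delta> where "\<delta> > 0" "\<And>w. w \<in> \<Omega> \<Longrightarrow> norm (w - z u) < \<delta> \<Longrightarrow> norm (H w) \<le> \<epsilon> * norm (w - z u)"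
proof -
  have Rd: "Re d = 1" using Re_z_derivative[OF dz] .
  have nd: "norm d \<ge> 1" using complex_Re_le_cmod[of d] Rd by simp
  obtain \<delta>1 where \<delta>1: "\<delta>1 > 0" "\<And>v. norm (v - u) < \<delta>1 \<Longrightarrow> norm (H (z v) - H (z u) - (v - u) *\<^sub>R 0) \<le> (\<epsilon> / 9) * norm (v - u)"
  proof -
    have "\<epsilon> / 9 > 0" using \<open>\<epsilon> > 0\<close> by simp
    then show ?thesis using Hz(1) that unfolding has_vector_derivative_def has_derivative_within_alt by blast
  qed
  obtain \<delta>2 where \<delta>2: "\<delta>2 > 0" "\<And>v. \<bar>v - u\<bar> < \<delta>2 \<Longrightarrow> \<bar>a v - a u - Im d * (v - u)\<bar> \<le> (1/2) * \<bar>v - u\<bar>"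
    using tangent_estimate[OF dz, of "1/2"] by auto
  define \<delta> where "\<delta> = min \<delta>1 \<delta>2 / 2"
  have \<delta>: "\<delta> > 0" "\<delta> < \<delta>1" "\<delta> < \<delta>2" using \<delta>1 \<delta>2 by (auto simp: \<delta>_def)
  let ?c = "- \<i> * cnj (sgn d)"
  have "d \<noteq> 0" using nd by auto
  then have nc: "norm ?c = 1" by (simp add: norm_mult norm_sgn)
  have Re_le: "\<bar>Re w - u\<bar> \<le> norm (w - z u)" for w using abs_Re_le_cmod[of "w - z u"] by simp
  obtain r where r: "r > 0" "\<And>w. w \<in> \<Omega> \<Longrightarrow> norm (w - z u) < r \<Longrightarrow> norm (H w) \<le> 9 * (\<epsilon> / 9) * norm (w - z u)"
  proof (rule local_phragmen_lindelof[OF open_\<Omega> nc \<delta>(1), where \<epsilon>="\<epsilon> / 9" and H=H and ?w0.0="z u"])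
    fix w assume w: "norm (w - z u) \<le> \<delta>"
    show "- (norm (w - z u) / 2) \<le> Re ((w - z u) * ?c)" if "w \<in> closure \<Omega>"
    proof (cases "Re ((w - z u) * ?c) \<ge> 0")
      case True then show ?thesis by (rule order_trans[rotated]) simp
    next
      case False
      have "\<bar>Re w - u\<bar> < \<delta>2" using Re_le[of w] w \<delta> by linarith
      then have "\<bar>a (Re w) - a u - Im d * (Re w - u)\<bar> \<le> (1/2) * \<bar>Re w - u\<bar>" by (rule \<delta>2(2))
      then have "- ((1/2) * \<bar>Re w - u\<bar>) \<le> a (Re w) - a u - Im d * (Re w - u)" by (simp only: abs_le_iff minus_le_iff)
      moreover have "a (Re w) \<le> Im w" using that by (simp add: closure_\<Omega> height_def)
      moreover have "- (N / 2) \<le> y - b - D" if "- ((1/2) * X) \<le> x - b - D" "x \<le> y" "X \<le> N" for N X x y b D :: real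
        using that by linarith
      ultimately have "- (norm (w - z u) / 2) \<le> Im w - a u - Im d * (Re w - u)" using Re_le[of w] by blast
      also have "\<dots> = Re ((w - z u) * ?c) * norm d" by (rule normal_coordinate[OF Rd, symmetric])
      also have "\<dots> \<le> Re ((w - z u) * ?c) * 1" using nd False by (intro mult_left_mono_neg) auto
      finally show ?thesis by simp
    qed
    show "norm (H w) \<le> \<epsilon> / 9 * norm (w - z u)" if "w \<in> frontier \<Omega>"
    proof -
      obtain v where v: "w = z v" using \<open>w \<in> frontier \<Omega>\<close> unfolding frontier_\<Omega> by auto
      then have "norm (v - u) < \<delta>1" using Re_le[of w] w \<delta> by simp
      then have "norm (H w) \<le> (\<epsilon> / 9) * norm (v - u)" using \<delta>1(2)[of v] Hz(2) v by simp
      also have "\<dots> \<le> (\<epsilon> / 9) * norm (w - z u)" using Re_le[of w] v \<open>\<epsilon> > 0\<close> by (intro mult_left_mono) auto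
      finally show ?thesis .
    qed
  qed (use \<open>\<epsilon> > 0\<close> cont hol in auto)
  show ?thesis by (rule that[OF r(1)]) (use r(2) in simp)
qed

lemma sin_ge_of_sector:
  assumes "0 < \<phi>" "\<phi> < t" "t < pi - \<phi>" shows "sin \<phi> \<le> sin t"
proof (cases "t \<le> pi / 2")
  case True
  then show ?thesis using assms by (intro sin_monotone_2pi_le) auto
next
  case False
  then have "sin \<phi> \<le> sin (pi - t)" using assms by (intro sin_monotone_2pi_le) auto
  then show ?thesis by simp
qed

text \<open>Let \<open>H\<close> be \<open>G\<close> minus its first-order expansion at \<open>z u\<close>. Along the graph \<open>H\<close> is of smaller order
  than the distance to \<open>z u\<close>, hence so it is in all of \<open>\<Omega>\<close> near \<open>z u\<close>. In a sector, \<open>F w - l = H' w\<close>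
  is then small by Cauchy's estimate on a disc of radius proportional to the distance.\<close>

lemma nontangential_limit_of_derivative:
  assumes dz: "(z has_vector_derivative d) (at u)"
    and cont: "continuous_on (closure \<Omega>) G" and der: "\<And>w. w \<in> \<Omega> \<Longrightarrow> (G has_field_derivative F w) (at w)"
    and Gz: "((\<lambda>v. G (z v)) has_vector_derivative D) (at u)"
  shows "has_nontangential_limit a F (z u) (D / d)"
proof -
  have Rd: "Re d = 1" using Re_z_derivative[OF dz] .
  have nd: "norm d \<ge> 1" using complex_Re_le_cmod[of d] Rd by simp
  have d0: "d \<noteq> 0" using nd by auto
  define l where "l = D / d"
  define H where "H w = G w - G (z u) - l * (w - z u)" for w
  have Hcont: "continuous_on (closure \<Omega>) H" unfolding H_def by (intro continuous_intros cont)
  have Hder: "(H has_field_derivative (F w - l)) (at w)" if "w \<in> \<Omega>" for w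
    unfolding H_def by (rule derivative_eq_intros der[OF that] refl | simp)+
  have Hhol: "H holomorphic_on \<Omega>" using Hder open_\<Omega> by (auto simp: holomorphic_on_open)
  have Hz: "((\<lambda>v. H (z v)) has_vector_derivative 0) (at u)" "H (z u) = 0"
  proof -
    have "((\<lambda>v. H (z v)) has_vector_derivative (D - 0 - l * (d - 0))) (at u)"
      unfolding H_def by (intro has_vector_derivative_diff has_vector_derivative_mult_right Gz dz has_vector_derivative_const)
    then show "((\<lambda>v. H (z v)) has_vector_derivative 0) (at u)" using d0 by (simp add: l_def)
  qed (simp add: H_def)
  have "(F \<longlongrightarrow> l) (at (z u) within sector (z u) (Arg d) \<phi> \<inter> \<Omega>)" if \<phi>: "\<phi> \<in> {0<..<pi/2}" for \<phi>
    unfolding tendsto_iff eventually_at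
  proof (intro allI impI)
    fix e :: real assume "e > 0"
    define k where "k = sin \<phi> / 2"
    have "sin \<phi> > 0" using \<phi> by (intro sin_gt_zero) auto
    then have k: "k > 0" "k \<le> 1" using order_trans[OF sin_le_one[of \<phi>], of 2] by (auto simp: k_def)
    obtain \<delta>1 where \<delta>1: "\<delta>1 > 0" "\<And>w. w \<in> \<Omega> \<Longrightarrow> norm (w - z u) < \<delta>1 \<Longrightarrow> norm (H w) \<le> (e * k / 4) * norm (w - z u)"
      using small_at_boundary_imp_small[OF dz Hcont Hhol Hz, of "e * k / 4"] \<open>e > 0\<close> k by auto
    obtain \<delta>2 where \<delta>2: "\<delta>2 > 0" "\<And>v. \<bar>v - u\<bar> < \<delta>2 \<Longrightarrow> \<bar>a v - a u - Im d * (v - u)\<bar> \<le> (k / 4) * \<bar>v - u\<bar>"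
      using tangent_estimate[OF dz, of "k / 4"] k by auto
    define \<delta> where "\<delta> = min \<delta>1 \<delta>2 / 2"
    have \<delta>: "\<delta> > 0" "2 * \<delta> \<le> \<delta>1" "2 * \<delta> \<le> \<delta>2" using \<delta>1 \<delta>2 by (auto simp: \<delta>_def)
    have "dist (F w) l < e" if w: "w \<in> sector (z u) (Arg d) \<phi> \<inter> \<Omega>" "w \<noteq> z u" "dist w (z u) < \<delta>" for w
    proof -
      obtain r \<theta> where w_eq: "w = z u + complex_of_real r * exp (\<i> * complex_of_real \<theta>)" and r: "r > 0"
        and \<theta>: "\<phi> < \<theta> - Arg d" "\<theta> - Arg d < pi - \<phi>" using w(1) unfolding sector_def by auto
      have nr: "norm (w - z u) = r" using r by (simp add: w_eq norm_mult)
      have r\<delta>: "r < \<delta>" using w(3) nr by (simp add: dist_norm)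
      have sgn_d: "cnj (sgn d) = exp (- (\<i> * complex_of_real (Arg d)))"
      proof -
        have "d = of_real (norm d) * exp (\<i> * complex_of_real (Arg d))" by (rule Arg_eq[OF d0])
        then have "sgn d = exp (\<i> * complex_of_real (Arg d))" using nd d0 by (simp add: sgn_eq field_simps)
        then show ?thesis by (simp add: exp_cnj)
      qed
      let ?c = "- \<i> * cnj (sgn d)"
      have nc: "norm ?c = 1" using d0 by (simp add: norm_mult norm_sgn)
      have "(w - z u) * ?c = complex_of_real r * (- \<i> * exp (\<i> * complex_of_real (\<theta> - Arg d)))"
        unfolding w_eq sgn_d by (simp add: exp_diff exp_minus right_diff_distrib divide_inverse)
      then have "Re ((w - z u) * ?c) = Re (complex_of_real r * (- \<i> * exp (\<i> * complex_of_real (\<theta> - Arg d))))"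
        by (rule arg_cong)
      also have "\<dots> = r * sin (\<theta> - Arg d)"
        by (simp add: Im_exp del: of_real_diff)
      finally have "Re ((w - z u) * ?c) = r * sin (\<theta> - Arg d)" .
      moreover have "2 * k \<le> sin (\<theta> - Arg d)" unfolding k_def using sin_ge_of_sector[of \<phi> "\<theta> - Arg d"] \<theta> \<phi> by simp
      ultimately have Rew: "2 * k * r \<le> Re ((w - z u) * ?c)" using r by (simp add: mult.commute)
      have sub: "x \<in> \<Omega> \<and> norm (x - z u) \<le> 2 * r" if x: "norm (w - x) \<le> k * r" for x
      proof
        have "k * r \<le> r" using k r by simp
        then show n2: "norm (x - z u) \<le> 2 * r" using x norm_triangle_ineq4[of "w - z u" "w - x"] nr by simp
        have "\<bar>Re ((x - w) * ?c)\<bar> \<le> k * r"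
          using abs_Re_le_cmod[of "(x - w) * ?c"] x nc by (simp add: norm_mult norm_minus_commute)
        moreover have "Re ((x - z u) * ?c) = Re ((w - z u) * ?c) + Re ((x - w) * ?c)" by (simp add: algebra_simps)
        ultimately have Rx: "k * r \<le> Re ((x - z u) * ?c)" using Rew by linarith
        have "k * r * 1 \<le> Re ((x - z u) * ?c) * norm d"
          using Rx nd k r order_trans[OF _ Rx, of 0] by (intro mult_mono) auto
        then have 1: "k * r \<le> Im x - a u - Im d * (Re x - u)" unfolding normal_coordinate[OF Rd] by simp
        have X: "\<bar>Re x - u\<bar> \<le> 2 * r" using abs_Re_le_cmod[of "x - z u"] n2 by simp
        then have "\<bar>a (Re x) - a u - Im d * (Re x - u)\<bar> \<le> (k / 4) * \<bar>Re x - u\<bar>"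
          using r\<delta> \<delta> by (intro \<delta>2(2)) linarith
        also have "\<dots> \<le> (k / 4) * (2 * r)" using X k by (intro mult_left_mono) auto
        also have "\<dots> < k * r" using k r by simp
        finally show "x \<in> \<Omega>" using 1 unfolding in_\<Omega>_iff height_def by linarith
      qed
      have "norm ((deriv ^^ 1) H w) \<le> fact 1 * (e * k / 4 * (2 * r)) / (k * r) ^ 1"
      proof (rule Cauchy_inequality)
        have cb: "cball w (k * r) \<subseteq> \<Omega>" using sub by (auto simp: dist_norm)
        show "H holomorphic_on ball w (k * r)"
          by (rule holomorphic_on_subset[OF Hhol order_trans[OF ball_subset_cball cb]])
        show "continuous_on (cball w (k * r)) H"
          by (rule continuous_on_subset[OF holomorphic_on_imp_continuous_on[OF Hhol] cb])
        show "0 < k * r" using k r by simp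
        fix x assume "norm (w - x) = k * r"
        then have x: "x \<in> \<Omega>" "norm (x - z u) \<le> 2 * r" using sub[of x] by auto
        have "norm (H x) \<le> (e * k / 4) * norm (x - z u)" using x r\<delta> \<delta> by (intro \<delta>1(2)) auto
        also have "\<dots> \<le> e * k / 4 * (2 * r)" using x \<open>e > 0\<close> k by (intro mult_left_mono) auto
        finally show "norm (H x) \<le> e * k / 4 * (2 * r)" .
      qed
      also have "fact 1 * (e * k / 4 * (2 * r)) / (k * r) ^ 1 = e / 2" using k r by simp
      finally have "norm (deriv H w) \<le> e / 2" by simp
      moreover have "deriv H w = F w - l" using w(1) by (intro DERIV_imp_deriv Hder) auto
      ultimately show ?thesis using \<open>e > 0\<close> by (simp add: dist_norm)
    qed
    then show "\<exists>\<delta>>0. \<forall>w\<in>sector (z u) (Arg d) \<phi> \<inter> \<Omega>. w \<noteq> z u \<and> dist w (z u) < \<delta> \<longrightarrow> dist (F w) l < e"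
      using \<delta>(1) by blast
  qed
  moreover have "Arg d \<in> {-(pi/2)<..<pi/2}" using Arg_Re_pos[of d] Rd by (auto simp: abs_less_iff)
  ultimately show ?thesis
    unfolding has_nontangential_limit_def l_def[symmetric] using dz Arg_eq[OF d0] by blast
qed

end

context hardy_function begin

text \<open>On the slices at height \<open>h n\<close>, the increments of \<open>G\<close> over \<open>{u..v}\<close> are at most \<open>1 + M\<close> times
  \<open>X n v - X n u + (v - u)\<close>, where \<open>X n\<close> is the distribution function of the \<open>p\<close>-th power of \<open>F\<close>.
  The functions \<open>X n\<close> need not converge, but lower limits are superadditive, so the increments of
  their lower limit \<open>V\<close> dominate the lower limits of their increments.\<close>

lemma boundary_primitive_differentiable_AE:
  assumes G: "\<And>w. w \<in> \<Omega> \<Longrightarrow> (G has_field_derivative F w) (at w)" and cont: "continuous_on (closure \<Omega>) G"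
  shows "AE u in lebesgue. (\<lambda>u. G (z u)) differentiable (at u)"
proof -
  define h where "h n = 1 / real (Suc n)" for n
  have h: "h n > 0" for n by (simp add: h_def)
  define X where "X n u = (LINT t:{..u}|lebesgue. norm (F (z t + \<i> * complex_of_real (h n))) powr p)" for n u
  have X0: "0 \<le> X n u" for n u unfolding X_def set_lebesgue_integral_def by (intro Bochner_Integration.integral_nonneg) auto
  have XA: "X n u \<le> A" for n u unfolding X_def by (rule slice_part_le[OF h]) simp
  have ip: "set_integrable lebesgue S (\<lambda>t. norm (F (z t + \<i> * complex_of_real (h n))) powr p)" if "S \<in> sets lebesgue" for n S
    unfolding set_integrable_def by (rule integrable_mult_indicator[OF that slice_integrable[OF h]])
  have Xadd: "X n v = X n u + (LINT t:{u..v}|lebesgue. norm (F (z t + \<i> * complex_of_real (h n))) powr p)" if "u \<le> v" for n u v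
  proof -
    have "{..v} = {..u} \<union> {u..v}" using that by auto
    moreover have "AE t in lebesgue. \<not> (t \<in> {..u} \<and> t \<in> {u..v})"
      using AE_completion[OF AE_lborel_singleton[of u]] by eventually_elim auto
    ultimately show ?thesis unfolding X_def by (simp add: set_integral_Un_AE ip)
  qed
  define V where "V u = Sup {y. \<forall>\<^sub>F n in sequentially. y \<le> X n u}" for u
  have bdd: "bdd_above {y. \<forall>\<^sub>F n in sequentially. y \<le> X n u}" for u
  proof (rule bdd_aboveI[of _ A])
    fix y assume "y \<in> {y. \<forall>\<^sub>F n in sequentially. y \<le> X n u}"
    then obtain n where "y \<le> X n u" using eventually_happens'[OF sequentially_bot] by blast
    then show "y \<le> A" using XA[of n u] by linarith
  qed
  have ne: "0 \<in> {y. \<forall>\<^sub>F n in sequentially. y \<le> X n u}" for u using X0 by simp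
  have lim: "(\<lambda>n. G (z u + \<i> * complex_of_real (h n))) \<longlonglongrightarrow> G (z u)" for u
  proof -
    have "(\<lambda>n. z u + \<i> * complex_of_real (h n)) \<longlonglongrightarrow> z u + \<i> * complex_of_real 0"
      unfolding h_def by (intro tendsto_intros LIMSEQ_inverse_real_of_nat[unfolded inverse_eq_divide])
    then have "(\<lambda>n. z u + \<i> * complex_of_real (h n)) \<longlonglongrightarrow> z u" by simp
    moreover have "z u \<in> closure \<Omega>" "\<forall>\<^sub>F n in sequentially. z u + \<i> * complex_of_real (h n) \<in> closure \<Omega>"
      unfolding closure_\<Omega> mem_Collect_eq height_z using less_imp_le[OF h] by simp_all
    ultimately show ?thesis by (rule continuous_on_tendsto_compose[OF cont])
  qed
  have dom: "norm (G (z v) - G (z u)) \<le> (1 + M) * (V v + v) - (1 + M) * (V u + u)" if uv: "u \<le> v" for u v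
  proof (rule field_le_epsilon)
    fix e :: real assume "e > 0"
    let ?D = "norm (G (z v) - G (z u))"
    define c where "c = (?D - e) / (1 + M) - (v - u)"
    have "(\<lambda>n. norm (G (z v + \<i> * complex_of_real (h n)) - G (z u + \<i> * complex_of_real (h n)))) \<longlonglongrightarrow> ?D"
      by (intro tendsto_intros lim)
    then have "\<forall>\<^sub>F n in sequentially. ?D - e < norm (G (z v + \<i> * complex_of_real (h n)) - G (z u + \<i> * complex_of_real (h n)))"
      using \<open>e > 0\<close> by (intro order_tendstoD(1)) auto
    then have ev: "\<forall>\<^sub>F n in sequentially. X n u + c \<le> X n v"
    proof eventually_elim
      case (elim n)
      have "?D - e \<le> (1 + M) * (1 * (LINT t:{u..v}|lebesgue. norm (F (z t + \<i> * complex_of_real (h n))) powr p) + 1 powr (- (1 / (p - 1))) * (v - u))"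
        using elim slice_increment[OF G h[of n] uv, of 1] by simp
      also have "\<dots> = (1 + M) * (X n v - X n u + (v - u))" using Xadd[OF uv, of n] by simp
      finally have "(?D - e) / (1 + M) \<le> X n v - X n u + (v - u)" using M_pos by (simp add: pos_divide_le_eq mult.commute)
      then show ?case by (simp add: c_def)
    qed
    have "V u \<le> V v - c"
      unfolding V_def[of u]
    proof (rule cSup_least)
      show "{y. \<forall>\<^sub>F n in sequentially. y \<le> X n u} \<noteq> {}" using ne by blast
      fix y assume "y \<in> {y. \<forall>\<^sub>F n in sequentially. y \<le> X n u}"
      then have "\<forall>\<^sub>F n in sequentially. y \<le> X n u" by simp
      with ev have "\<forall>\<^sub>F n in sequentially. y + c \<le> X n v" by eventually_elim simp
      then have "y + c \<le> V v" unfolding V_def by (intro cSup_upper bdd) simp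
      then show "y \<le> V v - c" by simp
    qed
    then have "(?D - e) / (1 + M) \<le> V v - V u + (v - u)" by (simp add: c_def)
    then have "?D - e \<le> (V v - V u + (v - u)) * (1 + M)" using M_pos by (simp add: pos_divide_le_eq)
    then show "?D \<le> (1 + M) * (V v + v) - (1 + M) * (V u + u) + e" by (simp add: algebra_simps)
  qed
  show ?thesis
  proof (rule dominated_complex_differentiable_AE[OF _ dom])
    show "continuous_on UNIV (\<lambda>u. G (z u))"
      by (rule continuous_on_compose2[OF cont continuous_on_z]) (auto simp: closure_\<Omega>)
  qed
qed

lemma nontangential_limit_AE: "AE u in lebesgue. \<exists>l. has_nontangential_limit a F (z u) l"
proof -
  obtain G0 where G0: "\<And>w. w \<in> \<Omega> \<Longrightarrow> (G0 has_field_derivative F w) (at w)"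
    using primitive_on_\<Omega>[OF F_hol] by blast
  obtain G where G: "uniformly_continuous_on (closure \<Omega>) G" "\<And>w. w \<in> \<Omega> \<Longrightarrow> G0 w = G w"
    by (rule uniformly_continuous_on_extension_on_closure[OF primitive_uniformly_continuous[OF G0]]) (assumption, rule that)
  have cont: "continuous_on (closure \<Omega>) G" by (rule uniformly_continuous_imp_continuous[OF G(1)])
  have der: "(G has_field_derivative F w) (at w)" if "w \<in> \<Omega>" for w
    by (rule has_field_derivative_transform_within_open[OF G0[OF that] open_\<Omega> that G(2)])
  have "AE u in lebesgue. (\<lambda>u. G (z u)) differentiable (at u)"
    by (rule boundary_primitive_differentiable_AE[OF der cont])
  with z_deriv_AE show ?thesis
  proof eventually_elim
    case (elim u)
    then have "((\<lambda>v. G (z v)) has_vector_derivative vector_derivative (\<lambda>v. G (z v)) (at u)) (at u)"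
      by (simp add: vector_derivative_works)
    then show ?case using nontangential_limit_of_derivative[OF elim(1) cont der] by blast
  qed
qed

end

section \<open>The Cauchy integral formula\<close>

lemma integrable_abs_powr:
  fixes s q x :: real
  assumes "s > 0" "q > 1"
  shows "integrable lebesgue (\<lambda>u. (s + \<bar>u - x\<bar>) powr (- q))"
proof -
  define f :: "real \<Rightarrow> real" where "f v = indicator {s..} v * v powr (- q)" for v
  have "(\<lambda>v. v powr (- q)) integrable_on {s..}"
    using has_integral_powr_to_inf[of "- q" s] assms by (auto simp: integrable_on_def)
  then have "set_integrable lebesgue {s..} (\<lambda>v. v powr (- q))"
    by (intro nonnegative_absolutely_integrable_1) auto
  then have "integrable lebesgue f" unfolding set_integrable_def f_def by simp
  moreover have fm: "f \<in> borel_measurable lborel" unfolding f_def by measurable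
  ultimately have f: "integrable lborel f" by (simp add: integrable_completion)
  have "integrable lborel (\<lambda>u. f ((s - x) + 1 * u) + f ((s + x) + (-1) * u))"
    by (intro Bochner_Integration.integrable_add lborel_integrable_real_affine f) auto
  then have "integrable lborel (\<lambda>u. (s + \<bar>u - x\<bar>) powr (- q))"
  proof (rule Bochner_Integration.integrable_bound)
    show "AE u in lborel. norm ((s + \<bar>u - x\<bar>) powr (- q)) \<le> norm (f ((s - x) + 1 * u) + f ((s + x) + (-1) * u))"
    proof (intro AE_I2)
      fix u
      have f0: "0 \<le> f v" for v by (simp add: f_def)
      have "(s + \<bar>u - x\<bar>) powr (- q) \<le> f ((s - x) + 1 * u) + f ((s + x) + (-1) * u)"
      proof (cases "u \<ge> x")
        case True
        then have "(s + \<bar>u - x\<bar>) powr (- q) = f ((s - x) + 1 * u)" by (simp add: f_def algebra_simps)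
        then show ?thesis using f0[of "(s + x) + (-1) * u"] by linarith
      next
        case False
        then have "(s + \<bar>u - x\<bar>) powr (- q) = f ((s + x) + (-1) * u)" by (simp add: f_def algebra_simps)
        then show ?thesis using f0[of "(s - x) + 1 * u"] by linarith
      qed
      then show "norm ((s + \<bar>u - x\<bar>) powr (- q)) \<le> norm (f ((s - x) + 1 * u) + f ((s + x) + (-1) * u))" by simp
    qed
  qed measurable
  then show ?thesis by (subst integrable_completion) auto
qed

lemma integrable_product_young:
  fixes f g :: "'a \<Rightarrow> complex"
  assumes p: "p > 1" and [measurable]: "f \<in> borel_measurable N" "g \<in> borel_measurable N"
    and f: "integrable N (\<lambda>x. norm (f x) powr p)" and g: "integrable N (\<lambda>x. norm (g x) powr (p / (p - 1)))"
  shows "integrable N (\<lambda>x. f x * g x)"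
    and "\<kappa> > 0 \<Longrightarrow> (LINT x|N. norm (f x * g x)) \<le> \<kappa> * (LINT x|N. norm (f x) powr p)
            + \<kappa> powr (- (1 / (p - 1))) * (LINT x|N. norm (g x) powr (p / (p - 1)))"
proof -
  let ?b = "\<lambda>\<kappa> x. \<kappa> * norm (f x) powr p + \<kappa> powr (- (1 / (p - 1))) * norm (g x) powr (p / (p - 1))"
  have b: "integrable N (?b \<kappa>)" for \<kappa> by (intro Bochner_Integration.integrable_add integrable_mult_right f g)
  have le: "norm (f x * g x) \<le> ?b \<kappa> x" if "\<kappa> > 0" for \<kappa> x
    unfolding norm_mult by (rule weighted_young[OF p that]) auto
  show 1: "integrable N (\<lambda>x. f x * g x)"
  proof (rule Bochner_Integration.integrable_bound[OF b[of 1]])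
    show "AE x in N. norm (f x * g x) \<le> norm (?b 1 x)"
      using le[of 1] by (intro AE_I2) (auto intro: order_trans)
  qed measurable
  assume \<kappa>: "\<kappa> > 0"
  have "(LINT x|N. norm (f x * g x)) \<le> (LINT x|N. ?b \<kappa> x)"
    by (intro integral_mono integrable_norm 1 b le \<kappa>)
  also have "\<dots> = \<kappa> * (LINT x|N. norm (f x) powr p)
            + \<kappa> powr (- (1 / (p - 1))) * (LINT x|N. norm (g x) powr (p / (p - 1)))"
    using f g by simp
  finally show "(LINT x|N. norm (f x * g x)) \<le> \<kappa> * (LINT x|N. norm (f x) powr p)
            + \<kappa> powr (- (1 / (p - 1))) * (LINT x|N. norm (g x) powr (p / (p - 1)))" .
qed

text \<open>Fatou's lemma gives a bound for the limit. By \<open>weighted_young\<close>, the integrand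
  \<open>norm ((f n x - f0 x) * g x)\<close> exceeds \<open>\<kappa> * norm (f n x - f0 x) powr p\<close> at most by a fixed multiple of
  the integrable function \<open>norm (g x) powr (p / (p - 1))\<close>; dominated convergence applies to this excess, and the rest is
  of size \<open>\<kappa>\<close>.\<close>

lemma weak_convergence_of_AE_bounded:
  fixes f :: "nat \<Rightarrow> 'a \<Rightarrow> complex" and f0 g :: "'a \<Rightarrow> complex"
  assumes p: "p > 1" and f [measurable]: "\<And>n. f n \<in> borel_measurable N" and f0 [measurable]: "f0 \<in> borel_measurable N"
    and g [measurable]: "g \<in> borel_measurable N"
    and lim: "AE x in N. (\<lambda>n. f n x) \<longlonglongrightarrow> f0 x"
    and fp: "\<And>n. integrable N (\<lambda>x. norm (f n x) powr p)" "\<And>n. (LINT x|N. norm (f n x) powr p) \<le> A"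
    and gq: "integrable N (\<lambda>x. norm (g x) powr (p / (p - 1)))"
  shows "integrable N (\<lambda>x. f0 x * g x)" and "(\<lambda>n. LINT x|N. f n x * g x) \<longlonglongrightarrow> (LINT x|N. f0 x * g x)"
proof -
  have A0: "0 \<le> A" using fp(2)[of 0] by (rule order_trans[rotated]) simp
  have f0p: "integrable N (\<lambda>x. norm (f0 x) powr p)" "(LINT x|N. norm (f0 x) powr p) \<le> A"
  proof -
    have "(\<integral>\<^sup>+x. ennreal (norm (f0 x) powr p) \<partial>N) = (\<integral>\<^sup>+x. liminf (\<lambda>n. ennreal (norm (f n x) powr p)) \<partial>N)"
    proof (rule nn_integral_cong_AE)
      show "AE x in N. ennreal (norm (f0 x) powr p) = liminf (\<lambda>n. ennreal (norm (f n x) powr p))"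
        using lim
      proof eventually_elim
        case (elim x)
        have "(\<lambda>n. norm (f n x) powr p) \<longlonglongrightarrow> norm (f0 x) powr p"
          using p by (intro tendsto_powr' tendsto_intros elim) auto
        then have "(\<lambda>n. ennreal (norm (f n x) powr p)) \<longlonglongrightarrow> ennreal (norm (f0 x) powr p)" by (rule tendsto_ennrealI)
        then show ?case by (intro lim_imp_Liminf[symmetric]) auto
      qed
    qed
    also have "\<dots> \<le> liminf (\<lambda>n. \<integral>\<^sup>+x. ennreal (norm (f n x) powr p) \<partial>N)"
      by (rule nn_integral_liminf) measurable
    also have "\<dots> \<le> liminf (\<lambda>n. ennreal A)"
    proof (rule Liminf_mono, rule always_eventually, rule allI)
      fix n
      have "(\<integral>\<^sup>+x. ennreal (norm (f n x) powr p) \<partial>N) = ennreal (LINT x|N. norm (f n x) powr p)"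
        by (rule nn_integral_eq_integral[OF fp(1)]) auto
      also have "\<dots> \<le> ennreal A" by (rule ennreal_leI[OF fp(2)])
      finally show "(\<integral>\<^sup>+x. ennreal (norm (f n x) powr p) \<partial>N) \<le> ennreal A" .
    qed
    also have "\<dots> = ennreal A" by (simp add: Liminf_const)
    finally have le: "(\<integral>\<^sup>+x. ennreal (norm (f0 x) powr p) \<partial>N) \<le> ennreal A" .
    show "integrable N (\<lambda>x. norm (f0 x) powr p)"
      by (rule integrableI_nonneg) (auto intro: order_le_less_trans[OF le])
    show "(LINT x|N. norm (f0 x) powr p) \<le> A" by (rule integral_real_bounded[OF A0 le])
  qed
  show i0: "integrable N (\<lambda>x. f0 x * g x)" by (rule integrable_product_young[OF p f0 g f0p(1) gq])
  have ifg: "integrable N (\<lambda>x. f n x * g x)" for n by (rule integrable_product_young[OF p f g fp(1) gq])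
  have dp_le: "norm (f n x - f0 x) powr p \<le> 2 powr p * (norm (f n x) powr p + norm (f0 x) powr p)" for n x
  proof -
    let ?m = "max (norm (f n x)) (norm (f0 x))"
    have "norm (f n x - f0 x) \<le> 2 * ?m" using norm_triangle_ineq4[of "f n x" "f0 x"] by linarith
    then have "norm (f n x - f0 x) powr p \<le> (2 * ?m) powr p" using p by (intro powr_mono2) auto
    also have "\<dots> = 2 powr p * ?m powr p" by (rule powr_mult)
    also have "\<dots> \<le> 2 powr p * (norm (f n x) powr p + norm (f0 x) powr p)"
      by (intro mult_left_mono) (auto simp: max_def)
    finally show ?thesis .
  qed
  have dp: "integrable N (\<lambda>x. norm (f n x - f0 x) powr p)" "(LINT x|N. norm (f n x - f0 x) powr p) \<le> 2 powr p * (A + A)" for n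
  proof -
    have ib: "integrable N (\<lambda>x. 2 powr p * (norm (f n x) powr p + norm (f0 x) powr p))"
      by (intro integrable_mult_right Bochner_Integration.integrable_add fp f0p)
    show i: "integrable N (\<lambda>x. norm (f n x - f0 x) powr p)"
    proof (rule Bochner_Integration.integrable_bound[OF ib])
      show "AE x in N. norm (norm (f n x - f0 x) powr p) \<le> norm (2 powr p * (norm (f n x) powr p + norm (f0 x) powr p))"
        using dp_le by (intro AE_I2) (auto intro: order_trans)
    qed measurable
    have "(LINT x|N. norm (f n x - f0 x) powr p) \<le> (LINT x|N. 2 powr p * (norm (f n x) powr p + norm (f0 x) powr p))"
      by (intro integral_mono i ib dp_le)
    also have "\<dots> = 2 powr p * ((LINT x|N. norm (f n x) powr p) + (LINT x|N. norm (f0 x) powr p))"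
      using fp f0p by simp
    also have "\<dots> \<le> 2 powr p * (A + A)" by (intro mult_left_mono add_mono fp f0p) auto
    finally show "(LINT x|N. norm (f n x - f0 x) powr p) \<le> 2 powr p * (A + A)" .
  qed
  have idg: "integrable N (\<lambda>x. (f n x - f0 x) * g x)" for n
    by (rule integrable_product_young[OF p _ g dp(1) gq]) measurable
  have "(\<lambda>n. LINT x|N. (f n x - f0 x) * g x) \<longlonglongrightarrow> 0"
  proof (rule LIMSEQ_I)
    fix e :: real assume "e > 0"
    define \<kappa> where "\<kappa> = e / (2 * (2 powr p * (A + A) + 1))"
    have c0: "0 \<le> 2 powr p * (A + A)" using A0 by simp
    have \<kappa>: "\<kappa> > 0" unfolding \<kappa>_def using \<open>e > 0\<close> by (intro divide_pos_pos mult_pos_pos add_nonneg_pos c0) auto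
    have \<kappa>e: "\<kappa> * (2 powr p * (A + A)) \<le> e / 2"
    proof -
      have "\<kappa> * (2 powr p * (A + A)) \<le> \<kappa> * (2 powr p * (A + A) + 1)" using \<kappa> by (intro mult_left_mono) auto
      also have "\<dots> = e / 2"
      proof -
        have "e / (2 * (c + 1)) * (c + 1) = e / 2" if "0 \<le> c" for c using that by (simp add: field_simps)
        from this[OF c0] show ?thesis unfolding \<kappa>_def .
      qed
      finally show ?thesis .
    qed
    define E where "E n x = max 0 (norm ((f n x - f0 x) * g x) - \<kappa> * norm (f n x - f0 x) powr p)" for n x
    let ?w = "\<lambda>x. \<kappa> powr (- (1 / (p - 1))) * norm (g x) powr (p / (p - 1))"
    have iw: "integrable N ?w" by (intro integrable_mult_right gq)
    have Em: "E n \<in> borel_measurable N" for n unfolding E_def by measurable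
    have Eb: "norm (E n x) \<le> ?w x" for n x
      using weighted_young[OF p \<kappa>, of "norm (f n x - f0 x)" "norm (g x)"] by (simp add: E_def norm_mult)
    have El: "AE x in N. (\<lambda>n. E n x) \<longlonglongrightarrow> 0"
      using lim
    proof eventually_elim
      case (elim x)
      have "(\<lambda>n. norm (f n x - f0 x) powr p) \<longlonglongrightarrow> norm (f0 x - f0 x) powr p"
        using p by (intro tendsto_powr' tendsto_intros elim) auto
      then have "(\<lambda>n. E n x) \<longlonglongrightarrow> max 0 (norm ((f0 x - f0 x) * g x) - \<kappa> * norm (f0 x - f0 x) powr p)"
        unfolding E_def by (intro tendsto_max tendsto_const tendsto_diff tendsto_norm tendsto_mult elim)
      then show ?case by simp
    qed
    have "(\<lambda>n. LINT x|N. E n x) \<longlonglongrightarrow> (LINT x|N. 0)"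
      by (rule integral_dominated_convergence[OF _ Em iw El]) (use Eb in auto)
    then have "(\<lambda>n. LINT x|N. E n x) \<longlonglongrightarrow> 0" by simp
    then obtain n0 where n0: "\<And>n. n \<ge> n0 \<Longrightarrow> norm ((LINT x|N. E n x) - 0) < e / 2"
      using LIMSEQ_D[of _ 0 "e / 2"] \<open>e > 0\<close> by (metis half_gt_zero)
    show "\<exists>n0. \<forall>n\<ge>n0. norm ((LINT x|N. (f n x - f0 x) * g x) - 0) < e"
    proof (intro exI[of _ n0] allI impI)
      fix n assume "n \<ge> n0"
      have iE: "integrable N (E n)" by (rule Bochner_Integration.integrable_bound[OF iw Em]) (use Eb in \<open>auto intro: order_trans\<close>)
      have "norm (LINT x|N. (f n x - f0 x) * g x) \<le> (LINT x|N. norm ((f n x - f0 x) * g x))"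
        by (rule integral_norm_bound)
      also have "\<dots> \<le> (LINT x|N. \<kappa> * norm (f n x - f0 x) powr p + E n x)"
      proof (rule integral_mono)
        show "norm ((f n x - f0 x) * g x) \<le> \<kappa> * norm (f n x - f0 x) powr p + E n x" for x by (simp add: E_def)
      qed (intro integrable_norm idg Bochner_Integration.integrable_add integrable_mult_right dp iE)+
      also have "\<dots> = \<kappa> * (LINT x|N. norm (f n x - f0 x) powr p) + (LINT x|N. E n x)"
        using dp(1) iE by simp
      also have "\<dots> \<le> \<kappa> * (2 powr p * (A + A)) + (LINT x|N. E n x)"
        using \<kappa> dp(2)[of n] by (intro add_mono mult_left_mono) auto
      also have "\<dots> < e" using \<kappa>e n0[OF \<open>n \<ge> n0\<close>] by (simp add: abs_less_iff)
      finally show "norm ((LINT x|N. (f n x - f0 x) * g x) - 0) < e" by simp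
    qed
  qed
  moreover have "(LINT x|N. (f n x - f0 x) * g x) = (LINT x|N. f n x * g x) - (LINT x|N. f0 x * g x)" for n
    unfolding left_diff_distrib by (rule Bochner_Integration.integral_diff[OF ifg i0])
  ultimately show "(\<lambda>n. LINT x|N. f n x * g x) \<longlonglongrightarrow> (LINT x|N. f0 x * g x)"
    by (simp add: LIM_zero_iff)
qed

text \<open>The two branches of the logarithm with cuts along the upper and the lower half of the imaginary axis;
  their difference replaces the winding number in the residue computation.\<close>

lemma Ln_rotation_diff:
  assumes "Re \<zeta> \<noteq> 0"
  shows "Ln (\<i> * \<zeta>) - Ln (- \<i> * \<zeta>) = (if Re \<zeta> > 0 then \<i> * pi else - (\<i> * pi))"
  using Ln_minus[of "\<i> * \<zeta>"] assms by (auto simp: complex_eq_iff)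

context lipschitz_graph begin

lemma kernel_lower:
  "(\<bar>N - height w\<bar> + \<bar>u - Re w\<bar>) / (2 * (1 + M)) \<le> norm (z u + \<i> * complex_of_real N - w)"
proof -
  let ?v = "z u + \<i> * complex_of_real N - w"
  have "\<bar>N - height w\<bar> \<le> (1 + M) * norm ?v"
    using height_lip[of "z u + \<i> * complex_of_real N" w] by simp
  moreover have "\<bar>u - Re w\<bar> \<le> (1 + M) * norm ?v"
  proof -
    have "\<bar>u - Re w\<bar> \<le> norm ?v" using abs_Re_le_cmod[of ?v] by simp
    also have "\<dots> \<le> (1 + M) * norm ?v" using M_pos by (simp add: algebra_simps)
    finally show ?thesis .
  qed
  ultimately have "\<bar>N - height w\<bar> + \<bar>u - Re w\<bar> \<le> (2 * (1 + M)) * norm ?v" by (simp add: algebra_simps)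
  then show ?thesis using M_pos by (simp add: pos_divide_le_eq mult.commute)
qed

text \<open>The Cauchy kernel with pole \<open>w\<close>, pulled back to the parameter of the graph shifted up by \<open>N\<close>.\<close>

definition kernel :: "real \<Rightarrow> complex \<Rightarrow> real \<Rightarrow> complex" where
  "kernel N w u = dz u / (z u + \<i> * complex_of_real N - w)"

lemma kernel_measurable [measurable]: "kernel N w \<in> borel_measurable lebesgue"
  unfolding kernel_def by measurable

lemma kernel_bound_AE:
  assumes "N \<noteq> height w"
  shows "AE u in lebesgue. norm (kernel N w u) \<le> (2 * (1 + M)\<^sup>2) / (\<bar>N - height w\<bar> + \<bar>u - Re w\<bar>)"
  using dz_bounds_AE
proof eventually_elim
  case (elim u)
  let ?s = "\<bar>N - height w\<bar> + \<bar>u - Re w\<bar>" and ?v = "norm (z u + \<i> * complex_of_real N - w)"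
  have s: "?s > 0" using assms by (intro add_pos_nonneg) auto
  then have s': "?s / (2 * (1 + M)) > 0" using M_pos by simp
  have "norm (kernel N w u) \<le> (1 + M) / (?s / (2 * (1 + M)))"
    unfolding kernel_def norm_divide
    using elim kernel_lower[of N w u] s' M_pos by (intro frac_le) auto
  also have "\<dots> = (2 * (1 + M)\<^sup>2) / ?s" by (simp add: power2_eq_square)
  finally show ?case .
qed

lemma kernel_powr_integrable:
  assumes "N \<noteq> height w" "q > 1"
  shows "integrable lebesgue (\<lambda>u. norm (kernel N w u) powr q)"
    and "(LINT u|lebesgue. norm (kernel N w u) powr q)
      \<le> (2 * (1 + M)\<^sup>2) powr q * (LINT u|lebesgue. (\<bar>N - height w\<bar> + \<bar>u - Re w\<bar>) powr (- q))"
proof -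
  let ?b = "\<lambda>u. (2 * (1 + M)\<^sup>2) powr q * (\<bar>N - height w\<bar> + \<bar>u - Re w\<bar>) powr (- q)"
  have s: "\<bar>N - height w\<bar> > 0" using assms by simp
  have ib: "integrable lebesgue ?b"
    by (intro integrable_mult_right integrable_abs_powr s assms)
  have le: "AE u in lebesgue. norm (kernel N w u) powr q \<le> ?b u"
    using kernel_bound_AE[OF assms(1)]
  proof eventually_elim
    case (elim u)
    have "norm (kernel N w u) powr q \<le> ((2 * (1 + M)\<^sup>2) / (\<bar>N - height w\<bar> + \<bar>u - Re w\<bar>)) powr q"
      using elim assms by (intro powr_mono2) auto
    also have "\<dots> = ?b u" by (simp add: powr_divide powr_minus_divide)
    finally show ?case .
  qed
  show i: "integrable lebesgue (\<lambda>u. norm (kernel N w u) powr q)"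
  proof (rule Bochner_Integration.integrable_bound[OF ib])
    show "AE u in lebesgue. norm (norm (kernel N w u) powr q) \<le> norm (?b u)" using le by eventually_elim simp
  qed measurable
  have "(LINT u|lebesgue. norm (kernel N w u) powr q) \<le> (LINT u|lebesgue. ?b u)"
    by (rule integral_mono_AE[OF i ib le])
  then show "(LINT u|lebesgue. norm (kernel N w u) powr q)
      \<le> (2 * (1 + M)\<^sup>2) powr q * (LINT u|lebesgue. (\<bar>N - height w\<bar> + \<bar>u - Re w\<bar>) powr (- q))" by simp
qed

text \<open>Write \<open>q = q1 + q2\<close> with \<open>q1 > 1\<close> and \<open>q2 > 0\<close>: the power \<open>q1\<close> keeps the integral finite, and the
  power \<open>q2\<close> of the distance between pole and graph makes it tend to zero.\<close>

lemma kernel_powr_tendsto_0: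
  assumes "q > 1"
  shows "(\<lambda>n. LINT u|lebesgue. norm (kernel (real n) w u) powr q) \<longlonglongrightarrow> 0"
proof -
  define q1 where "q1 = (q + 1) / 2"
  define q2 where "q2 = (q - 1) / 2"
  have q12: "q1 > 1" "q2 > 0" "q = q1 + q2" using assms by (auto simp: q1_def q2_def field_simps)
  let ?J = "LINT u|lebesgue. (1 + \<bar>u - Re w\<bar>) powr (- q1)" and ?C = "(2 * (1 + M)\<^sup>2) powr q"
  have lim: "filterlim (\<lambda>n. \<bar>real n - height w\<bar>) at_top sequentially"
  proof (rule filterlim_at_top_mono)
    show "filterlim (\<lambda>n. - height w + real n) at_top sequentially"
      by (rule filterlim_tendsto_add_at_top[OF tendsto_const filterlim_real_sequentially])
  qed (auto intro: always_eventually)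
  show ?thesis
  proof (rule Lim_null_comparison)
    have "((\<lambda>n. \<bar>real n - height w\<bar> powr (- q2)) \<longlongrightarrow> 0) sequentially"
      using q12 by (intro tendsto_neg_powr[OF _ lim]) auto
    then have "(\<lambda>n. ?C * (\<bar>real n - height w\<bar> powr (- q2) * ?J)) \<longlonglongrightarrow> ?C * (0 * ?J)" by (intro tendsto_intros)
    then show "(\<lambda>n. ?C * (\<bar>real n - height w\<bar> powr (- q2) * ?J)) \<longlonglongrightarrow> 0" by simp
    have "\<forall>\<^sub>F n in sequentially. 1 \<le> \<bar>real n - height w\<bar>" using lim unfolding filterlim_at_top by blast
    then show "\<forall>\<^sub>F n in sequentially. norm (LINT u|lebesgue. norm (kernel (real n) w u) powr q) \<le> ?C * (\<bar>real n - height w\<bar> powr (- q2) * ?J)"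
    proof eventually_elim
      case (elim n)
      let ?s = "\<bar>real n - height w\<bar>"
      have s: "real n \<noteq> height w" "?s > 0" using elim by auto
      have "(LINT u|lebesgue. (?s + \<bar>u - Re w\<bar>) powr (- q)) \<le> (LINT u|lebesgue. ?s powr (- q2) * (1 + \<bar>u - Re w\<bar>) powr (- q1))"
      proof (rule integral_mono)
        show "integrable lebesgue (\<lambda>u. (?s + \<bar>u - Re w\<bar>) powr (- q))" using assms s by (intro integrable_abs_powr) auto
        show "integrable lebesgue (\<lambda>u. ?s powr (- q2) * (1 + \<bar>u - Re w\<bar>) powr (- q1))"
          using q12 by (intro integrable_mult_right integrable_abs_powr) auto
        fix u
        have "(?s + \<bar>u - Re w\<bar>) powr (- q) = (?s + \<bar>u - Re w\<bar>) powr (- q2) * (?s + \<bar>u - Re w\<bar>) powr (- q1)"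
          unfolding powr_add[symmetric] using q12 by (simp add: add.commute)
        also have "\<dots> \<le> ?s powr (- q2) * (1 + \<bar>u - Re w\<bar>) powr (- q1)"
          using s q12 elim by (intro mult_mono powr_mono2') auto
        finally show "(?s + \<bar>u - Re w\<bar>) powr (- q) \<le> ?s powr (- q2) * (1 + \<bar>u - Re w\<bar>) powr (- q1)" .
      qed
      also have "\<dots> = ?s powr (- q2) * ?J" by simp
      finally have "?C * (LINT u|lebesgue. (?s + \<bar>u - Re w\<bar>) powr (- q)) \<le> ?C * (?s powr (- q2) * ?J)"
        by (intro mult_left_mono) auto
      then have "(LINT u|lebesgue. norm (kernel (real n) w u) powr q) \<le> ?C * (?s powr (- q2) * ?J)"
        using kernel_powr_integrable(2)[OF s(1) assms] by linarith
      then show ?case by simp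
    qed
  qed
qed

end

context hardy_function begin

lemma slice_kernel_integrable:
  assumes "\<tau> > 0" "\<tau> \<noteq> height w"
  shows "integrable lebesgue (\<lambda>u. F (z u + \<i> * complex_of_real \<tau>) * kernel \<tau> w u)"
    and "\<kappa> > 0 \<Longrightarrow> (LINT u|lebesgue. norm (F (z u + \<i> * complex_of_real \<tau>) * kernel \<tau> w u))
      \<le> \<kappa> * A + \<kappa> powr (- (1 / (p - 1))) * (LINT u|lebesgue. norm (kernel \<tau> w u) powr (p / (p - 1)))"
proof -
  have q: "p / (p - 1) > 1" using p by (simp add: field_simps)
  note y = integrable_product_young[OF p slice_measurable[OF assms(1)] kernel_measurable slice_integrable[OF assms(1)]
      kernel_powr_integrable(1)[OF assms(2) q]]
  show "integrable lebesgue (\<lambda>u. F (z u + \<i> * complex_of_real \<tau>) * kernel \<tau> w u)" by (rule y(1))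
  assume \<kappa>: "\<kappa> > 0"
  have "\<kappa> * (LINT u|lebesgue. norm (F (z u + \<i> * complex_of_real \<tau>)) powr p) \<le> \<kappa> * A"
    using \<kappa> slice_bound[OF assms(1)] by (intro mult_left_mono) auto
  then show "(LINT u|lebesgue. norm (F (z u + \<i> * complex_of_real \<tau>) * kernel \<tau> w u))
      \<le> \<kappa> * A + \<kappa> powr (- (1 / (p - 1))) * (LINT u|lebesgue. norm (kernel \<tau> w u) powr (p / (p - 1)))"
    using y(2)[OF \<kappa>] by linarith
qed

text \<open>Cauchy's formula on the region between the slices at heights \<open>\<tau>\<close> and \<open>N\<close> and the vertical lines
  through \<open>R\<close> and \<open>-R\<close>. A primitive of \<open>F v / (v - w)\<close> is \<open>P v + F w * Ln (c * (v - w))\<close> with \<open>P\<close> a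
  primitive of the difference quotient: for \<open>c = \<i>\<close> the cut goes up from \<open>w\<close> and misses the bottom and
  the sides, for \<open>c = - \<i>\<close> it goes down and misses the top. The mismatch of the two at the upper
  corners yields \<open>2 * pi * \<i> * F w\<close>, and the sides are estimated by the bound for \<open>F\<close>.\<close>

lemma box_formula:
  assumes \<tau>: "0 < \<tau>" "\<tau> < height w" "height w < N" and R: "\<bar>Re w\<bar> < R"
    and B: "\<And>v. \<tau> \<le> height v \<Longrightarrow> norm (F v) \<le> B"
  shows "norm ((LINT u:{-R..R}|lebesgue. F (z u + \<i> * complex_of_real \<tau>) * kernel \<tau> w u)
    - (LINT u:{-R..R}|lebesgue. F (z u + \<i> * complex_of_real N) * kernel N w u) - 2 * pi * \<i> * F w)
    \<le> 2 * (B / (R - \<bar>Re w\<bar>) * (N - \<tau>))"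
proof -
  define Q where "Q v = (if v = w then deriv F w else (F v - F w) / (v - w))" for v
  have "Q holomorphic_on \<Omega>" unfolding Q_def by (rule pole_lemma_open[OF F_hol open_\<Omega>])
  then obtain P where P: "\<And>v. v \<in> \<Omega> \<Longrightarrow> (P has_field_derivative Q v) (at v)"
    using primitive_on_\<Omega> by blast
  define \<Lambda> where "\<Lambda> c v = P v + F w * Ln (c * (v - w))" for c v
  define U where "U c = \<Omega> \<inter> {v. c * (v - w) \<notin> \<real>\<^sub>\<le>\<^sub>0}" for c
  have openU: "open (U c)" for c
  proof -
    have "open ((\<lambda>v. c * (v - w)) -` (- \<real>\<^sub>\<le>\<^sub>0))"
      by (intro open_vimage continuous_intros) (simp add: open_Compl)
    moreover have "(\<lambda>v. c * (v - w)) -` (- \<real>\<^sub>\<le>\<^sub>0) = {v. c * (v - w) \<notin> \<real>\<^sub>\<le>\<^sub>0}" by auto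
    ultimately show ?thesis unfolding U_def using open_\<Omega> by (intro open_Int) auto
  qed
  have der: "(\<Lambda> c has_field_derivative F v / (v - w)) (at v)" if v: "v \<in> U c" for c v
  proof -
    have nz: "c * (v - w) \<noteq> 0" and v\<Omega>: "v \<in> \<Omega>" and nn: "c * (v - w) \<notin> \<real>\<^sub>\<le>\<^sub>0" using v by (auto simp: U_def)
    have "(\<Lambda> c has_field_derivative (Q v + F w * (inverse (c * (v - w)) * c))) (at v)"
      unfolding \<Lambda>_def using nn by (auto intro!: derivative_eq_intros P[OF v\<Omega>] simp: field_simps)
    moreover have "Q v + F w * (inverse (c * (v - w)) * c) = F v / (v - w)"
    proof -
      have "inverse (c * (v - w)) * c = 1 / (v - w)" "v \<noteq> w" using nz by (auto simp: field_simps)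
      then show ?thesis by (simp add: Q_def diff_divide_distrib)
    qed
    ultimately show ?thesis by simp
  qed
  have RR: "- R \<le> R" using R by linarith
  have inU1: "z u + \<i> * complex_of_real \<tau> \<in> U \<i>" for u
  proof -
    have "Re w = u \<Longrightarrow> a u + \<tau> < Im w" using \<tau> by (auto simp: height_def)
    then show ?thesis unfolding U_def using \<tau> by (auto simp: z_in_\<Omega> complex_nonpos_Reals_iff)
  qed
  have inU2: "z u + \<i> * complex_of_real N \<in> U (- \<i>)" for u
  proof -
    have "Re w = u \<Longrightarrow> Im w < a u + N" using \<tau> by (auto simp: height_def)
    then show ?thesis unfolding U_def using \<tau> by (auto simp: z_in_\<Omega> complex_nonpos_Reals_iff)
  qed
  have bot: "(LINT u:{-R..R}|lebesgue. F (z u + \<i> * complex_of_real \<tau>) * kernel \<tau> w u)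
      = \<Lambda> \<i> (z R + \<i> * complex_of_real \<tau>) - \<Lambda> \<i> (z (-R) + \<i> * complex_of_real \<tau>)"
    using graph_integral_derivative(2)[OF openU der RR inU1] by (simp add: kernel_def)
  have top: "(LINT u:{-R..R}|lebesgue. F (z u + \<i> * complex_of_real N) * kernel N w u)
      = \<Lambda> (- \<i>) (z R + \<i> * complex_of_real N) - \<Lambda> (- \<i>) (z (-R) + \<i> * complex_of_real N)"
    using graph_integral_derivative(2)[OF openU der RR inU2] by (simp add: kernel_def)
  have side: "norm (\<Lambda> \<i> (z x + \<i> * complex_of_real N) - \<Lambda> \<i> (z x + \<i> * complex_of_real \<tau>)) \<le> B / (R - \<bar>Re w\<bar>) * (N - \<tau>)"
    if x: "\<bar>x\<bar> = R" for x
  proof -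
    have B0: "0 \<le> B" using B[of w] \<tau> norm_ge_zero[of "F w"] by linarith
    have xr: "R - \<bar>Re w\<bar> \<le> \<bar>x - Re w\<bar>" using x by linarith
    have "norm (\<Lambda> \<i> (z x + \<i> * complex_of_real N) - \<Lambda> \<i> (z x + \<i> * complex_of_real \<tau>)) \<le> B / (R - \<bar>Re w\<bar>) * norm (N - \<tau>)"
    proof (rule vector_derivative_bound[where S="{\<tau>..N}" and f'="\<lambda>s. \<i> * (F (z x + \<i> * complex_of_real s) / (z x + \<i> * complex_of_real s - w))"])
      fix s assume s: "s \<in> {\<tau>..N}"
      let ?v = "z x + \<i> * complex_of_real s"
      have inU: "?v \<in> U \<i>" unfolding U_def using s \<tau> x R by (auto simp: z_in_\<Omega> complex_nonpos_Reals_iff)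
      have "((\<lambda>s. z x + \<i> * complex_of_real s) has_vector_derivative \<i>) (at s)"
        by (auto intro!: derivative_eq_intros)
      from field_vector_diff_chain_at[OF this der[OF inU]]
      have "((\<lambda>s. \<Lambda> \<i> (z x + \<i> * complex_of_real s)) has_vector_derivative \<i> * (F ?v / (?v - w))) (at s)"
        by (simp add: o_def)
      then show "((\<lambda>s. \<Lambda> \<i> (z x + \<i> * complex_of_real s)) has_vector_derivative \<i> * (F ?v / (?v - w))) (at s within {\<tau>..N})"
        by (rule has_vector_derivative_at_within)
      have "R - \<bar>Re w\<bar> \<le> norm (?v - w)" using xr abs_Re_le_cmod[of "?v - w"] by simp
      then have "norm (F ?v) / norm (?v - w) \<le> B / (R - \<bar>Re w\<bar>)"
        using s R B0 by (intro frac_le B) auto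
      then show "norm (\<i> * (F ?v / (?v - w))) \<le> B / (R - \<bar>Re w\<bar>)" by (simp add: norm_mult norm_divide)
    qed (use \<tau> in auto)
    then show ?thesis using \<tau> by simp
  qed
  have jump: "\<Lambda> \<i> (z x + \<i> * complex_of_real N) - \<Lambda> (- \<i>) (z x + \<i> * complex_of_real N) = F w * (if x > Re w then \<i> * pi else - (\<i> * pi))"
    if "x \<noteq> Re w" for x
  proof -
    have "\<Lambda> \<i> (z x + \<i> * complex_of_real N) - \<Lambda> (- \<i>) (z x + \<i> * complex_of_real N)
      = F w * (Ln (\<i> * (z x + \<i> * complex_of_real N - w)) - Ln (- \<i> * (z x + \<i> * complex_of_real N - w)))"
      unfolding \<Lambda>_def by (simp add: right_diff_distrib)
    also have "\<dots> = F w * (if x > Re w then \<i> * pi else - (\<i> * pi))"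
      by (subst Ln_rotation_diff) (use that in auto)
    finally show ?thesis .
  qed
  define S1 where "S1 = \<Lambda> \<i> (z R + \<i> * complex_of_real N) - \<Lambda> \<i> (z R + \<i> * complex_of_real \<tau>)"
  define S2 where "S2 = \<Lambda> \<i> (z (-R) + \<i> * complex_of_real N) - \<Lambda> \<i> (z (-R) + \<i> * complex_of_real \<tau>)"
  have "R > Re w" "- R < Re w" using R by auto
  then have j1: "\<Lambda> (- \<i>) (z R + \<i> * complex_of_real N) = \<Lambda> \<i> (z R + \<i> * complex_of_real N) - F w * (\<i> * pi)"
    and j2: "\<Lambda> (- \<i>) (z (-R) + \<i> * complex_of_real N) = \<Lambda> \<i> (z (-R) + \<i> * complex_of_real N) + F w * (\<i> * pi)"
    using jump[of R] jump[of "-R"] by (auto simp: algebra_simps)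
  have "(LINT u:{-R..R}|lebesgue. F (z u + \<i> * complex_of_real \<tau>) * kernel \<tau> w u)
    - (LINT u:{-R..R}|lebesgue. F (z u + \<i> * complex_of_real N) * kernel N w u) - 2 * pi * \<i> * F w = S2 - S1"
    unfolding bot top j1 j2 S1_def S2_def by (simp add: algebra_simps)
  also have "norm \<dots> \<le> norm S2 + norm S1" by (rule norm_triangle_ineq4)
  also have "\<dots> \<le> B / (R - \<bar>Re w\<bar>) * (N - \<tau>) + B / (R - \<bar>Re w\<bar>) * (N - \<tau>)"
    unfolding S1_def S2_def using R by (intro add_mono side) auto
  finally show ?thesis by simp
qed

text \<open>Let first \<open>R\<close> tend to infinity in \<open>box_formula\<close>: the sides vanish as \<open>F\<close> is bounded at positive
  height. Then let \<open>N\<close> tend to infinity: by Young's inequality with weight \<open>\<kappa>\<close> the top contributes at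
  most \<open>\<kappa> * A\<close> in the limit. Finally \<open>\<kappa>\<close> is arbitrary.\<close>

lemma cauchy_formula_slice:
  assumes \<tau>: "0 < \<tau>" "\<tau> < height w"
  shows "(LINT u|lebesgue. F (z u + \<i> * complex_of_real \<tau>) * kernel \<tau> w u) = 2 * pi * \<i> * F w"
proof -
  obtain B where B: "B > 0" "\<And>v. \<tau> \<le> height v \<Longrightarrow> norm (F v) \<le> B" using F_bounded_above[OF \<tau>(1)] by blast
  have q: "p / (p - 1) > 1" using p by (simp add: field_simps)
  let ?f = "\<lambda>N u. F (z u + \<i> * complex_of_real N) * kernel N w u"
  let ?I = "LINT u|lebesgue. ?f \<tau> u"
  have int: "integrable lebesgue (?f \<tau>)" using \<tau> by (intro slice_kernel_integrable) auto
  have conv: "(\<lambda>n. LINT u:{-real n..real n}|lebesgue. ?f \<tau> u) \<longlonglongrightarrow> ?I"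
    unfolding set_lebesgue_integral_def
  proof (rule integral_dominated_convergence)
    show "integrable lebesgue (\<lambda>u. norm (?f \<tau> u))" by (rule integrable_norm[OF int])
    show "AE u in lebesgue. (\<lambda>n. indicat_real {-real n..real n} u *\<^sub>R ?f \<tau> u) \<longlonglongrightarrow> ?f \<tau> u"
    proof (intro AE_I2 tendsto_eventually)
      fix u
      obtain n0 :: nat where "\<bar>u\<bar> \<le> real n0" using real_arch_simple by blast
      then show "\<forall>\<^sub>F n in sequentially. indicat_real {-real n..real n} u *\<^sub>R ?f \<tau> u = ?f \<tau> u"
        by (intro eventually_sequentiallyI[of n0]) (auto simp: indicator_def)
    qed
    show "?f \<tau> \<in> borel_measurable lebesgue" using int by auto
    then show "(\<lambda>u. indicat_real {-real n..real n} u *\<^sub>R ?f \<tau> u) \<in> borel_measurable lebesgue" for n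
      by (intro borel_measurable_scaleR borel_measurable_indicator) auto
    show "AE u in lebesgue. norm (indicat_real {-real n..real n} u *\<^sub>R ?f \<tau> u) \<le> norm (?f \<tau> u)" for n
      by (auto simp: indicator_def)
  qed
  have bound: "norm (?I - 2 * pi * \<i> * F w) \<le> \<kappa> * A + \<kappa> powr (- (1 / (p - 1))) * (LINT u|lebesgue. norm (kernel N w u) powr (p / (p - 1)))"
    if N: "height w < N" and \<kappa>: "\<kappa> > 0" for N \<kappa>
  proof (rule LIMSEQ_le)
    let ?K = "\<kappa> * A + \<kappa> powr (- (1 / (p - 1))) * (LINT u|lebesgue. norm (kernel N w u) powr (p / (p - 1)))"
    show "(\<lambda>n. norm ((LINT u:{-real n..real n}|lebesgue. ?f \<tau> u) - 2 * pi * \<i> * F w)) \<longlonglongrightarrow> norm (?I - 2 * pi * \<i> * F w)"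
      by (intro tendsto_intros conv)
    have "filterlim (\<lambda>n. - \<bar>Re w\<bar> + real n) at_top sequentially"
      by (rule filterlim_tendsto_add_at_top[OF tendsto_const filterlim_real_sequentially])
    then have "(\<lambda>n. B / (- \<bar>Re w\<bar> + real n)) \<longlonglongrightarrow> 0"
      by (intro tendsto_divide_0[OF tendsto_const] filterlim_at_top_imp_at_infinity)
    then have "(\<lambda>n. 2 * (B / (- \<bar>Re w\<bar> + real n) * (N - \<tau>)) + ?K) \<longlonglongrightarrow> 2 * (0 * (N - \<tau>)) + ?K" by (intro tendsto_intros)
    then show "(\<lambda>n. 2 * (B / (real n - \<bar>Re w\<bar>) * (N - \<tau>)) + ?K) \<longlonglongrightarrow> ?K" by simp
    obtain n0 :: nat where n0: "\<bar>Re w\<bar> < real n0" using reals_Archimedean2 by blast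
    show "\<exists>n0. \<forall>n\<ge>n0. norm ((LINT u:{-real n..real n}|lebesgue. ?f \<tau> u) - 2 * pi * \<i> * F w) \<le> 2 * (B / (real n - \<bar>Re w\<bar>) * (N - \<tau>)) + ?K"
    proof (intro exI[of _ n0] allI impI)
      fix n assume "n \<ge> n0"
      then have R: "\<bar>Re w\<bar> < real n" using n0 by linarith
      have Ni: "0 < N" "N \<noteq> height w" using N \<tau> by auto
      have intN: "integrable lebesgue (?f N)" by (rule slice_kernel_integrable(1)[OF Ni])
      have sN: "set_integrable lebesgue {-real n..real n} (?f N)"
        unfolding set_integrable_def by (rule integrable_mult_indicator[OF _ intN]) auto
      have "norm (LINT u:{-real n..real n}|lebesgue. ?f N u) \<le> (LINT u:{-real n..real n}|lebesgue. norm (?f N u))"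
        by (rule set_integral_norm_bound[OF sN])
      also have "\<dots> \<le> (LINT u|lebesgue. norm (?f N u))"
        unfolding set_lebesgue_integral_def
        by (rule integral_mono[OF integrable_mult_indicator[OF _ integrable_norm[OF intN]] integrable_norm[OF intN]])
           (auto simp: indicator_def)
      also have "\<dots> \<le> ?K" by (rule slice_kernel_integrable(2)[OF Ni \<kappa>])
      finally have top: "norm (LINT u:{-real n..real n}|lebesgue. ?f N u) \<le> ?K" .
      show "norm ((LINT u:{-real n..real n}|lebesgue. ?f \<tau> u) - 2 * pi * \<i> * F w) \<le> 2 * (B / (real n - \<bar>Re w\<bar>) * (N - \<tau>)) + ?K"
        using box_formula[OF \<tau> N R B(2)] top
          norm_triangle_ineq[of "(LINT u:{-real n..real n}|lebesgue. ?f \<tau> u) - (LINT u:{-real n..real n}|lebesgue. ?f N u) - 2 * pi * \<i> * F w" "LINT u:{-real n..real n}|lebesgue. ?f N u"]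
        by (simp add: algebra_simps)
    qed
  qed
  have "norm (?I - 2 * pi * \<i> * F w) \<le> \<kappa> * A" if \<kappa>: "\<kappa> > 0" for \<kappa>
  proof (rule LIMSEQ_le_const)
    have "(\<lambda>n. \<kappa> * A + \<kappa> powr (- (1 / (p - 1))) * (LINT u|lebesgue. norm (kernel (real n) w u) powr (p / (p - 1))))
       \<longlonglongrightarrow> \<kappa> * A + \<kappa> powr (- (1 / (p - 1))) * 0"
      by (intro tendsto_intros kernel_powr_tendsto_0 q)
    then show "(\<lambda>n. \<kappa> * A + \<kappa> powr (- (1 / (p - 1))) * (LINT u|lebesgue. norm (kernel (real n) w u) powr (p / (p - 1)))) \<longlonglongrightarrow> \<kappa> * A"
      by simp
    obtain n0 :: nat where n0: "height w < real n0" using reals_Archimedean2 by blast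
    show "\<exists>n0. \<forall>n\<ge>n0. norm (?I - 2 * pi * \<i> * F w) \<le> \<kappa> * A + \<kappa> powr (- (1 / (p - 1))) * (LINT u|lebesgue. norm (kernel (real n) w u) powr (p / (p - 1)))"
    proof (intro exI[of _ n0] allI impI)
      fix n assume "n \<ge> n0"
      then have "height w < real n" using n0 by linarith
      then show "norm (?I - 2 * pi * \<i> * F w) \<le> \<kappa> * A + \<kappa> powr (- (1 / (p - 1))) * (LINT u|lebesgue. norm (kernel (real n) w u) powr (p / (p - 1)))"
        by (rule bound[OF _ \<kappa>])
    qed
  qed
  then have "norm (?I - 2 * pi * \<i> * F w) \<le> 0 + e" if "e > 0" for e
  proof -
    have "e / (A + 1) > 0" using \<open>e > 0\<close> A_nonneg by simp
    from \<open>\<And>\<kappa>. \<kappa> > 0 \<Longrightarrow> norm (?I - 2 * pi * \<i> * F w) \<le> \<kappa> * A\<close>[OF this]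
    have "norm (?I - 2 * pi * \<i> * F w) \<le> e / (A + 1) * A" .
    also have "\<dots> \<le> e / (A + 1) * (A + 1)" using \<open>e > 0\<close> A_nonneg by (intro mult_left_mono) auto
    finally show ?thesis using A_nonneg by simp
  qed
  then have "norm (?I - 2 * pi * \<i> * F w) \<le> 0" by (rule field_le_epsilon)
  then show ?thesis by simp
qed

text \<open>The tangent is not vertical, so the vertical direction lies in one of the sectors.\<close>

lemma nontangential_imp_vertical:
  assumes "has_nontangential_limit a F (z u) l"
  shows "(\<lambda>n. F (z u + \<i> * complex_of_real (1 / real (Suc n)))) \<longlonglongrightarrow> l"
proof -
  obtain u0 \<phi>0 where u0: "z u = z u0" and \<phi>0: "\<phi>0 \<in> {-(pi/2)<..<pi/2}"
    and lim: "\<forall>\<phi>\<in>{0<..<pi/2}. (F \<longlongrightarrow> l) (at (z u) within sector (z u) \<phi>0 \<phi> \<inter> \<Omega>)"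
    using assms unfolding has_nontangential_limit_def by blast
  define \<phi> where "\<phi> = (pi/2 - \<bar>\<phi>0\<bar>) / 2"
  have \<phi>: "\<phi> \<in> {0<..<pi/2}" using \<phi>0 by (auto simp: \<phi>_def)
  define b where "b = \<bar>\<phi>0\<bar>"
  have "b < pi/2" "\<phi>0 \<le> b" "- \<phi>0 \<le> b" "\<phi> = (pi/2 - b) / 2" using \<phi>0 by (auto simp: b_def \<phi>_def)
  then have "\<phi> < pi/2 - \<phi>0" and "pi/2 - \<phi>0 < pi - \<phi>" by (simp_all add: field_simps)
  then have \<theta>: "pi/2 - \<phi>0 \<in> {\<phi><..<pi - \<phi>}" by simp
  have "filterlim (\<lambda>n. z u + \<i> * complex_of_real (1 / real (Suc n))) (at (z u) within sector (z u) \<phi>0 \<phi> \<inter> \<Omega>) sequentially"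
    unfolding filterlim_at
  proof
    have "(\<lambda>n. z u + \<i> * complex_of_real (1 / real (Suc n))) \<longlonglongrightarrow> z u + \<i> * complex_of_real 0"
      by (intro tendsto_intros LIMSEQ_inverse_real_of_nat[unfolded inverse_eq_divide])
    then show "(\<lambda>n. z u + \<i> * complex_of_real (1 / real (Suc n))) \<longlonglongrightarrow> z u" by simp
    have "z u + \<i> * complex_of_real (1 / real (Suc n)) \<in> sector (z u) \<phi>0 \<phi> \<inter> \<Omega>" for n
    proof
      have h: "1 / real (Suc n) > 0" by simp
      show "z u + \<i> * complex_of_real (1 / real (Suc n)) \<in> \<Omega>" by (rule z_in_\<Omega>[OF h])
      have "exp (\<i> * complex_of_real (pi/2)) = \<i>"
        unfolding cis_conv_exp[symmetric] by (rule cis_pi_half)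
      then have "z u + \<i> * complex_of_real (1 / real (Suc n)) = z u + complex_of_real (1 / real (Suc n)) * exp (\<i> * complex_of_real (pi/2))"
        by (simp only: mult.commute)
      then show "z u + \<i> * complex_of_real (1 / real (Suc n)) \<in> sector (z u) \<phi>0 \<phi>"
        unfolding sector_def using h \<theta> by blast
    qed
    then show "\<forall>\<^sub>F n in sequentially. z u + \<i> * complex_of_real (1 / real (Suc n)) \<in> sector (z u) \<phi>0 \<phi> \<inter> \<Omega> \<and> z u + \<i> * complex_of_real (1 / real (Suc n)) \<noteq> z u"
      by (intro always_eventually) (auto simp del: of_nat_Suc)
  qed
  with bspec[OF lim \<phi>] show ?thesis by (rule filterlim_compose)
qed

text \<open>The slices converge almost everywhere to the boundary values, with bounded \<open>p\<close>-norms, while the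
  kernel is a fixed function with integrable power \<open>p / (p - 1)\<close>: shifting slice and pole together
  leaves the kernel unchanged.\<close>

lemma cauchy_formula_boundary:
  assumes f: "AE u in lebesgue. has_nontangential_limit a F (z u) (f (z u))" and w: "w \<in> \<Omega>"
  shows "integrable lebesgue (\<lambda>u. f (z u) * kernel 0 w u)"
    and "(LINT u|lebesgue. f (z u) * kernel 0 w u) = 2 * pi * \<i> * F w"
proof -
  define h where "h n = 1 / real (Suc n)" for n
  have h: "h n > 0" for n by (simp add: h_def)
  let ?\<phi> = "\<lambda>n u. F (z u + \<i> * complex_of_real (h n))"
  have hw: "height w > 0" using w by (simp add: in_\<Omega>_iff)
  have q: "p / (p - 1) > 1" using p by (simp add: field_simps)
  have lim: "AE u in lebesgue. (\<lambda>n. ?\<phi> n u) \<longlonglongrightarrow> f (z u)"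
    using f unfolding h_def by eventually_elim (rule nontangential_imp_vertical)
  have m: "?\<phi> n \<in> borel_measurable lebesgue" for n by (rule slice_measurable[OF h])
  have fm: "(\<lambda>u. f (z u)) \<in> borel_measurable lebesgue"
  proof (rule borel_measurable_completion_cong_AE)
    show "(\<lambda>u. lim (\<lambda>n. ?\<phi> n u)) \<in> borel_measurable lebesgue" using m by (rule borel_measurable_lim_metric)
    show "AE u in lebesgue. lim (\<lambda>n. ?\<phi> n u) = f (z u)" using lim by eventually_elim (rule limI)
  qed
  note wc = weak_convergence_of_AE_bounded[OF p m fm kernel_measurable lim slice_integrable[OF h] slice_bound[OF h],
      of 0 w, OF kernel_powr_integrable(1)[OF _ q]]
  show "integrable lebesgue (\<lambda>u. f (z u) * kernel 0 w u)" by (rule wc(1)) (use hw in auto)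
  have lim1: "(\<lambda>n. LINT u|lebesgue. ?\<phi> n u * kernel 0 w u) \<longlonglongrightarrow> (LINT u|lebesgue. f (z u) * kernel 0 w u)"
    by (rule wc(2)) (use hw in auto)
  have slice: "(LINT u|lebesgue. ?\<phi> n u * kernel 0 w u) = 2 * pi * \<i> * F (w + \<i> * complex_of_real (h n))" for n
  proof -
    have "kernel 0 w u = kernel (h n) (w + \<i> * complex_of_real (h n)) u" for u by (simp add: kernel_def)
    then show ?thesis using cauchy_formula_slice[OF h, of n "w + \<i> * complex_of_real (h n)"] hw by simp
  qed
  have lim2: "(\<lambda>n. 2 * pi * \<i> * F (w + \<i> * complex_of_real (h n))) \<longlonglongrightarrow> 2 * pi * \<i> * F w"
  proof -
    have "(\<lambda>n. w + \<i> * complex_of_real (h n)) \<longlonglongrightarrow> w + \<i> * complex_of_real 0"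
      unfolding h_def by (intro tendsto_intros LIMSEQ_inverse_real_of_nat[unfolded inverse_eq_divide])
    then have t: "(\<lambda>n. w + \<i> * complex_of_real (h n)) \<longlonglongrightarrow> w" by simp
    have "isCont F w" using holomorphic_on_imp_continuous_on[OF F_hol] open_\<Omega> w continuous_on_eq_continuous_at by blast
    from isCont_tendsto_compose[OF this t] show ?thesis by (intro tendsto_intros)
  qed
  show "(LINT u|lebesgue. f (z u) * kernel 0 w u) = 2 * pi * \<i> * F w"
    by (rule LIMSEQ_unique[OF lim1[unfolded slice] lim2])
qed

end

theorem mainTheorem3:
  fixes a :: "real \<Rightarrow> real" and M p :: real and F :: "complex \<Rightarrow> complex"
  assumes "M > 0"
    and "\<And>u\<^sub>1 u\<^sub>2. \<bar>a u\<^sub>1 - a u\<^sub>2\<bar> \<le> M * \<bar>u\<^sub>1 - u\<^sub>2\<bar>"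
    and "1 < p"
    and "F \<in> hardy_space a p"
  shows "(AE \<zeta> in arc_length a. \<exists>l. has_nontangential_limit a F \<zeta> l) \<and>
    (\<forall>f. (AE \<zeta> in arc_length a. has_nontangential_limit a F \<zeta> (f \<zeta>)) \<longrightarrow>
      (\<forall>w\<in>upper_domain a.
         line_integrable a (\<lambda>\<zeta>. f \<zeta> / (\<zeta> - w)) \<and>
         F w = 1 / (2 * complex_of_real pi * \<i>) * line_integral a (\<lambda>\<zeta>. f \<zeta> / (\<zeta> - w))))"
proof -
  interpret lipschitz_graph a M by unfold_locales (use assms in auto)
  define S where "S = (SUP \<tau>\<in>{0<..}. \<integral>\<^sup>+\<zeta>. ennreal (norm (F (\<zeta> + \<i> * complex_of_real \<tau>)) powr p) \<partial>arc_length a)"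
  have F_hol: "F holomorphic_on \<Omega>" and S: "S < \<infinity>" using assms(4) by (auto simp: hardy_space_def S_def)
  have cont: "continuous_on T (\<lambda>w. norm (F (w + \<i> * complex_of_real \<tau>)) powr p)"
    if "\<tau> > 0" "T \<subseteq> graph_curve a" for \<tau> T
  proof -
    have "w + \<i> * complex_of_real \<tau> \<in> \<Omega>" if "w \<in> T" for w
      using \<open>\<tau> > 0\<close> \<open>T \<subseteq> graph_curve a\<close> that z_in_\<Omega> by (auto simp: graph_curve_def)
    then have "continuous_on T (\<lambda>w. F (w + \<i> * complex_of_real \<tau>))"
      by (intro continuous_on_compose2[OF holomorphic_on_imp_continuous_on[OF F_hol]] continuous_intros) auto
    then show ?thesis using assms(3) by (intro continuous_on_powr' continuous_intros) auto
  qed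
  have nn: "(\<integral>\<^sup>+u. ennreal (norm (F (z u + \<i> * complex_of_real \<tau>)) powr p) \<partial>lebesgue) \<le> S" if "\<tau> > 0" for \<tau>
  proof -
    have "(\<integral>\<^sup>+u. ennreal (norm (F (z u + \<i> * complex_of_real \<tau>)) powr p) \<partial>lebesgue)
      \<le> (\<integral>\<^sup>+u. ennreal (norm (F (z u + \<i> * complex_of_real \<tau>)) powr p) * ennreal (norm (dz u)) \<partial>lebesgue)"
    proof (rule nn_integral_mono_AE)
      show "AE u in lebesgue. ennreal (norm (F (z u + \<i> * complex_of_real \<tau>)) powr p) \<le> ennreal (norm (F (z u + \<i> * complex_of_real \<tau>)) powr p) * ennreal (norm (dz u))"
        using dz_bounds_AE
      proof eventually_elim
        case (elim u)
        then have "1 \<le> ennreal (norm (dz u))" by simp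
        from mult_left_mono[OF this, of "ennreal (norm (F (z u + \<i> * complex_of_real \<tau>)) powr p)"] show ?case by simp
      qed
    qed
    also have "\<dots> = (\<integral>\<^sup>+\<zeta>. ennreal (norm (F (\<zeta> + \<i> * complex_of_real \<tau>)) powr p) \<partial>arc_length a)"
      by (rule nn_integral_arc_length[symmetric]) (rule cont[OF that order_refl])
    also have "\<dots> \<le> S" unfolding S_def using that by (intro SUP_upper) auto
    finally show ?thesis .
  qed
  have SA: "S = ennreal (enn2real S)" using S by (simp add: less_top)
  have meas: "(\<lambda>u. norm (F (z u + \<i> * complex_of_real \<tau>)) powr p) \<in> borel_measurable lebesgue" if "\<tau> > 0" for \<tau>
  proof -
    have "continuous_on UNIV (\<lambda>u. norm (F (z u + \<i> * complex_of_real \<tau>)) powr p)"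
      by (rule continuous_on_compose2[OF cont[OF that order_refl] continuous_on_z]) (auto simp: graph_curve_def)
    then show ?thesis by (intro measurable_completion) (simp add: borel_measurable_continuous_onI)
  qed
  interpret hardy_function a M p "enn2real S" F
  proof
    show "integrable lebesgue (\<lambda>u. norm (F (z u + \<i> * complex_of_real \<tau>)) powr p)" if "\<tau> > 0" for \<tau>
      by (rule integrableI_nonneg) (use that meas in \<open>auto intro: order_le_less_trans[OF nn S[unfolded infinity_ennreal_def]]\<close>)
    show "(LINT u|lebesgue. norm (F (z u + \<i> * complex_of_real \<tau>)) powr p) \<le> enn2real S" if "\<tau> > 0" for \<tau>
      using nn[OF that] SA by (intro integral_real_bounded) auto
  qed (use assms(3) F_hol in auto)
  show ?thesis
  proof (intro conjI allI impI ballI)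
    show "AE \<zeta> in arc_length a. \<exists>l. has_nontangential_limit a F \<zeta> l"
      unfolding AE_arc_length_iff by (rule nontangential_limit_AE)
    fix f w assume f: "AE \<zeta> in arc_length a. has_nontangential_limit a F \<zeta> (f \<zeta>)" and w: "w \<in> \<Omega>"
    have eq: "f (z u) / (z u - w) * dz u = f (z u) * kernel 0 w u" for u by (simp add: kernel_def)
    note cf = cauchy_formula_boundary[OF f[unfolded AE_arc_length_iff] w]
    show "line_integrable a (\<lambda>\<zeta>. f \<zeta> / (\<zeta> - w))" unfolding line_integrable_def eq by (rule cf(1))
    show "F w = 1 / (2 * complex_of_real pi * \<i>) * line_integral a (\<lambda>\<zeta>. f \<zeta> / (\<zeta> - w))"
      unfolding line_integral_def eq cf(2) by simp
  qed
qed

end
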